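(* Let $s\in(0,1)$, let $\Omega\subset\mathbb{R}^N$ be a bounded open set, let $f\in L^2(\mathbb{R}^N)$ and let $h\in\mathbb{R}^N$ with $|h|<1$. Assume that $\phi\in W^{1,\infty}(\mathbb{R}^N)$ satisfies $0\le\phi(x)\le 1$ and $\mathrm{supp}\,\phi\subseteq B_1(0)$. Assume that $u\in\mathcal{X}^s_0(\Omega)$ is the weak solution of $(-\Delta)^s u=f$ in $\Omega$, $u=0$ in $\mathbb{R}^N\setminus\Omega$, and that $\phi u_h\in\mathcal{X}^s_0(\Omega)$, where $u_h(x):=u(x+h)$. Set $T_hu:=\phi u_h+(1-\phi)u$. Then there is a constant $C$, depending only on $N$, $s$, $\mathrm{Lip}\,\phi$ and $\mathrm{diam}\,\Omega$, such that $$\|T_hu-u\|^2_{L^2(\mathbb{R}^N)}\le\|u_h-u\|^2_{L^2(\mathbb{R}^N)}\le C|h|^{2s}\|f\|^2_{\mathcal{X}^s_0(\Omega)'}.$$ Moreover, if $\Omega$ satisfies a $(\rho,\theta)$-Lipschitz cone condition for some $\rho\in(0,+\infty)$, $\theta\in(0,\pi/2)$ and $|h|\le\frac{\rho\sin\theta}{4}$, then there is a constant $\tilde C$, depending only on $N$, $s$, $\mathrm{Lip}\,\phi$, $\mathrm{diam}\,\Omega$, $\rho$ and $\theta$, such that $$\|T_hu-u\|_s^2\le\tilde C|h|^s\|f\|_{L^2(\mathbb{R}^N)}\|f\|_{H^{-s}(\mathbb{R}^N)}.$$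
   Context: Gagliardo seminorm: $\|v\|_s^2:=\iint_{\mathbb{R}^{2N}}\frac{|v(x)-v(y)|^2}{|x-y|^{N+2s}}\,dx\,dy$. For an open set $\Omega\subseteq\mathbb{R}^N$, $\mathcal{X}^s_0(\Omega):=\{v\in H^s(\mathbb{R}^N): v=0\text{ a.e. in }\mathbb{R}^N\setminus\Omega\}$, with norm $(\|v\|^2_{L^2(\mathbb{R}^N)}+\|v\|_s^2)^{1/2}$; $\mathcal{X}^s_0(\Omega)'$ is its dual, and $H^{-s}(\mathbb{R}^N)$ is the dual of $H^s(\mathbb{R}^N)$ (normed by $(\|v\|^2_{L^2}+\|v\|_s^2)^{1/2}$). A function $f\in L^2(\mathbb{R}^N)$ is viewed as the functional $\langle f,\varphi\rangle=\int_{\mathbb{R}^N} f\varphi\,dx$. $(-\Delta)^{s/2}$ is the Fourier multiplier with symbol $|\xi|^s$. Weak solution of $(-\Delta)^su=f$ in $\Omega$, $u=0$ in $\mathbb{R}^N\setminus\Omega$: $u\in\mathcal{X}^s_0(\Omega)$ with $\int_{\mathbb{R}^N}(-\Delta)^{s/2}u\,(-\Delta)^{s/2}\varphi\,dx=\langle f,\varphi\rangle$ for all $\varphi\in\mathcal{X}^s_0(\Omega)$ (it exists and is unique for bounded $\Omega$). $\mathrm{Lip}\,\phi$ is the Lipschitz constant of $\phi$ and $\mathrm{diam}\,\Omega=\sup_{x,y\in\Omega}|x-y|$. Lipschitz cone condition: for a unit vector $\mathbf n$, $\rho>0$ and $\theta\in(0,\pi/2)$ let $\mathcal{C}_{\rho,\theta}(\mathbf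 n):=\{\mathbf v\in\mathbb{R}^N:0<|\mathbf v|<\rho,\ \mathbf v\cdot\mathbf n>|\mathbf v|\cos\theta\}$. For an open set $\Omega$ and $x_0\in\mathbb{R}^N$ let $\mathcal{N}_{\rho,\theta}(x_0,\Omega)$ be the set of unit vectors $\mathbf n$ such that for every $\mathbf v\in\mathcal{C}_{\rho,\theta}(\mathbf n)$: (i) $y-\mathbf v\in\Omega$ for every $y\in B_{3\rho}(x_0)\cap\Omega$; (ii) $y+\mathbf v\in\mathbb{R}^N\setminus\Omega$ for every $y\in B_{3\rho}(x_0)\setminus\Omega$. $\Omega$ satisfies the (uniform) $(\rho,\theta)$-Lipschitz cone condition if $\mathcal{N}_{\rho,\theta}(x_0,\Omega)\ne\emptyset$ for all $x_0\in\mathbb{R}^N$. *)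

theory Defs
  imports "HOL-Analysis.Analysis"
begin

text \<open>
  \<open>\<real>\<^sup>N\<close> is a type \<open>'a::euclidean_space\<close> with \<open>N = DIM('a)\<close>. Functions are
  representatives, Lebesgue measurable, of their almost-everywhere classes.
  Quantities that could be infinite are kept in \<^typ>\<open>ennreal\<close>.
\<close>

section \<open>Lebesgue spaces\<close>

definition Ltwo :: "('a::euclidean_space \<Rightarrow> 'b::real_normed_vector) set" where
  "Ltwo = {f \<in> borel_measurable lebesgue. integrable lebesgue (\<lambda>x. (norm (f x))\<^sup>2)}"

definition Linfty :: "('a::euclidean_space \<Rightarrow> 'b::real_normed_vector) set" where
  "Linfty = {f \<in> borel_measurable lebesgue. \<exists>M. AE x in lebesgue. norm (f x) \<le> M}"

definition L2_normsq :: "('a::euclidean_space \<Rightarrow> 'b::real_normed_vector) \<Rightarrow> ennreal" where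
  "L2_normsq f = (\<integral>\<^sup>+x. ennreal ((norm (f x))\<^sup>2) \<partial>lebesgue)"

definition L2_norm :: "('a::euclidean_space \<Rightarrow> 'b::real_normed_vector) \<Rightarrow> real" where
  "L2_norm f = sqrt (enn2real (L2_normsq f))"

section \<open>Fractional Sobolev spaces and dual norms\<close>

text \<open>The integrand is \<open>0\<close> on the diagonal, a null set, since \<open>0 / 0 = 0\<close>.\<close>

definition gagliardo_sq :: "real \<Rightarrow> ('a::euclidean_space \<Rightarrow> real) \<Rightarrow> ennreal" where
  "gagliardo_sq s v =
     (\<integral>\<^sup>+(x, y). ennreal (\<bar>v x - v y\<bar>\<^sup>2 / norm (x - y) powr (real DIM('a) + 2 * s))
        \<partial>(lebesgue :: ('a \<times> 'a) measure))"

definition Hs :: "real \<Rightarrow> ('a::euclidean_space \<Rightarrow> real) set" where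
  "Hs s = {v \<in> Ltwo. gagliardo_sq s v < \<infinity>}"

definition Hs_norm :: "real \<Rightarrow> ('a::euclidean_space \<Rightarrow> real) \<Rightarrow> real" where
  "Hs_norm s v = sqrt (enn2real (L2_normsq v + gagliardo_sq s v))"

definition X0 :: "real \<Rightarrow> 'a::euclidean_space set \<Rightarrow> ('a \<Rightarrow> real) set" where
  "X0 s \<Omega> = {v \<in> Hs s. AE x in lebesgue. x \<notin> \<Omega> \<longrightarrow> v x = 0}"

definition pairing :: "('a::euclidean_space \<Rightarrow> real) \<Rightarrow> ('a \<Rightarrow> real) \<Rightarrow> real" where
  "pairing f v = (LINT x|lebesgue. f x * v x)"

text \<open>Norm of a functional \<open>F\<close> on a subspace \<open>V\<close> of \<open>H\<^sup>s\<close>; a real supremum, so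
  meaningful for bounded \<open>F\<close> only, e.g. \<open>F = pairing f\<close> with \<open>f\<close> in \<open>L\<^sup>2\<close>.\<close>

definition dual_norm ::
    "real \<Rightarrow> ('a::euclidean_space \<Rightarrow> real) set \<Rightarrow> (('a \<Rightarrow> real) \<Rightarrow> real) \<Rightarrow> real" where
  "dual_norm s V F = (SUP v\<in>{v \<in> V. Hs_norm s v \<le> 1}. \<bar>F v\<bar>)"

section \<open>The fractional Laplacian as a Fourier multiplier\<close>

text \<open>The normalisation is the unitary one with phase \<open>x \<bullet> \<xi>\<close>, for which \<open>-\<Delta>\<close> has the
  symbol \<open>\<bar>\<xi>\<bar>\<^sup>2\<close>.\<close>

definition fourier :: "('a::euclidean_space \<Rightarrow> complex) \<Rightarrow> 'a \<Rightarrow> complex" where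
  "fourier u \<xi> = complex_of_real ((2 * pi) powr (- real DIM('a) / 2)) *
     (LINT x|lebesgue. cis (- (x \<bullet> \<xi>)) * u x)"

text \<open>Fourier--Plancherel transform: the \<open>L\<^sup>2\<close>-limit of the transforms of the truncations,
  which are integrable. It is determined up to a null set.\<close>

definition fourier_L2 :: "('a::euclidean_space \<Rightarrow> complex) \<Rightarrow> 'a \<Rightarrow> complex" where
  "fourier_L2 u = (SOME U. U \<in> Ltwo \<and>
     ((\<lambda>R. L2_normsq (\<lambda>\<xi>. fourier (\<lambda>x. indicator (ball 0 R) x * u x) \<xi> - U \<xi>))
        \<longlongrightarrow> 0) at_top)"

definition inv_fourier_L2 :: "('a::euclidean_space \<Rightarrow> complex) \<Rightarrow> 'a \<Rightarrow> complex" where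
  "inv_fourier_L2 U x = fourier_L2 U (- x)"

definition fourier_multiplier ::
    "('a::euclidean_space \<Rightarrow> complex) \<Rightarrow> ('a \<Rightarrow> complex) \<Rightarrow> 'a \<Rightarrow> complex" where
  "fourier_multiplier m u = inv_fourier_L2 (\<lambda>\<xi>. m \<xi> * fourier_L2 u \<xi>)"

text \<open>\<open>half_frac_laplacian s\<close> is \<open>(-\<Delta>)\<^bsup>s/2\<^esup>\<close>.\<close>

definition half_frac_laplacian ::
    "real \<Rightarrow> ('a::euclidean_space \<Rightarrow> real) \<Rightarrow> 'a \<Rightarrow> complex" where
  "half_frac_laplacian s u =
     fourier_multiplier (\<lambda>\<xi>. complex_of_real (norm \<xi> powr s)) (\<lambda>x. complex_of_real (u x))"

definition weak_solution ::
    "real \<Rightarrow> 'a::euclidean_space set \<Rightarrow> ('a \<Rightarrow> real) \<Rightarrow> ('a \<Rightarrow> real) \<Rightarrow> bool" where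
  "weak_solution s \<Omega> f u \<longleftrightarrow> u \<in> X0 s \<Omega> \<and>
     (\<forall>v\<in>X0 s \<Omega>.
        (LINT x|lebesgue. half_frac_laplacian s u x * half_frac_laplacian s v x)
          = complex_of_real (pairing f v))"

section \<open>The space \<open>W\<^bsup>1,\<infinity>\<^esup>\<close> and the Lipschitz constant\<close>

text \<open>Weak gradient, tested against \<open>C\<^sup>1\<close> functions with compact support.\<close>

definition weak_gradient :: "('a::euclidean_space \<Rightarrow> real) \<Rightarrow> ('a \<Rightarrow> 'a) \<Rightarrow> bool" where
  "weak_gradient \<phi> g \<longleftrightarrow>
     (\<forall>\<psi> D. (\<forall>x. GDERIV \<psi> x :> D x) \<and> continuous_on UNIV D \<and>
            compact (closure {x. \<psi> x \<noteq> 0}) \<longrightarrow>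
        (\<forall>b\<in>Basis. (LINT x|lebesgue. \<phi> x * (D x \<bullet> b)) =
                   - (LINT x|lebesgue. (g x \<bullet> b) * \<psi> x)))"

definition W1_infty :: "('a::euclidean_space \<Rightarrow> real) set" where
  "W1_infty = {\<phi> \<in> Linfty. \<exists>g\<in>Linfty. weak_gradient \<phi> g}"

definition Lip :: "('a::euclidean_space \<Rightarrow> real) \<Rightarrow> real" where
  "Lip \<phi> = Inf {L. L-lipschitz_on UNIV \<phi>}"

section \<open>The Lipschitz cone condition\<close>

definition cone :: "real \<Rightarrow> real \<Rightarrow> 'a::euclidean_space \<Rightarrow> 'a set" where
  "cone \<rho> \<theta> n = {v. 0 < norm v \<and> norm v < \<rho> \<and> v \<bullet> n > norm v * cos \<theta>}"

definition cone_directions ::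
    "real \<Rightarrow> real \<Rightarrow> 'a::euclidean_space \<Rightarrow> 'a set \<Rightarrow> 'a set" where
  "cone_directions \<rho> \<theta> x0 \<Omega> = {n. norm n = 1 \<and>
     (\<forall>v\<in>cone \<rho> \<theta> n.
        (\<forall>y\<in>ball x0 (3 * \<rho>) \<inter> \<Omega>. y - v \<in> \<Omega>) \<and>
        (\<forall>y\<in>ball x0 (3 * \<rho>) - \<Omega>. y + v \<in> - \<Omega>))}"

definition lipschitz_cone_condition ::
    "real \<Rightarrow> real \<Rightarrow> 'a::euclidean_space set \<Rightarrow> bool" where
  "lipschitz_cone_condition \<rho> \<theta> \<Omega> \<longleftrightarrow> (\<forall>x0. cone_directions \<rho> \<theta> x0 \<Omega> \<noteq> {})"

section \<open>Translations\<close>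

definition shift :: "'a::euclidean_space \<Rightarrow> ('a \<Rightarrow> real) \<Rightarrow> 'a \<Rightarrow> real" where
  "shift h u x = u (x + h)"

definition local_shift ::
    "('a::euclidean_space \<Rightarrow> real) \<Rightarrow> 'a \<Rightarrow> ('a \<Rightarrow> real) \<Rightarrow> 'a \<Rightarrow> real" where
  "local_shift \<phi> h u x = \<phi> x * shift h u x + (1 - \<phi> x) * u x"

end

theory Submission
  imports Defs "HOL-Probability.Characteristic_Functions"
begin

text \<open>
  The weak equation is written with a Fourier multiplier, but the estimates live on the
  Gagliardo double integral \<open>E(u)\<close>. The bridge is \<open>half_frac_laplacian_form\<close>: the bilinear form of
  the equation is a positive multiple \<open>c\<close> of the polarisation \<open>(E(u + v) - E(u) - E(v)) / 2\<close>.

  To build the bridge, regularise with the heat kernel \<open>G\<^sub>t\<close>. Fubini and the Fourier transform of a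
  Gaussian give
  \<open>\<integral> \<bar>Fg\<bar>\<^sup>2 exp (- t \<bar>\<xi>\<bar>\<^sup>2) + 1/2 \<integral>\<integral> \<bar>g(x) - g(y)\<bar>\<^sup>2 G\<^sub>t(x - y) = \<parallel>g\<parallel>\<^sup>2\<close>
  (\<open>gauss_fourier_identity\<close>). Letting \<open>t\<close> tend to \<open>0\<close> yields Plancherel's theorem. Integrating the
  identity against \<open>t powr (- 1 - s)\<close> yields the energy identity: by scaling in the single variable
  \<open>t\<close>, the factor \<open>1 - exp (- t \<bar>\<xi>\<bar>\<^sup>2)\<close> becomes a multiple of \<open>\<bar>\<xi>\<bar> powr (2 s)\<close> and \<open>G\<^sub>t(z)\<close> becomes a
  multiple of \<open>\<bar>z\<bar> powr (- N - 2 s)\<close> (\<open>fourier_energy\<close>). Completeness of \<open>L\<^sup>2\<close> then carries the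
  Fourier--Plancherel transform to the square integrable symbol \<open>\<bar>\<xi>\<bar> powr s * Fu\<close>.

  Three facts about \<open>E\<close> remain. A translation by \<open>h\<close> moves a function by at most a constant times
  \<open>\<bar>h\<bar> powr s * sqrt E\<close> in \<open>L\<^sup>2\<close> (\<open>gag_translation_estimate\<close>, averaging over a ball between the
  two points). A function vanishing outside a bounded set is controlled by its energy
  (\<open>fractional_poincare\<close>, by interaction with a far ball). And
  \<open>E(T u) \<le> (1 + C \<bar>h\<bar> powr s) E(u)\<close> for the localised translation \<open>T u = \<phi> u\<^sub>h + (1 - \<phi>) u\<close>: its
  differences are a convex combination of those of \<open>u\<^sub>h\<close> and \<open>u\<close>, whose energy costs only a factor
  \<open>1 + Lip \<phi> \<bar>h\<bar>\<close> after translating back, plus a commutator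
  \<open>(\<phi>(x) - \<phi>(y)) (u\<^sub>h(y) - u(y))\<close> controlled by \<open>\<parallel>u\<^sub>h - u\<parallel>\<^sup>2\<close> (\<open>gag_local_shift_le\<close>). The Lipschitz
  bound on \<open>\<phi>\<close> comes from its weak gradient (\<open>W1_infty_lipschitz\<close>).

  The theorem follows by testing. With the solution itself, \<open>c E(u)\<close> is the pairing of \<open>f\<close> and \<open>u\<close>, so
  Poincare's inequality bounds \<open>E(u)\<close> by the square of the dual norm and the translation estimate gives
  the first part. With \<open>v = T u - u\<close>, expanding the square gives
  \<open>E(v) = E(T u) - E(u) - (2 / c) \<langle>f, v\<rangle>\<close>. The difference of energies is at most \<open>C \<bar>h\<bar> powr s * E(u)\<close>,
  and \<open>\<bar>\<langle>f, v\<rangle>\<bar> \<le> \<parallel>f\<parallel> \<parallel>v\<parallel>\<close>, where \<open>\<parallel>v\<parallel> \<le> C \<bar>h\<bar> powr s * sqrt (E(u))\<close>. Both terms have the required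
  form, because \<open>sqrt (E(u))\<close> is at most a multiple of the dual norm of \<open>f\<close>, and \<open>E(u)\<close>, being
  \<open>\<langle>f, u\<rangle> / c\<close>, at most a multiple of \<open>\<parallel>f\<parallel> * sqrt (E(u))\<close>.
\<close>

section \<open>Gaussian integrals\<close>

lemma integral_gauss_cis_real:
  fixes a \<xi> :: real
  assumes a: "a > 0"
  shows "integrable lborel (\<lambda>x. complex_of_real (exp (- a * x\<^sup>2)) * cis (x * \<xi>))" (is ?I)
    and "(LINT x|lborel. complex_of_real (exp (- a * x\<^sup>2)) * cis (x * \<xi>))
           = complex_of_real (sqrt (pi / a) * exp (- \<xi>\<^sup>2 / (4 * a)))" (is ?E)
proof -
  \<comment> \<open>the dilation that turns the integrand into the standard normal density\<close>
  define c where "c = sqrt (2 * a)"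
  have c: "c > 0" "c\<^sup>2 = 2 * a" using a by (auto simp: c_def)
  define t where "t = \<xi> / c"
  have int: "integrable lborel (\<lambda>x. std_normal_density x *\<^sub>R iexp (t * x))"
  proof (rule Bochner_Integration.integrable_bound)
    show "integrable lborel std_normal_density" by (rule integrable_normal_density) simp
    show "AE x in lborel. norm (std_normal_density x *\<^sub>R iexp (t * x)) \<le> norm (std_normal_density x)"
      by (auto simp: norm_mult)
  qed measurable
  have eq: "(std_normal_density (c * x)) *\<^sub>R iexp (t * (c * x))
      = of_real (1 / sqrt (2 * pi)) * (complex_of_real (exp (- a * x\<^sup>2)) * cis (x * \<xi>))" for x
  proof -
    have "t * (c * x) = x * \<xi>" using c by (simp add: t_def)
    then have "iexp (t * (c * x)) = cis (x * \<xi>)" by (simp only: cis_conv_exp)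
    moreover have "- (c * x)\<^sup>2 / 2 = - a * x\<^sup>2" using c by (simp add: power_mult_distrib)
    ultimately show ?thesis
      by (simp only: std_normal_density_def scaleR_conv_of_real of_real_mult mult.assoc)
  qed
  have "integrable lborel (\<lambda>x. (std_normal_density (0 + c * x)) *\<^sub>R iexp (t * (0 + c * x)))"
    using lborel_integrable_real_affine[OF int, of c 0] c by simp
  then have "integrable lborel (\<lambda>x. of_real (1 / sqrt (2 * pi)) *
      (complex_of_real (exp (- a * x\<^sup>2)) * cis (x * \<xi>)))"
    by (simp only: add_0 eq)
  from integrable_mult_right[OF this, of "complex_of_real (sqrt (2 * pi))"] show ?I
    by (simp only: mult.assoc[symmetric] of_real_mult[symmetric]) simp
  have "complex_of_real (exp (- t\<^sup>2 / 2)) = (LINT x|lborel. std_normal_density x *\<^sub>R iexp (t * x))"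
    using char_std_normal_distribution unfolding char_def fun_eq_iff
    by (subst (asm) integral_density) auto
  also have "\<dots> = \<bar>c\<bar> *\<^sub>R (LINT x|lborel. std_normal_density (0 + c * x) *\<^sub>R iexp (t * (0 + c * x)))"
    using c by (subst lborel_integral_real_affine[of c _ 0]) auto
  also have "\<dots> = of_real (c / sqrt (2 * pi)) * (LINT x|lborel. complex_of_real (exp (- a * x\<^sup>2)) * cis (x * \<xi>))"
    using c by (simp only: add_0 eq) (simp add: scaleR_conv_of_real)
  finally have "(LINT x|lborel. complex_of_real (exp (- a * x\<^sup>2)) * cis (x * \<xi>))
     = of_real (sqrt (2 * pi) / c) * complex_of_real (exp (- t\<^sup>2 / 2))"
    using c by (simp add: field_simps)
  moreover have "sqrt (2 * pi) / c = sqrt (pi / a)"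
    using a by (simp add: c_def real_sqrt_divide[symmetric])
  moreover have "t\<^sup>2 / 2 = \<xi>\<^sup>2 / (4 * a)"
    using c by (simp add: t_def power_divide)
  ultimately show ?E by simp
qed

lemma cis_sum: "finite A \<Longrightarrow> cis (\<Sum>i\<in>A. f i) = (\<Prod>i\<in>A. cis (f i))"
  by (induction A rule: finite_induct) (auto simp: cis_mult[symmetric])

lemma norm_sq_Basis: "(norm (x::'a::euclidean_space))\<^sup>2 = (\<Sum>b\<in>Basis. (x \<bullet> b)\<^sup>2)"
  unfolding power2_norm_eq_inner by (subst euclidean_inner) (simp only: power2_eq_square)

text \<open>
  Lebesgue measure is the image of a product of one-dimensional ones, and a Gaussian times a character
  factorises over the coordinates.
\<close>
lemma integral_gauss_cis:
  fixes \<xi> :: "'a::euclidean_space"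
  assumes a: "a > 0"
  shows "integrable lborel (\<lambda>x::'a. complex_of_real (exp (- a * (norm x)\<^sup>2)) * cis (x \<bullet> \<xi>))" (is ?I)
    and "(LINT x|lborel. complex_of_real (exp (- a * (norm (x::'a))\<^sup>2)) * cis (x \<bullet> \<xi>))
           = complex_of_real ((pi / a) powr (real DIM('a) / 2) * exp (- (norm \<xi>)\<^sup>2 / (4 * a)))" (is ?E)
proof -
  let ?P = "\<Pi>\<^sub>M b\<in>(Basis::'a set). (lborel :: real measure)"
  let ?T = "\<lambda>f. \<Sum>b\<in>(Basis::'a set). f b *\<^sub>R b"
  let ?g = "\<lambda>b x. complex_of_real (exp (- a * x\<^sup>2)) * cis (x * (\<xi> \<bullet> b))"
  interpret product_sigma_finite "\<lambda>b::'a. lborel :: real measure" ..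
  have eq: "complex_of_real (exp (- a * (norm (?T f))\<^sup>2)) * cis (?T f \<bullet> \<xi>) = (\<Prod>b\<in>Basis. ?g b (f b))" for f
  proof -
    have "?T f \<bullet> b = f b" if "b \<in> Basis" for b
      using that by (simp add: inner_sum_left inner_Basis if_distrib cong: if_cong)
    then have n: "(norm (?T f))\<^sup>2 = (\<Sum>b\<in>Basis. (f b)\<^sup>2)"
      by (simp add: norm_sq_Basis)
    have i: "?T f \<bullet> \<xi> = (\<Sum>b\<in>Basis. f b * (\<xi> \<bullet> b))"
      by (simp add: inner_sum_left inner_commute[of \<xi>])
    show ?thesis
      by (simp add: n i cis_sum prod.distrib sum_distrib_left exp_sum flip: of_real_prod sum_negf)
  qed
  have T[measurable]: "?T \<in> ?P \<rightarrow>\<^sub>M borel" by measurable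
  have ip: "integrable ?P (\<lambda>f. \<Prod>b\<in>Basis. ?g b (f b))"
    by (intro product_integrable_prod finite_Basis integral_gauss_cis_real a)
  have m: "(\<lambda>x::'a. complex_of_real (exp (- a * (norm x)\<^sup>2)) * cis (x \<bullet> \<xi>)) \<in> borel_measurable borel"
    by (intro borel_measurable_continuous_onI continuous_intros)
  show ?I
    by (subst lborel_eq, subst integrable_distr_eq[OF T m]) (use ip eq in simp)
  have "(LINT x|lborel. complex_of_real (exp (- a * (norm (x::'a))\<^sup>2)) * cis (x \<bullet> \<xi>))
      = (LINT f|?P. (\<Prod>b\<in>Basis. ?g b (f b)))"
    by (subst lborel_eq, subst integral_distr[OF T m]) (use eq in simp)
  also have "\<dots> = (\<Prod>b\<in>Basis. LINT x|lborel. ?g b x)"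
    by (intro product_integral_prod finite_Basis integral_gauss_cis_real a)
  also have "\<dots> = complex_of_real (\<Prod>b\<in>(Basis::'a set). (sqrt (pi / a) * exp (- (\<xi> \<bullet> b)\<^sup>2 / (4 * a))))"
    using integral_gauss_cis_real(2)[OF a] by simp
  also have "(\<Prod>b\<in>(Basis::'a set). (sqrt (pi / a) * exp (- (\<xi> \<bullet> b)\<^sup>2 / (4 * a))))
     = sqrt (pi / a) ^ DIM('a) * exp (- (norm \<xi>)\<^sup>2 / (4 * a))"
    by (simp add: prod.distrib exp_sum[symmetric] norm_sq_Basis sum_divide_distrib sum_negf)
  also have "sqrt (pi / a) ^ DIM('a) = (pi / a) powr (real DIM('a) / 2)"
    using a by (simp add: powr_half_sqrt[symmetric] powr_powr powr_realpow[symmetric])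
  finally show ?E .
qed

text \<open>
  The heat kernel, that is, the centred normal density with variance \<open>2 * t\<close> in each coordinate.
\<close>
definition gauss :: "real \<Rightarrow> 'a::euclidean_space \<Rightarrow> real" where
  "gauss t z = (4 * pi * t) powr (- real DIM('a) / 2) * exp (- (norm z)\<^sup>2 / (4 * t))"

lemma gauss_nonneg [simp]: "0 \<le> gauss t z"
  by (simp add: gauss_def)

lemma gauss_measurable [measurable]: "gauss t \<in> borel_measurable borel"
  unfolding gauss_def by measurable

lemma gauss_measurable_pair: "(\<lambda>(t, z). gauss t z) \<in> borel_measurable (borel \<Otimes>\<^sub>M borel)"
  unfolding gauss_def by measurable

lemma gauss_minus: "gauss t (x - y) = gauss t (y - x)"
  by (simp add: gauss_def norm_minus_commute)

lemma gauss_integrable: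
  assumes "t > 0" shows "integrable lborel (gauss t :: 'a::euclidean_space \<Rightarrow> real)"
    and "(LINT z|lborel. gauss t (z::'a)) = 1"
proof -
  note * = integral_gauss_cis[of "1 / (4 * t)" "0::'a"]
  have "integrable lborel (\<lambda>z::'a. Re (complex_of_real (exp (- (1 / (4 * t)) * (norm z)\<^sup>2)) * cis (z \<bullet> 0)))"
    using * assms by (intro integrable_Re) auto
  then have i: "integrable lborel (\<lambda>z::'a. exp (- (norm z)\<^sup>2 / (4 * t)))"
    by simp
  then show "integrable lborel (gauss t :: 'a \<Rightarrow> real)" unfolding gauss_def by simp
  have "complex_of_real (LINT z|lborel. exp (- (norm (z::'a))\<^sup>2 / (4 * t))) = of_real ((pi * (4 * t)) powr (real DIM('a) / 2))"
    using * assms by (simp flip: integral_complex_of_real)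
  then have "(LINT z|lborel. exp (- (norm (z::'a))\<^sup>2 / (4 * t))) = (pi * (4 * t)) powr (real DIM('a) / 2)"
    using of_real_eq_iff by blast
  then show "(LINT z|lborel. gauss t (z::'a)) = 1" unfolding gauss_def
    using assms by (simp add: powr_minus mult_ac)
qed

lemma gauss_nn_integral:
  assumes "t > 0" shows "(\<integral>\<^sup>+z. ennreal (gauss t (z::'a::euclidean_space)) \<partial>lborel) = 1"
  using gauss_integrable[OF assms, where 'a='a] by (simp add: nn_integral_eq_integral)

lemma gauss_eq_Fourier:
  fixes x :: "'a::euclidean_space"
  assumes "t > 0"
  shows "of_real ((2 * pi) powr (- real DIM('a))) *
      (LINT \<xi>|lborel. complex_of_real (exp (- t * (norm \<xi>)\<^sup>2)) * cis (\<xi> \<bullet> x)) = of_real (gauss t x)"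
proof -
  have "(2 * pi) powr (- real DIM('a)) * (pi / t) powr (real DIM('a) / 2) = (4 * pi * t) powr (- real DIM('a) / 2)"
  proof -
    have "(2 * pi) powr (- real DIM('a)) = ((2 * pi) powr 2) powr (- real DIM('a) / 2)"
      unfolding powr_powr by simp
    also have "(2 * pi) powr 2 = (4 * pi * t) * (pi / t)"
      using assms by (simp add: powr_numeral power2_eq_square)
    also have "\<dots> powr (- real DIM('a) / 2) = (4 * pi * t) powr (- real DIM('a) / 2) * (pi / t) powr (- real DIM('a) / 2)"
      using assms by (subst powr_mult) auto
    finally show ?thesis using assms by (simp add: powr_minus)
  qed
  then show ?thesis
    using integral_gauss_cis(2)[OF assms, of x] 
    by (simp add: gauss_def flip: of_real_mult mult.assoc)
qed

section \<open>The Fourier transform of integrable functions\<close>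

lemma fourier_lborel:
  fixes g :: "'a::euclidean_space \<Rightarrow> complex"
  assumes [measurable]: "g \<in> borel_measurable borel"
  shows "fourier g \<xi> = of_real ((2 * pi) powr (- real DIM('a) / 2)) * (LINT x|lborel. cis (- (x \<bullet> \<xi>)) * g x)"
  unfolding fourier_def by (subst integral_completion) (auto simp: cis_conv_exp)

lemma cis_inner_measurable [measurable]:
  fixes f g :: "_ \<Rightarrow> 'a::euclidean_space"
  assumes [measurable]: "f \<in> borel_measurable M" "g \<in> borel_measurable M"
  shows "(\<lambda>x. cis (f x \<bullet> g x)) \<in> borel_measurable M" "(\<lambda>x. cis (- (f x \<bullet> g x))) \<in> borel_measurable M"
  by (simp_all add: cis_conv_exp)

lemma fourier_measurable [measurable]:
  fixes g :: "'a::euclidean_space \<Rightarrow> complex"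
  assumes [measurable]: "g \<in> borel_measurable borel"
  shows "fourier g \<in> borel_measurable borel"
proof -
  have [measurable]: "(\<lambda>(\<xi>, x). cis (- (x \<bullet> \<xi>)) * g x) \<in> borel_measurable (borel \<Otimes>\<^sub>M lborel)"
    by measurable
  show ?thesis
    unfolding fourier_lborel[OF assms, abs_def]
    by (intro borel_measurable_times borel_measurable_const lborel.borel_measurable_lebesgue_integral) measurable
qed

lemma integrable_cis_mult:
  fixes g :: "'a::euclidean_space \<Rightarrow> complex"
  assumes "integrable lborel g"
  shows "integrable lborel (\<lambda>x. cis (- (x \<bullet> \<xi>)) * g x)"
  by (rule Bochner_Integration.integrable_bound[OF assms]) (use assms in \<open>auto simp: norm_mult\<close>)

lemma norm_fourier_le:
  fixes g :: "'a::euclidean_space \<Rightarrow> complex"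
  assumes [measurable]: "g \<in> borel_measurable borel" and "integrable lborel g"
  shows "norm (fourier g \<xi>) \<le> (2 * pi) powr (- real DIM('a) / 2) * (LINT x|lborel. norm (g x))"
proof -
  have "norm (LINT x|lborel. cis (- (x \<bullet> \<xi>)) * g x) \<le> (LINT x|lborel. norm (cis (- (x \<bullet> \<xi>)) * g x))"
    by (rule integral_norm_bound)
  then show ?thesis
    by (simp add: fourier_lborel norm_mult mult_left_mono)
qed

lemma continuous_fourier:
  fixes g :: "'a::euclidean_space \<Rightarrow> complex"
  assumes [measurable]: "g \<in> borel_measurable borel" and i: "integrable lborel g"
  shows "continuous_on UNIV (fourier g)"
  unfolding continuous_on_sequentially comp_def
proof safe
  fix \<xi> and X :: "nat \<Rightarrow> 'a" assume X: "X \<longlonglongrightarrow> \<xi>"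
  have "(\<lambda>n. LINT x|lborel. cis (- (x \<bullet> X n)) * g x) \<longlonglongrightarrow> (LINT x|lborel. cis (- (x \<bullet> \<xi>)) * g x)"
  proof (rule integral_dominated_convergence[where w="\<lambda>x. norm (g x)"])
    have "(\<lambda>n. cis (- (x \<bullet> X n)) * g x) \<longlonglongrightarrow> cis (- (x \<bullet> \<xi>)) * g x" for x
      unfolding cis_conv_exp by (intro tendsto_intros X)
    then show "AE x in lborel. (\<lambda>n. cis (- (x \<bullet> X n)) * g x) \<longlonglongrightarrow> cis (- (x \<bullet> \<xi>)) * g x" by simp
  qed (use i in \<open>auto simp: norm_mult\<close>)
  then show "(\<lambda>n. fourier g (X n)) \<longlonglongrightarrow> fourier g \<xi>"
    unfolding fourier_lborel[OF assms(1)] by (intro tendsto_intros)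
qed

text \<open>
  Both sides are the same double integral, by Fubini.
\<close>
lemma fourier_multiplication_formula:
  fixes g w :: "'a::euclidean_space \<Rightarrow> complex"
  assumes [measurable]: "g \<in> borel_measurable borel" "w \<in> borel_measurable borel"
    and g: "integrable lborel g" and w: "integrable lborel w"
  shows "(LINT \<xi>|lborel. fourier g \<xi> * w \<xi>) = (LINT x|lborel. g x * fourier w x)"
proof -
  let ?c = "complex_of_real ((2 * pi) powr (- real DIM('a) / 2))"
  let ?F = "\<lambda>x \<xi>. cis (- (x \<bullet> \<xi>)) * g x * w \<xi>"
  have "integrable (lborel \<Otimes>\<^sub>M lborel) (\<lambda>(x, \<xi>). ?F x \<xi>)"
  proof (rule lborel_pair.Fubini_integrable)
    show "AE x in lborel. integrable lborel (\<lambda>y. case (x, y) of (x, \<xi>) \<Rightarrow> ?F x \<xi>)"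
      using integrable_cis_mult[OF w] by (auto simp: inner_commute mult_ac intro: integrable_mult_right)
    show "integrable lborel (\<lambda>x. LINT y|lborel. norm (case (x, y) of (x, \<xi>) \<Rightarrow> ?F x \<xi>))"
      using g by (simp add: norm_mult)
  qed measurable
  from lborel_pair.Fubini_integral[OF this]
  have eq: "(LINT \<xi>|lborel. LINT x|lborel. ?F x \<xi>) = (LINT x|lborel. LINT \<xi>|lborel. ?F x \<xi>)" .
  have "(LINT \<xi>|lborel. fourier g \<xi> * w \<xi>) = (LINT \<xi>|lborel. ?c * (LINT x|lborel. ?F x \<xi>))"
    by (simp add: fourier_lborel mult.assoc[symmetric])
  also have "\<dots> = ?c * (LINT \<xi>|lborel. LINT x|lborel. ?F x \<xi>)"
    by (rule integral_mult_right_zero)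
  also have "\<dots> = ?c * (LINT x|lborel. LINT \<xi>|lborel. ?F x \<xi>)"
    by (simp only: eq)
  also have "\<dots> = (LINT x|lborel. ?c * (LINT \<xi>|lborel. ?F x \<xi>))"
    by simp
  also have "\<dots> = (LINT x|lborel. g x * fourier w x)"
    by (intro Bochner_Integration.integral_cong refl)
       (simp add: fourier_lborel inner_commute mult_ac flip: integral_mult_right_zero)
  finally show ?thesis .
qed

section \<open>Gaussian regularisation and Plancherel's theorem\<close>

lemma gauss_le: "t > 0 \<Longrightarrow> gauss t (z::'a::euclidean_space) \<le> (4 * pi * t) powr (- real DIM('a) / 2)"
  by (simp add: gauss_def mult_left_le)

lemma borel_measurable_cnj [measurable]:
  "f \<in> borel_measurable M \<Longrightarrow> (\<lambda>x. cnj (f x)) \<in> borel_measurable M"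
  by (rule measurable_compose[OF _ borel_measurable_continuous_onI]) (auto intro: continuous_intros)

lemma nn_integral_shift:
  fixes f :: "'a::euclidean_space \<Rightarrow> ennreal"
  assumes [measurable]: "f \<in> borel_measurable borel"
  shows "(\<integral>\<^sup>+x. f (x + c) \<partial>lborel) = (\<integral>\<^sup>+x. f x \<partial>lborel)"
proof -
  have "(\<integral>\<^sup>+x. f x \<partial>lborel) = (\<integral>\<^sup>+x. f x \<partial>(distr lborel borel ((+) c)))"
    by (simp only: lborel_distr_plus)
  also have "\<dots> = (\<integral>\<^sup>+x. f (x + c) \<partial>lborel)"
    by (subst nn_integral_distr) (auto simp: add.commute)
  finally show ?thesis ..
qed

lemma nn_integral_shift_minus:
  fixes f :: "'a::euclidean_space \<Rightarrow> ennreal"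
  assumes [measurable]: "f \<in> borel_measurable borel"
  shows "(\<integral>\<^sup>+x. f (x - c) \<partial>lborel) = (\<integral>\<^sup>+x. f x \<partial>lborel)"
  using nn_integral_shift[OF assms, of "- c"] by simp

lemma gauss_nn_integral_shift:
  assumes "t > 0"
  shows "(\<integral>\<^sup>+y. ennreal (gauss t (x - y::'a::euclidean_space)) \<partial>lborel) = 1"
  using nn_integral_shift_minus[of "\<lambda>z. ennreal (gauss t z)" x] gauss_nn_integral[OF assms, where 'a='a]
  by (simp add: gauss_minus)

lemma gauss_integrable_shift:
  assumes "t > 0"
  shows "integrable lborel (\<lambda>y. gauss t (x - y::'a::euclidean_space))"
    and "(LINT y|lborel. gauss t (x - y::'a::euclidean_space)) = 1"
proof -
  show i: "integrable lborel (\<lambda>y. gauss t (x - y))"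
    using gauss_nn_integral_shift[OF assms, of x] by (intro integrableI_bounded) auto
  show "(LINT y|lborel. gauss t (x - y)) = 1"
    using gauss_nn_integral_shift[OF assms, of x] nn_integral_eq_integral[OF i]
    by (simp flip: ennreal_1)
qed

definition gauss_defect :: "real \<Rightarrow> ('a::euclidean_space \<Rightarrow> complex) \<Rightarrow> ennreal" where
  "gauss_defect t g = (\<integral>\<^sup>+x. \<integral>\<^sup>+y. ennreal ((norm (g x - g y))\<^sup>2 * gauss t (x - y)) \<partial>lborel \<partial>lborel)"

text \<open>
  The multiplication formula against the function \<open>exp (- t \<bar>\<xi>\<bar>\<^sup>2) cis (\<xi> \<bullet> x)\<close>, whose transform is a translated heat
  kernel. It avoids Fourier inversion.
\<close>
lemma gauss_fourier_convolution:
  fixes g :: "'a::euclidean_space \<Rightarrow> complex"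
  assumes [measurable]: "g \<in> borel_measurable borel" and i: "integrable lborel g" and t: "t > 0"
  shows "fourier (\<lambda>\<xi>. of_real (exp (- t * (norm \<xi>)\<^sup>2)) * cnj (fourier g \<xi>)) x
           = cnj (LINT y|lborel. g y * of_real (gauss t (x - y)))"
proof -
  let ?c = "complex_of_real ((2 * pi) powr (- real DIM('a) / 2))"
  let ?e = "\<lambda>\<xi>::'a. complex_of_real (exp (- t * (norm \<xi>)\<^sup>2))"
  define w where "w = (\<lambda>\<xi>. ?e \<xi> * cis (\<xi> \<bullet> x))"
  have w[measurable]: "w \<in> borel_measurable borel" unfolding w_def by measurable
  have wi: "integrable lborel w" unfolding w_def using integral_gauss_cis(1)[OF t] .
  have c2: "?c * ?c = of_real ((2 * pi) powr (- real DIM('a)))"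
    by (simp flip: powr_add of_real_mult)
  have w2: "?c * fourier w y = of_real (gauss t (x - y))" for y
  proof -
    have "?c * fourier w y = ?c * ?c * (LINT \<xi>|lborel. cis (- (\<xi> \<bullet> y)) * w \<xi>)"
      by (simp only: fourier_lborel[OF w] mult.assoc)
    also have "(LINT \<xi>|lborel. cis (- (\<xi> \<bullet> y)) * w \<xi>) = (LINT \<xi>|lborel. ?e \<xi> * cis (\<xi> \<bullet> (x - y)))"
      unfolding w_def
      by (intro Bochner_Integration.integral_cong refl) (simp add: inner_diff_right cis_mult)
    finally show ?thesis
      using gauss_eq_Fourier[OF t, of "x - y"] by (simp only: c2)
  qed
  have "fourier (\<lambda>\<xi>. ?e \<xi> * cnj (fourier g \<xi>)) x
      = ?c * (LINT \<xi>|lborel. cnj (fourier g \<xi> * w \<xi>))"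
    by (subst fourier_lborel[where g="\<lambda>\<xi>. ?e \<xi> * cnj (fourier g \<xi>)"], measurable)
      (auto intro!: Bochner_Integration.integral_cong simp: w_def cis_cnj)
  also have "\<dots> = cnj (?c * (LINT \<xi>|lborel. fourier g \<xi> * w \<xi>))"
    by (subst Bochner_Integration.integral_cnj) simp
  also have "?c * (LINT \<xi>|lborel. fourier g \<xi> * w \<xi>) = (LINT y|lborel. ?c * (g y * fourier w y))"
    by (simp only: fourier_multiplication_formula[OF assms(1) w i wi] integral_mult_right_zero)
  also have "\<dots> = (LINT y|lborel. g y * of_real (gauss t (x - y)))"
    by (intro Bochner_Integration.integral_cong refl) (simp only: w2[symmetric] mult_ac)
  finally show ?thesis .
qed

text \<open>
  Multiplying \<open>gauss_fourier_convolution\<close> by \<open>g x\<close> and integrating turns the weighted integral of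
  \<open>\<bar>Fg\<bar>\<^sup>2\<close> into the double integral of \<open>Re (g x * cnj (g y))\<close> against the heat kernel; writing this real
  part as half of \<open>\<bar>g x\<bar>\<^sup>2 + \<bar>g y\<bar>\<^sup>2 - \<bar>g x - g y\<bar>\<^sup>2\<close> and using that the kernel has mass one gives the
  identity. It serves twice: at small \<open>t\<close> for Plancherel, and integrated in \<open>t\<close> for the energy.
\<close>
lemma gauss_fourier_identity:
  fixes g :: "'a::euclidean_space \<Rightarrow> complex"
  assumes [measurable]: "g \<in> borel_measurable borel"
    and i: "integrable lborel g" and i2: "integrable lborel (\<lambda>x. (norm (g x))\<^sup>2)" and t: "t > 0"
  shows "(\<integral>\<^sup>+\<xi>. ennreal (exp (- t * (norm \<xi>)\<^sup>2) * (norm (fourier g \<xi>))\<^sup>2) \<partial>lborel)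
           + ennreal (1/2) * gauss_defect t g = (\<integral>\<^sup>+x. ennreal ((norm (g x))\<^sup>2) \<partial>lborel)"
proof -
  let ?e = "\<lambda>\<xi>::'a. exp (- t * (norm \<xi>)\<^sup>2)"
  let ?N = "LINT x|lborel. (norm (g x))\<^sup>2"
  define w where "w = (\<lambda>\<xi>. complex_of_real (?e \<xi>) * cnj (fourier g \<xi>))"
  define B where "B = (2 * pi) powr (- real DIM('a) / 2) * (LINT x|lborel. norm (g x))"
  have B: "norm (fourier g \<xi>) \<le> B" for \<xi>
    unfolding B_def by (rule norm_fourier_le) (use i in auto)
  have B0: "B \<ge> 0" using B[of 0] norm_ge_zero order_trans by blast
  have ei: "integrable lborel ?e"
    using integrable_Re[OF integral_gauss_cis(1)[OF t, of "0::'a"]] by simp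
  have w[measurable]: "w \<in> borel_measurable borel"
    unfolding w_def by measurable
  have wi: "integrable lborel w"
    by (rule Bochner_Integration.integrable_bound[OF integrable_mult_right[OF ei, of B]])
       (use B B0 in \<open>auto simp: w_def norm_mult mult.commute intro!: mult_right_mono\<close>)
  have conv: "fourier w x = cnj (LINT y|lborel. g y * of_real (gauss t (x - y)))" for x
    unfolding w_def by (rule gauss_fourier_convolution) (use i t in auto)
  \<comment> \<open>For fixed \<open>x\<close> the three terms of the expanded square are separately integrable in \<open>y\<close>,
    because the kernel is bounded.\<close>
  have ig: "integrable lborel (\<lambda>y. g y * of_real (gauss t (x - y)))" for x
    by (rule Bochner_Integration.integrable_bound[OF integrable_mult_right[OF i, of "of_real ((4 * pi * t) powr (- real DIM('a) / 2))"]])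
       (use gauss_le[OF t, where 'a='a] in \<open>auto simp: norm_mult mult.commute intro!: mult_left_mono\<close>)
  have ig2: "integrable lborel (\<lambda>y. (norm (g y))\<^sup>2 * gauss t (x - y))" for x
    by (rule Bochner_Integration.integrable_bound[OF integrable_mult_left[OF i2, of "(4 * pi * t) powr (- real DIM('a) / 2)"]])
       (use gauss_le[OF t, where 'a='a] in \<open>auto simp: norm_mult intro!: mult_left_mono\<close>)
  define S where "S x = (LINT y|lborel. (norm (g y))\<^sup>2 * gauss t (x - y))" for x
  define R where "R x = Re (g x * fourier w x)" for x
  have R: "integrable lborel (\<lambda>y. Re (g x * cnj (g y)) * gauss t (x - y))"
          "(LINT y|lborel. Re (g x * cnj (g y)) * gauss t (x - y)) = R x" for x
  proof -
    have *: "Re (g x * cnj (g y)) * gauss t (x - y) = Re (g x * cnj (g y * of_real (gauss t (x - y))))" for y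
      by (simp add: algebra_simps)
    have **: "integrable lborel (\<lambda>y. g x * cnj (g y * of_real (gauss t (x - y))))"
      by (intro integrable_mult_right Bochner_Integration.integrable_cnj ig)
    show "integrable lborel (\<lambda>y. Re (g x * cnj (g y)) * gauss t (x - y))"
      unfolding * by (rule integrable_Re[OF **])
    show "(LINT y|lborel. Re (g x * cnj (g y)) * gauss t (x - y)) = R x"
      unfolding * R_def conv integral_Re[OF **] integral_mult_right_zero Bochner_Integration.integral_cnj ..
  qed
  have expand: "(norm (g x - g y))\<^sup>2 * gauss t (x - y) =
     (norm (g x))\<^sup>2 * gauss t (x - y) + (norm (g y))\<^sup>2 * gauss t (x - y) - 2 * (Re (g x * cnj (g y)) * gauss t (x - y))" for x y
    unfolding cmod_power2 by (simp add: power2_eq_square algebra_simps)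
  have Di: "integrable lborel (\<lambda>y. (norm (g x - g y))\<^sup>2 * gauss t (x - y))" for x
    unfolding expand
    by (intro Bochner_Integration.integrable_add Bochner_Integration.integrable_diff integrable_mult_right R ig2 gauss_integrable_shift t)
  have D: "(LINT y|lborel. (norm (g x - g y))\<^sup>2 * gauss t (x - y)) = (norm (g x))\<^sup>2 + S x - 2 * R x" for x
    unfolding expand S_def R(2)[symmetric]
    using gauss_integrable_shift[OF t, of x] R[of x] ig2[of x] by simp
  have Snn: "(\<integral>\<^sup>+x. ennreal (S x) \<partial>lborel) = ennreal ?N"
  proof -
    have "(\<integral>\<^sup>+x. ennreal (S x) \<partial>lborel) = (\<integral>\<^sup>+x. \<integral>\<^sup>+y. ennreal ((norm (g y))\<^sup>2) * ennreal (gauss t (y - x)) \<partial>lborel \<partial>lborel)"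
      unfolding S_def using ig2 by (subst nn_integral_eq_integral[symmetric]) (auto simp: gauss_minus ennreal_mult)
    also have "\<dots> = (\<integral>\<^sup>+y. \<integral>\<^sup>+x. ennreal ((norm (g y))\<^sup>2) * ennreal (gauss t (y - x)) \<partial>lborel \<partial>lborel)"
      by (rule lborel_pair.Fubini') measurable
    also have "\<dots> = ennreal ?N"
      by (simp add: nn_integral_cmult gauss_nn_integral_shift[OF t] nn_integral_eq_integral[OF i2])
    finally show ?thesis .
  qed
  have S0: "S x \<ge> 0" for x unfolding S_def by (intro Bochner_Integration.integral_nonneg) auto
  have Sm[measurable]: "S \<in> borel_measurable borel"
    unfolding S_def[abs_def] by measurable
  have Si: "integrable lborel S" "(LINT x|lborel. S x) = ?N"
  proof -
    show "integrable lborel S" by (rule integrableI_bounded) (use Snn S0 in auto)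
    from nn_integral_eq_integral[OF this] Snn S0 show "(LINT x|lborel. S x) = ?N"
      by (auto simp: Bochner_Integration.integral_nonneg)
  qed
  have Ri0: "integrable lborel (\<lambda>x. g x * fourier w x)"
  proof (rule Bochner_Integration.integrable_bound[OF integrable_mult_right[OF i, of "of_real ((2 * pi) powr (- real DIM('a) / 2) * (LINT x|lborel. norm (w x)))"]])
    show "AE x in lborel. norm (g x * fourier w x) \<le> norm (complex_of_real ((2 * pi) powr (- real DIM('a) / 2) * (LINT x|lborel. norm (w x))) * g x)"
    proof (rule AE_I2)
      fix x show "norm (g x * fourier w x) \<le> norm (complex_of_real ((2 * pi) powr (- real DIM('a) / 2) * (LINT x|lborel. norm (w x))) * g x)"
        using mult_left_mono[OF norm_fourier_le[OF w wi, of x], of "norm (g x)"]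
        by (simp add: norm_mult Bochner_Integration.integral_nonneg mult_ac)
    qed
  qed measurable
  have Ri: "integrable lborel R" unfolding R_def[abs_def] by (rule integrable_Re[OF Ri0])
  have ee: "fourier g \<xi> * w \<xi> = of_real (?e \<xi> * (norm (fourier g \<xi>))\<^sup>2)" for \<xi>
    by (simp add: w_def complex_norm_square mult_ac del: of_real_power)
  have Rint: "(LINT x|lborel. R x) = (LINT \<xi>|lborel. ?e \<xi> * (norm (fourier g \<xi>))\<^sup>2)"
  proof -
    have "(LINT x|lborel. R x) = Re (LINT x|lborel. g x * fourier w x)"
      unfolding R_def by (rule integral_Re[OF Ri0])
    also have "(LINT x|lborel. g x * fourier w x) = (LINT \<xi>|lborel. fourier g \<xi> * w \<xi>)"
      by (rule fourier_multiplication_formula[OF assms(1) w i wi, symmetric])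
    also have "\<dots> = of_real (LINT \<xi>|lborel. ?e \<xi> * (norm (fourier g \<xi>))\<^sup>2)"
      unfolding ee by (rule integral_complex_of_real)
    finally show ?thesis by simp
  qed
  have Fi: "integrable lborel (\<lambda>\<xi>. ?e \<xi> * (norm (fourier g \<xi>))\<^sup>2)"
    by (rule Bochner_Integration.integrable_bound[OF integrable_mult_right[OF ei, of "B\<^sup>2"]])
       (use B B0 in \<open>auto simp: norm_mult mult.commute intro!: mult_right_mono power_mono\<close>)
  have "gauss_defect t g = (\<integral>\<^sup>+x. ennreal ((norm (g x))\<^sup>2 + S x - 2 * R x) \<partial>lborel)"
    unfolding gauss_defect_def D[symmetric] using Di by (subst nn_integral_eq_integral) auto
  also have "\<dots> = ennreal (LINT x|lborel. (norm (g x))\<^sup>2 + S x - 2 * R x)"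
  proof (rule nn_integral_eq_integral)
    show "integrable lborel (\<lambda>x. (norm (g x))\<^sup>2 + S x - 2 * R x)"
      using Si Ri i2 by simp
  qed (auto simp: D[symmetric] intro!: Bochner_Integration.integral_nonneg)
  also have "(LINT x|lborel. (norm (g x))\<^sup>2 + S x - 2 * R x) = 2 * ?N - 2 * (LINT \<xi>|lborel. ?e \<xi> * (norm (fourier g \<xi>))\<^sup>2)"
    using Si Ri i2 Rint by simp
  finally have gd: "gauss_defect t g = ennreal (2 * ?N - 2 * (LINT \<xi>|lborel. ?e \<xi> * (norm (fourier g \<xi>))\<^sup>2))" (is "_ = ennreal ?d") .
  have d0: "?d \<ge> 0"
  proof -
    have "0 \<le> (LINT x|lborel. (norm (g x))\<^sup>2 + S x - 2 * R x)"
      by (auto simp: D[symmetric] intro!: Bochner_Integration.integral_nonneg)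
    then show ?thesis using Si Ri i2 Rint by simp
  qed
  have "ennreal (1/2) * gauss_defect t g = ennreal (?d / 2)"
    unfolding gd using d0 by (subst ennreal_mult[symmetric]) auto
  moreover have "(\<integral>\<^sup>+\<xi>. ennreal (?e \<xi> * (norm (fourier g \<xi>))\<^sup>2) \<partial>lborel) = ennreal (LINT \<xi>|lborel. ?e \<xi> * (norm (fourier g \<xi>))\<^sup>2)"
    by (rule nn_integral_eq_integral[OF Fi]) auto
  moreover have "(\<integral>\<^sup>+x. ennreal ((norm (g x))\<^sup>2) \<partial>lborel) = ennreal ?N"
    by (rule nn_integral_eq_integral[OF i2]) auto
  ultimately show ?thesis
    using d0 by (simp add: Bochner_Integration.integral_nonneg diff_divide_distrib flip: ennreal_plus)
qed

text \<open>
  Half of the exponential absorbs the factor \<open>\<bar>z\<bar>\<^sup>2\<close>, since \<open>a * exp (- a) \<le> 1\<close>; the other half is a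
  heat kernel at time \<open>2 * t\<close>.
\<close>
lemma gauss_second_moment:
  assumes t: "t > 0"
  shows "(\<integral>\<^sup>+z. ennreal ((norm z)\<^sup>2 * gauss t (z::'a::euclidean_space)) \<partial>lborel) \<le> ennreal (8 * 2 powr (real DIM('a) / 2) * t)"
proof -
  have "(norm z)\<^sup>2 * gauss t z \<le> 8 * 2 powr (real DIM('a) / 2) * t * gauss (2 * t) z" for z :: 'a
  proof -
    define a where "a = (norm z)\<^sup>2 / (8 * t)"
    have "a * exp (- a) \<le> 1"
    proof -
      have "a \<le> exp a" using exp_ge_add_one_self[of a] by linarith
      then show ?thesis by (simp add: exp_minus field_simps)
    qed
    have z: "(norm z)\<^sup>2 = 8 * t * a" using t by (simp add: a_def)
    have "(4 * pi * (2 * t)) powr (- real DIM('a) / 2) = 2 powr (- real DIM('a) / 2) * (4 * pi * t) powr (- real DIM('a) / 2)"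
      using t by (subst powr_mult[symmetric]) (auto simp: mult_ac)
    then have *: "2 powr (real DIM('a) / 2) * (4 * pi * (2 * t)) powr (- real DIM('a) / 2) = (4 * pi * t) powr (- real DIM('a) / 2)"
      by (simp add: powr_minus)
    have "exp (- (norm z)\<^sup>2 / (4 * t)) = exp (- a) * exp (- a)"
      using t by (simp add: a_def flip: exp_add)
    then have "(norm z)\<^sup>2 * gauss t z
        = 8 * t * (4 * pi * t) powr (- real DIM('a) / 2) * exp (- a) * (a * exp (- a))"
      by (simp add: gauss_def z)
    also have "\<dots> \<le> 8 * t * (4 * pi * t) powr (- real DIM('a) / 2) * exp (- a)"
      using t \<open>a * exp (- a) \<le> 1\<close> by (intro mult_right_le_one_le mult_nonneg_nonneg) (auto simp: a_def)
    also have "\<dots> = 8 * t * (2 powr (real DIM('a) / 2) * (4 * pi * (2 * t)) powr (- real DIM('a) / 2)) * exp (- a)"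
      by (simp only: *)
    also have "\<dots> = 8 * 2 powr (real DIM('a) / 2) * t * gauss (2 * t) z"
      using t by (simp add: gauss_def a_def mult_ac)
    finally show ?thesis .
  qed
  then have "(\<integral>\<^sup>+z. ennreal ((norm z)\<^sup>2 * gauss t (z::'a)) \<partial>lborel)
     \<le> (\<integral>\<^sup>+z. ennreal (8 * 2 powr (real DIM('a) / 2) * t) * ennreal (gauss (2 * t) (z::'a)) \<partial>lborel)"
    using t by (intro nn_integral_mono) (simp flip: ennreal_mult)
  also have "\<dots> = ennreal (8 * 2 powr (real DIM('a) / 2) * t)"
    using t by (simp add: nn_integral_cmult gauss_nn_integral)
  finally show ?thesis .
qed

definition translation_defect :: "('a::euclidean_space \<Rightarrow> 'b::real_normed_vector) \<Rightarrow> 'a \<Rightarrow> ennreal" where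
  "translation_defect g z = (\<integral>\<^sup>+x. ennreal ((norm (g (x + z) - g x))\<^sup>2) \<partial>lborel)"

lemma translation_defect_measurable [measurable]:
  fixes g :: "'a::euclidean_space \<Rightarrow> 'b::{second_countable_topology, real_normed_vector}"
  assumes [measurable]: "g \<in> borel_measurable borel"
  shows "translation_defect g \<in> borel_measurable borel"
  unfolding translation_defect_def[abs_def] by measurable

text \<open>
  Tonelli with the substitution \<open>x = y + z\<close>: a double integral against a kernel of \<open>x - y\<close> only sees translates.
\<close>
lemma nn_integral_difference_kernel:
  fixes F :: "'a::euclidean_space \<Rightarrow> 'a \<Rightarrow> ennreal" and k :: "'a \<Rightarrow> ennreal"
  assumes [measurable]: "case_prod F \<in> borel_measurable (borel \<Otimes>\<^sub>M borel)" "k \<in> borel_measurable borel"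
  shows "(\<integral>\<^sup>+x. \<integral>\<^sup>+y. F x y * k (x - y) \<partial>lborel \<partial>lborel) = (\<integral>\<^sup>+z. (\<integral>\<^sup>+x. F (x + z) x \<partial>lborel) * k z \<partial>lborel)"
proof -
  have "(\<integral>\<^sup>+x. \<integral>\<^sup>+y. F x y * k (x - y) \<partial>lborel \<partial>lborel) = (\<integral>\<^sup>+y. \<integral>\<^sup>+x. F x y * k (x - y) \<partial>lborel \<partial>lborel)"
    by (rule lborel_pair.Fubini'[symmetric]) measurable
  also have "\<dots> = (\<integral>\<^sup>+y. \<integral>\<^sup>+z. F (z + y) y * k z \<partial>lborel \<partial>lborel)"
  proof (rule nn_integral_cong)
    fix y :: 'a
    have "(\<integral>\<^sup>+z. F (z + y) y * k (z + y - y) \<partial>lborel) = (\<integral>\<^sup>+x. F x y * k (x - y) \<partial>lborel)"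
      by (rule nn_integral_shift[of "\<lambda>x. F x y * k (x - y)" y]) measurable
    then show "(\<integral>\<^sup>+x. F x y * k (x - y) \<partial>lborel) = (\<integral>\<^sup>+z. F (z + y) y * k z \<partial>lborel)" by simp
  qed
  also have "\<dots> = (\<integral>\<^sup>+z. \<integral>\<^sup>+y. F (z + y) y * k z \<partial>lborel \<partial>lborel)"
    by (rule lborel_pair.Fubini'[symmetric]) measurable
  also have "\<dots> = (\<integral>\<^sup>+z. (\<integral>\<^sup>+y. F (z + y) y \<partial>lborel) * k z \<partial>lborel)"
    by (intro nn_integral_cong nn_integral_multc) measurable
  finally show ?thesis by (simp add: add.commute)
qed

lemma gauss_defect_eq:
  fixes g :: "'a::euclidean_space \<Rightarrow> complex"
  assumes [measurable]: "g \<in> borel_measurable borel"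
  shows "gauss_defect t g = (\<integral>\<^sup>+z. translation_defect g z * ennreal (gauss t z) \<partial>lborel)"
  unfolding gauss_defect_def translation_defect_def
  by (subst nn_integral_difference_kernel[symmetric]) (auto simp: ennreal_mult)

lemma norm_diff_sq_le: "(norm (a - b))\<^sup>2 \<le> 2 * (norm a)\<^sup>2 + 2 * (norm (b::'a::real_normed_vector))\<^sup>2"
proof -
  have "(norm (a - b))\<^sup>2 \<le> (norm a + norm b)\<^sup>2"
    by (intro power_mono norm_triangle_ineq4) auto
  also have "\<dots> \<le> 2 * (norm a)\<^sup>2 + 2 * (norm b)\<^sup>2"
    using zero_le_power2[of "norm a - norm b"] by (simp add: power2_eq_square algebra_simps)
  finally show ?thesis .
qed

lemma translation_defect_le:
  fixes g :: "'a::euclidean_space \<Rightarrow> 'b::{second_countable_topology, real_normed_vector}"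
  assumes [measurable]: "g \<in> borel_measurable borel"
  shows "translation_defect g z \<le> 4 * (\<integral>\<^sup>+x. ennreal ((norm (g x))\<^sup>2) \<partial>lborel)"
proof -
  have "translation_defect g z \<le> (\<integral>\<^sup>+x. 2 * ennreal ((norm (g (x + z)))\<^sup>2) + 2 * ennreal ((norm (g x))\<^sup>2) \<partial>lborel)"
    unfolding translation_defect_def
    using norm_diff_sq_le by (intro nn_integral_mono) (simp add: ennreal_leI flip: ennreal_plus ennreal_mult ennreal_numeral)
  also have "\<dots> = 2 * (\<integral>\<^sup>+x. ennreal ((norm (g x))\<^sup>2) \<partial>lborel) + 2 * (\<integral>\<^sup>+x. ennreal ((norm (g x))\<^sup>2) \<partial>lborel)"
    using nn_integral_shift[of "\<lambda>x. ennreal ((norm (g x))\<^sup>2)" z]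
    by (subst nn_integral_add) (simp_all add: nn_integral_cmult)
  also have "\<dots> = 4 * (\<integral>\<^sup>+x. ennreal ((norm (g x))\<^sup>2) \<partial>lborel)"
    by (simp flip: distrib_right)
  finally show ?thesis .
qed

text \<open>
  The heat kernel concentrates at the origin, where the translation defect is small. Away from the
  origin the defect is merely bounded, which the second moment of the kernel compensates.
\<close>
lemma gauss_defect_tendsto_0:
  fixes g :: "'a::euclidean_space \<Rightarrow> complex"
  assumes [measurable]: "g \<in> borel_measurable borel"
    and fin: "(\<integral>\<^sup>+x. ennreal ((norm (g x))\<^sup>2) \<partial>lborel) < \<infinity>"
    and lim: "(translation_defect g \<longlongrightarrow> 0) (at 0)"
  shows "((\<lambda>t. gauss_defect t g) \<longlongrightarrow> 0) (at_right 0)"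
proof (rule order_tendstoI)
  fix e :: ennreal assume "e > 0"
  \<comment> \<open>a real threshold below \<open>e\<close>, which may be infinite\<close>
  define \<epsilon> where "\<epsilon> = (if e = \<infinity> then 1 else enn2real e)"
  have \<epsilon>: "\<epsilon> > 0" "ennreal \<epsilon> \<le> e"
    using \<open>e > 0\<close> by (cases e; simp add: \<epsilon>_def)+
  obtain N where N: "(\<integral>\<^sup>+x. ennreal ((norm (g x))\<^sup>2) \<partial>lborel) = ennreal N" "N \<ge> 0"
    using fin by (cases "\<integral>\<^sup>+x. ennreal ((norm (g x))\<^sup>2) \<partial>lborel") auto
  have "\<forall>\<^sub>F z in at 0. translation_defect g z < ennreal (\<epsilon>/2)"
    using lim \<epsilon> by (intro order_tendstoD(2)[OF lim]) auto
  then obtain \<delta> where \<delta>: "\<delta> > 0" "\<And>z. z \<noteq> 0 \<Longrightarrow> norm z < \<delta> \<Longrightarrow> translation_defect g z < ennreal (\<epsilon>/2)"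
    by (auto simp: eventually_at)
  \<comment> \<open>for \<open>norm z \<ge> \<delta>\<close> the crude bound \<open>4 * N\<close> on the defect is at most \<open>K * (norm z)\<^sup>2\<close>\<close>
  define K where "K = 4 * N / \<delta>\<^sup>2"
  define c where "c = 8 * 2 powr (real DIM('a) / 2)"
  have K: "K \<ge> 0" using N by (simp add: K_def)
  have c: "c > 0" by (simp add: c_def)
  have bound: "translation_defect g z \<le> ennreal (\<epsilon>/2) + ennreal (K * (norm z)\<^sup>2)" for z
  proof (cases "norm z < \<delta>")
    case True
    then have "translation_defect g z \<le> ennreal (\<epsilon>/2)"
      using \<delta>(2)[of z] by (cases "z = 0") (auto simp: translation_defect_def)
    then show ?thesis by (simp add: add_increasing2)
  next
    case False
    then have "1 \<le> (norm z)\<^sup>2 / \<delta>\<^sup>2" using \<delta> by (simp add: power_mono)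
    from mult_left_mono[OF this, of "4 * N"] have "4 * N \<le> K * (norm z)\<^sup>2" using N by (simp add: K_def)
    moreover have "translation_defect g z \<le> ennreal (4 * N)"
      using translation_defect_le[OF assms(1), of z] N by (simp add: ennreal_mult)
    ultimately have "translation_defect g z \<le> ennreal (K * (norm z)\<^sup>2)"
      using order_trans ennreal_leI by blast
    then show ?thesis by (simp add: add_increasing)
  qed
  have main: "gauss_defect t g \<le> ennreal (\<epsilon>/2 + K * c * t)" if t: "t > 0" for t
  proof -
    have "gauss_defect t g \<le> (\<integral>\<^sup>+z. ennreal (\<epsilon>/2) * ennreal (gauss t (z::'a)) + ennreal K * ennreal ((norm z)\<^sup>2 * gauss t z) \<partial>lborel)"
      unfolding gauss_defect_eq[OF assms(1)]
    proof (rule nn_integral_mono)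
      fix z :: 'a
      have "translation_defect g z * ennreal (gauss t z) \<le> (ennreal (\<epsilon>/2) + ennreal (K * (norm z)\<^sup>2)) * ennreal (gauss t z)"
        by (intro mult_right_mono bound) auto
      also have "\<dots> = ennreal (\<epsilon>/2) * ennreal (gauss t z) + ennreal K * ennreal ((norm z)\<^sup>2 * gauss t z)"
        using K by (simp add: distrib_right ennreal_mult mult.assoc)
      finally show "translation_defect g z * ennreal (gauss t z) \<le> \<dots>" .
    qed
    also have "\<dots> = ennreal (\<epsilon>/2) + ennreal K * (\<integral>\<^sup>+z. ennreal ((norm (z::'a))\<^sup>2 * gauss t z) \<partial>lborel)"
      using t by (subst nn_integral_add) (simp_all add: nn_integral_cmult gauss_nn_integral)
    also have "\<dots> \<le> ennreal (\<epsilon>/2) + ennreal K * ennreal (c * t)"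
      using gauss_second_moment[OF t, where 'a='a] by (intro add_left_mono mult_left_mono) (auto simp: c_def)
    also have "\<dots> = ennreal (\<epsilon>/2 + K * c * t)"
      using K c t \<epsilon> by (simp add: mult.assoc flip: ennreal_plus ennreal_mult)
    finally show ?thesis .
  qed
  have "\<forall>\<^sub>F t in at_right 0. t < \<epsilon> / (2 * (K * c + 1))"
    using \<epsilon> K c by (intro eventually_at_right_less[THEN eventually_mono] eventually_at_rightI[of 0 "\<epsilon> / (2 * (K * c + 1))"]) (auto intro!: divide_pos_pos add_nonneg_pos)
  moreover have "\<forall>\<^sub>F t in at_right 0. (0::real) < t"
    by (simp add: eventually_at_right_less)
  ultimately show "\<forall>\<^sub>F t in at_right 0. gauss_defect t g < e"
  proof eventually_elim
    case (elim t)
    have "K * c * t \<le> (K * c + 1) * t" using elim by (simp add: algebra_simps)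
    also have "\<dots> < \<epsilon> / 2"
    proof -
      have "K * c + 1 > 0" using K c by (simp add: add_nonneg_pos)
      with elim show ?thesis by (simp add: field_simps)
    qed
    finally have "\<epsilon>/2 + K * c * t < \<epsilon>" by simp
    moreover have "0 \<le> \<epsilon>/2 + K * c * t" using \<epsilon> K c elim by simp
    ultimately have "ennreal (\<epsilon>/2 + K * c * t) < ennreal \<epsilon>" using \<epsilon>(1) by (simp add: ennreal_lessI)
    then show ?case using main[of t] elim \<epsilon>(2) by (meson le_less_trans less_le_trans)
  qed
qed simp

text \<open>
  In \<open>gauss_fourier_identity\<close> the defect vanishes as \<open>t\<close> tends to \<open>0\<close>, and the weights
  \<open>exp (- t \<bar>\<xi>\<bar>\<^sup>2)\<close> increase to one. Continuity of translations in \<open>L\<^sup>2\<close> is kept as a hypothesis because the two kinds of functions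
  that occur satisfy it for different elementary reasons: finite energy, or continuity almost everywhere.
\<close>
theorem plancherel:
  fixes g :: "'a::euclidean_space \<Rightarrow> complex"
  assumes [measurable]: "g \<in> borel_measurable borel"
    and i: "integrable lborel g" and i2: "integrable lborel (\<lambda>x. (norm (g x))\<^sup>2)"
    and lim: "(translation_defect g \<longlongrightarrow> 0) (at 0)"
  shows "(\<integral>\<^sup>+\<xi>. ennreal ((norm (fourier g \<xi>))\<^sup>2) \<partial>lborel) = (\<integral>\<^sup>+x. ennreal ((norm (g x))\<^sup>2) \<partial>lborel)"
proof -
  let ?t = "\<lambda>n::nat. 1 / real (Suc n)"
  let ?f = "\<lambda>n \<xi>. ennreal (exp (- ?t n * (norm \<xi>)\<^sup>2) * (norm (fourier g \<xi>))\<^sup>2)"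
  have fin: "(\<integral>\<^sup>+x. ennreal ((norm (g x))\<^sup>2) \<partial>lborel) < \<infinity>"
    using i2 by (simp add: integrable_iff_bounded)
  have t0: "filterlim ?t (at_right 0) sequentially"
    using LIMSEQ_Suc[OF lim_1_over_n[where 'a=real]] by (auto simp: filterlim_at simp del: of_nat_Suc)
  have 1: "(\<lambda>n. \<integral>\<^sup>+\<xi>. ?f n \<xi> \<partial>lborel) \<longlonglongrightarrow> (\<integral>\<^sup>+\<xi>. ennreal ((norm (fourier g \<xi>))\<^sup>2) \<partial>lborel)"
  proof (rule nn_integral_LIMSEQ)
    show "incseq ?f"
    proof (rule incseq_SucI, rule le_funI)
      fix n and \<xi> :: 'a
      have "?t (Suc n) * (norm \<xi>)\<^sup>2 \<le> ?t n * (norm \<xi>)\<^sup>2"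
        by (intro mult_right_mono) (auto simp: frac_le)
      then show "?f n \<xi> \<le> ?f (Suc n) \<xi>"
        by (intro ennreal_leI mult_right_mono) auto
    qed
    fix \<xi> :: 'a
    have "(\<lambda>n. exp (- ?t n * (norm \<xi>)\<^sup>2) * (norm (fourier g \<xi>))\<^sup>2) \<longlonglongrightarrow> exp (- 0 * (norm \<xi>)\<^sup>2) * (norm (fourier g \<xi>))\<^sup>2"
      by (intro tendsto_intros LIMSEQ_Suc lim_1_over_n)
    then show "(\<lambda>n. ?f n \<xi>) \<longlonglongrightarrow> ennreal ((norm (fourier g \<xi>))\<^sup>2)"
      by (simp add: tendsto_ennrealI)
  qed measurable
  have 2: "(\<lambda>n. gauss_defect (?t n) g) \<longlonglongrightarrow> 0"
    by (rule filterlim_compose[OF gauss_defect_tendsto_0[OF assms(1) fin lim] t0])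
  have 3: "(\<integral>\<^sup>+\<xi>. ?f n \<xi> \<partial>lborel) + ennreal (1/2) * gauss_defect (?t n) g = (\<integral>\<^sup>+x. ennreal ((norm (g x))\<^sup>2) \<partial>lborel)" for n
    by (rule gauss_fourier_identity[OF assms(1) i i2]) simp
  have "(\<lambda>n. (\<integral>\<^sup>+\<xi>. ?f n \<xi> \<partial>lborel) + ennreal (1/2) * gauss_defect (?t n) g)
     \<longlonglongrightarrow> (\<integral>\<^sup>+\<xi>. ennreal ((norm (fourier g \<xi>))\<^sup>2) \<partial>lborel) + ennreal (1/2) * 0"
    by (intro tendsto_add 1 ennreal_tendsto_cmult 2 ennreal_less_top)
  from LIMSEQ_unique[OF this[unfolded 3] tendsto_const] show ?thesis by simp
qed

lemma translation_defect_tendsto_0_AE_continuous: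
  fixes g :: "'a::euclidean_space \<Rightarrow> complex"
  assumes [measurable]: "g \<in> borel_measurable borel"
    and bd: "\<And>x. norm (g x) \<le> M" and supp: "\<And>x. norm x \<ge> R \<Longrightarrow> g x = 0"
    and cont: "AE x in lborel. isCont g x"
  shows "(translation_defect g \<longlongrightarrow> 0) (at 0)"
proof -
  have M: "M \<ge> 0" using bd[of 0] norm_ge_zero order_trans by blast
  have "(\<lambda>n. translation_defect g (X n)) \<longlonglongrightarrow> 0" if X: "X \<longlonglongrightarrow> 0" "\<And>n. norm (X n) \<le> 1" for X
  proof -
    have [measurable]: "cball (0::'a) (\<bar>R\<bar> + 1) \<in> sets borel" by simp
    let ?w = "\<lambda>x::'a. ennreal ((2 * M)\<^sup>2) * indicator (cball 0 (\<bar>R\<bar> + 1)) x"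
    have "(\<lambda>n. \<integral>\<^sup>+x. ennreal ((norm (g (x + X n) - g x))\<^sup>2) \<partial>lborel) \<longlonglongrightarrow> (\<integral>\<^sup>+x. 0 \<partial>(lborel::'a measure))"
    proof (rule nn_integral_dominated_convergence[where w="?w"])
      show "(\<integral>\<^sup>+x. ?w x \<partial>lborel) < \<infinity>"
        using emeasure_lborel_cball_finite[of "0::'a" "\<bar>R\<bar> + 1"]
        by (subst nn_integral_cmult_indicator) (simp_all add: ennreal_mult_less_top)
      fix n
      show "AE x in lborel. ennreal ((norm (g (x + X n) - g x))\<^sup>2) \<le> ?w x"
      proof (rule AE_I2)
        fix x
        show "ennreal ((norm (g (x + X n) - g x))\<^sup>2) \<le> ?w x"
        proof (cases "norm x \<le> \<bar>R\<bar> + 1")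
          case True
          have "norm (g (x + X n) - g x) \<le> 2 * M"
            using norm_triangle_ineq4[of "g (x + X n)" "g x"] bd[of x] bd[of "x + X n"] by simp
          then have "(norm (g (x + X n) - g x))\<^sup>2 \<le> (2 * M)\<^sup>2" by (intro power_mono) auto
          then show ?thesis using True by (simp add: ennreal_leI)
        next
          case False
          then have "norm (x + X n) \<ge> R" using X(2)[of n] norm_triangle_ineq4[of "x + X n" "X n"] by simp
          then show ?thesis using supp[of x] supp[of "x + X n"] False by simp
        qed
      qed
    next
      show "AE x in lborel. (\<lambda>n. ennreal ((norm (g (x + X n) - g x))\<^sup>2)) \<longlonglongrightarrow> 0"
        using cont
      proof eventually_elim
        case (elim x)
        have "(\<lambda>n. x + X n) \<longlonglongrightarrow> x" using tendsto_add[OF tendsto_const X(1), of x] by simp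
        from isCont_tendsto_compose[OF elim this] have "(\<lambda>n. g (x + X n)) \<longlonglongrightarrow> g x" .
        then have "(\<lambda>n. (norm (g (x + X n) - g x))\<^sup>2) \<longlonglongrightarrow> (norm (g x - g x))\<^sup>2" by (intro tendsto_intros)
        then show ?case using tendsto_ennrealI by fastforce
      qed
    qed measurable
    then show ?thesis unfolding translation_defect_def by simp
  qed note * = this
  show ?thesis
    unfolding tendsto_at_iff_sequentially comp_def
  proof safe
    fix X :: "nat \<Rightarrow> 'a" assume X: "\<forall>i. X i \<in> UNIV - {0}" "X \<longlonglongrightarrow> 0"
    define Y where "Y n = (if norm (X n) \<le> 1 then X n else 0)" for n
    have ev: "\<forall>\<^sub>F n in sequentially. Y n = X n"
      using order_tendstoD(2)[OF tendsto_norm[OF X(2)], of 1] by (auto simp: Y_def elim: eventually_mono)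
    have "Y \<longlonglongrightarrow> 0" 
      by (rule Lim_transform_eventually[OF X(2)]) (use ev in eventually_elim, simp)
    then have "(\<lambda>n. translation_defect g (Y n)) \<longlonglongrightarrow> 0" by (rule *) (simp add: Y_def)
    moreover have "\<forall>\<^sub>F n in sequentially. translation_defect g (Y n) = translation_defect g (X n)"
      using ev by eventually_elim simp
    ultimately show "(\<lambda>n. translation_defect g (X n)) \<longlonglongrightarrow> 0"
      using tendsto_cong by force
  qed
qed

section \<open>The Gagliardo energy as a superposition of Gaussian energies\<close>

definition riesz :: "real \<Rightarrow> 'a::euclidean_space \<Rightarrow> real" where
  "riesz s z = norm z powr (- (real DIM('a) + 2 * s))"

lemma riesz_nonneg [simp]: "0 \<le> riesz s z"
  by (simp add: riesz_def)

lemma riesz_measurable [measurable]: "riesz s \<in> borel_measurable borel"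
  unfolding riesz_def by measurable

text \<open>
  The Gagliardo seminorm as an iterated integral over Borel--Lebesgue measure and for values in any normed space,
  so that it applies to real and complex functions alike; \<open>gagliardo_sq_eq_gag\<close> links it to \<open>gagliardo_sq\<close>.
\<close>
definition gag :: "real \<Rightarrow> ('a::euclidean_space \<Rightarrow> 'b::real_normed_vector) \<Rightarrow> ennreal" where
  "gag s g = (\<integral>\<^sup>+x. \<integral>\<^sup>+y. ennreal ((norm (g x - g y))\<^sup>2) * ennreal (riesz s (x - y)) \<partial>lborel \<partial>lborel)"

lemma gag_of_real: "gag s (\<lambda>x. complex_of_real (v x)) = gag s v"
  unfolding gag_def by (simp flip: of_real_diff)

lemma gagliardo_sq_eq_gag:
  assumes [measurable]: "v \<in> borel_measurable borel"
  shows "gagliardo_sq s v = gag s v"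
proof -
  have "gagliardo_sq s v = (\<integral>\<^sup>+(x, y). ennreal ((norm (v x - v y))\<^sup>2) * ennreal (riesz s (x - y)) \<partial>(lborel \<Otimes>\<^sub>M lborel))"
    unfolding gagliardo_sq_def nn_integral_completion lborel_prod riesz_def powr_minus_divide
    by (intro nn_integral_cong) (auto simp flip: ennreal_mult)
  also have "\<dots> = gag s v"
    unfolding gag_def by (subst lborel.nn_integral_fst[symmetric]) auto
  finally show ?thesis .
qed

text \<open>
  The Mellin transform of \<open>f\<close> at \<open>- s\<close>.
\<close>
definition mellin :: "real \<Rightarrow> (real \<Rightarrow> real) \<Rightarrow> ennreal" where
  "mellin s f = (\<integral>\<^sup>+t. ennreal (f t * t powr (- 1 - s)) * indicator {0<..} t \<partial>lborel)"

lemma mellin_mono: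
  assumes "\<And>t. t > 0 \<Longrightarrow> f t \<le> g t"
  shows "mellin s f \<le> mellin s g"
  unfolding mellin_def using assms
  by (intro nn_integral_mono) (auto simp: indicator_def intro!: ennreal_leI mult_right_mono)

lemma mellin_cong:
  assumes "\<And>t. t > 0 \<Longrightarrow> f t = g t"
  shows "mellin s f = mellin s g"
  using assms by (intro antisym mellin_mono) auto

lemma mellin_cmult:
  assumes "c \<ge> 0" and [measurable]: "f \<in> borel_measurable borel"
  shows "mellin s (\<lambda>t. c * f t) = ennreal c * mellin s f"
  unfolding mellin_def using assms
  by (subst nn_integral_cmult[symmetric]) (auto simp: ennreal_mult' mult.assoc)

text \<open>
  Homogeneity under dilations of \<open>t\<close>. It produces the powers of \<open>\<bar>\<xi>\<bar>\<close> and \<open>\<bar>z\<bar>\<close> below.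
\<close>
lemma mellin_scale:
  assumes [measurable]: "f \<in> borel_measurable borel" and c: "c > 0"
  shows "mellin s (\<lambda>t. f (c * t)) = ennreal (c powr s) * mellin s f"
proof -
  have "mellin s f = ennreal c * (\<integral>\<^sup>+t. ennreal (f (c * t) * (c * t) powr (- 1 - s)) * indicator {0<..} (c * t) \<partial>lborel)"
    unfolding mellin_def using c by (subst nn_integral_real_affine[of _ c 0]) auto
  also have "\<dots> = ennreal (c powr (- s)) * mellin s (\<lambda>t. f (c * t))"
  proof -
    have "c * (f (c * t) * (c * t) powr (- 1 - s)) = c powr (- s) * (f (c * t) * t powr (- 1 - s))" if "t > 0" for t
      using c that by (simp add: powr_mult powr_diff powr_minus divide_simps)
    note * = this
    have "ennreal c * (ennreal (f (c * t) * (c * t) powr (- 1 - s)) * indicator {0<..} (c * t))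
        = ennreal (c powr (- s)) * (ennreal (f (c * t) * t powr (- 1 - s)) * indicator {0<..} t)" for t
    proof (cases "t > 0")
      case True
      have "ennreal c * ennreal (f (c * t) * (c * t) powr (- 1 - s)) = ennreal (c powr (- s)) * ennreal (f (c * t) * t powr (- 1 - s))"
        using *[OF True] c by (metis ennreal_mult' powr_ge_zero less_imp_le)
      then show ?thesis using True c by simp
    next
      case False
      then show ?thesis using c by (simp add: zero_less_mult_iff)
    qed
    then show ?thesis
      unfolding mellin_def by (subst (1 2) nn_integral_cmult[symmetric]) simp_all
  qed
  finally have "ennreal (c powr s) * mellin s f = ennreal (c powr s * c powr (- s)) * mellin s (\<lambda>t. f (c * t))"
    by (simp add: ennreal_mult mult.assoc)
  also have "c powr s * c powr (- s) = 1" using c by (simp flip: powr_add)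
  finally show ?thesis by simp
qed

lemma mellin_min_finite:
  assumes s: "0 < s" "s < 1"
  shows "mellin s (\<lambda>t. min 1 t) < \<infinity>"
proof -
  have "mellin s (\<lambda>t. min 1 t) \<le> (\<integral>\<^sup>+t. ennreal (t powr (-s)) * indicator {0..1} t + ennreal (t powr (- 1 - s)) * indicator {1..} t \<partial>lborel)"
    unfolding mellin_def
  proof (intro nn_integral_mono)
    fix t :: real
    have "t * t powr (- 1 - s) = t powr (- s)" if "t > 0"
      using that by (simp add: powr_diff powr_minus divide_simps)
    then show "ennreal (min 1 t * t powr (- 1 - s)) * indicator {0<..} t
       \<le> ennreal (t powr (-s)) * indicator {0..1} t + ennreal (t powr (- 1 - s)) * indicator {1..} t"
      by (auto simp: indicator_def min_def intro!: ennreal_leI)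
  qed
  also have "\<dots> = (\<integral>\<^sup>+t. ennreal (t powr (-s)) * indicator {0..1} t \<partial>lborel) + (\<integral>\<^sup>+t. ennreal (t powr (- 1 - s)) * indicator {1..} t \<partial>lborel)"
    by (rule nn_integral_add) measurable
  also have "(\<integral>\<^sup>+t. ennreal (t powr (-s)) * indicator {0..1} t \<partial>lborel) = ennreal (1 powr (-s + 1) / (-s + 1))"
    by (rule nn_integral_has_integral_lebesgue'[OF _ has_integral_powr_from_0]) (use s in auto)
  also have "(\<integral>\<^sup>+t. ennreal (t powr (- 1 - s)) * indicator {1..} t \<partial>lborel) = ennreal (-(1 powr (- 1 - s + 1)) / (- 1 - s + 1))"
    by (rule nn_integral_has_integral_lebesgue'[OF _ has_integral_powr_to_inf]) (use s in auto)
  finally show ?thesis by (simp add: less_top order.strict_trans1)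
qed

lemma mellin_finite:
  assumes s: "0 < s" "s < 1" and "c \<ge> 0" and "\<And>t. t > 0 \<Longrightarrow> f t \<le> c * min 1 t"
  shows "mellin s f < \<infinity>"
proof -
  have "mellin s f \<le> mellin s (\<lambda>t. c * min 1 t)" by (rule mellin_mono) (use assms in auto)
  also have "\<dots> = ennreal c * mellin s (\<lambda>t. min 1 t)" by (rule mellin_cmult) (use assms in auto)
  also have "\<dots> < \<infinity>" using mellin_min_finite[OF s] by (simp add: ennreal_mult_less_top)
  finally show ?thesis .
qed

lemma mellin_pos:
  assumes [measurable]: "f \<in> borel_measurable borel" and "c > 0" "\<And>t. 1 \<le> t \<Longrightarrow> t \<le> 2 \<Longrightarrow> c \<le> f t"
  shows "mellin s f > 0"
proof -
  define d where "d = c * min 1 (2 powr (- 1 - s))"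
  have d: "d > 0" using assms by (simp add: d_def)
  have "ennreal d * indicator {1..2} t \<le> ennreal (f t * t powr (- 1 - s)) * indicator {0<..} t" for t :: real
  proof (cases "t \<in> {1..2}")
    case True
    have "min 1 (2 powr (- 1 - s)) \<le> t powr (- 1 - s)"
      using True powr_mono2'[of "1 + s" t 2] powr_mono_both[of 0 "- 1 - s" 1 t]
      by (cases "- 1 - s \<le> 0") (auto simp: min_le_iff_disj intro: powr_mono2')
    then have "d \<le> f t * t powr (- 1 - s)" unfolding d_def
      using assms(2) assms(3)[of t] True by (intro mult_mono) auto
    then show ?thesis using True by (auto intro: ennreal_leI)
  qed auto
  then have "(\<integral>\<^sup>+t. ennreal d * indicator {1..2} (t::real) \<partial>lborel) \<le> mellin s f"
    unfolding mellin_def by (rule nn_integral_mono)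
  moreover have "(\<integral>\<^sup>+t. ennreal d * indicator {1..2} (t::real) \<partial>lborel) = ennreal d"
    by (subst nn_integral_cmult_indicator) auto
  ultimately show ?thesis using d by (metis ennreal_less_zero_iff less_le_trans)
qed

text \<open>
  The maximum over \<open>t\<close>, up to the constant, from \<open>ln y \<le> y - 1\<close> at \<open>y = 1 / (4 * p * t)\<close>.
\<close>
lemma powr_exp_bound:
  fixes p t :: real
  assumes p: "p > 0" and t: "t > 0"
  shows "t powr (- p) * exp (- 1 / (4 * t)) \<le> (4 * p) powr p"
proof -
  define a where "a = 1 / t"
  have a: "a > 0" using t by (simp add: a_def)
  have "ln (a / (4 * p)) \<le> a / (4 * p) - 1" using a p by (intro ln_le_minus_one) simp
  then have "p * ln (a / (4 * p)) \<le> p * (a / (4 * p) - 1)" using p by (intro mult_left_mono) auto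
  also have "\<dots> \<le> a / 4" using p by (simp add: algebra_simps)
  finally have "(a / (4 * p)) powr p \<le> exp (a / 4)" using a p by (simp add: powr_def)
  then have "a powr p \<le> (4 * p) powr p * exp (a / 4)" using a p by (simp add: powr_divide divide_simps mult.commute)
  then have "a powr p * exp (- a / 4) \<le> (4 * p) powr p" by (simp add: exp_minus field_simps)
  moreover have "a powr p = t powr (- p)" using t by (simp add: a_def powr_divide powr_minus_divide)
  moreover have "- a / 4 = - 1 / (4 * t)" by (simp add: a_def)
  ultimately show ?thesis by (simp only:)
qed

text \<open>
  The two factors that appear when the heat semigroup is integrated in time: one relates
  \<open>1 - exp (- t \<bar>\<xi>\<bar>\<^sup>2)\<close> to \<open>\<bar>\<xi>\<bar> powr (2 * s)\<close>, the other the heat kernel in dimension \<open>d\<close> to the Riesz kernel.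
\<close>
definition symbol_const :: "real \<Rightarrow> ennreal" where
  "symbol_const s = mellin s (\<lambda>t. 1 - exp (- t))"

definition kernel_const :: "real \<Rightarrow> real \<Rightarrow> ennreal" where
  "kernel_const d s = mellin s (\<lambda>t. (4 * pi * t) powr (- d / 2) * exp (- 1 / (4 * t)))"

lemma symbol_const_bounds:
  assumes "0 < s" "s < 1"
  shows "0 < symbol_const s" "symbol_const s < \<infinity>"
proof -
  show "0 < symbol_const s" unfolding symbol_const_def
    by (rule mellin_pos[where c="1 - exp (- 1)"]) auto
  show "symbol_const s < \<infinity>" unfolding symbol_const_def
  proof (rule mellin_finite[where c=1, OF assms])
    fix t :: real assume "t > 0"
    then show "1 - exp (- t) \<le> 1 * min 1 t"
      using exp_ge_add_one_self[of "- t"] by (simp add: min_def)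
  qed simp
qed

lemma kernel_const_bounds:
  assumes "0 < s" "s < 1" "d > 0"
  shows "0 < kernel_const d s" "kernel_const d s < \<infinity>"
proof -
  show "0 < kernel_const d s" unfolding kernel_const_def
  proof (rule mellin_pos[where c="(8 * pi) powr (- d / 2) * exp (- 1 / 4)"])
    fix t :: real assume t: "1 \<le> t" "t \<le> 2"
    show "(8 * pi) powr (- d / 2) * exp (- 1 / 4) \<le> (4 * pi * t) powr (- d / 2) * exp (- 1 / (4 * t))"
    proof (intro mult_mono)
      show "(8 * pi) powr (- d / 2) \<le> (4 * pi * t) powr (- d / 2)"
        using assms t by (intro powr_mono2') auto
      show "exp (- 1 / 4) \<le> exp (- 1 / (4 * t))" using t by (simp add: field_simps)
    qed auto
  qed simp_all
  \<comment> \<open>Two exponents in \<open>powr_exp_bound\<close>: \<open>d / 2\<close> bounds the integrand for large times, \<open>d / 2 + 1\<close>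
    provides the factor \<open>t\<close> needed for small ones.\<close>
  define A where "A = max ((4 * (d / 2)) powr (d / 2)) ((4 * (d / 2 + 1)) powr (d / 2 + 1))"
  have A: "A \<ge> 0" by (simp add: A_def le_max_iff_disj)
  show "kernel_const d s < \<infinity>" unfolding kernel_const_def
  proof (rule mellin_finite[where c="(4 * pi) powr (- d / 2) * A", OF assms(1,2)])
    fix t :: real assume t: "t > 0"
    have 1: "t powr (- (d / 2)) * exp (- 1 / (4 * t)) \<le> A"
      using powr_exp_bound[of "d / 2" t] t assms unfolding A_def by linarith
    have "t powr (- (d / 2 + 1)) * exp (- 1 / (4 * t)) \<le> A"
      using powr_exp_bound[of "d / 2 + 1" t] t assms unfolding A_def by linarith
    moreover have "t powr (- (d / 2)) = t * t powr (- (d / 2 + 1))"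
      using t powr_add[of t 1 "- (d / 2 + 1)"] by simp
    ultimately have 2: "t powr (- (d / 2)) * exp (- 1 / (4 * t)) \<le> A * t"
      using t by (simp add: mult_ac)
    have "t powr (- (d / 2)) * exp (- 1 / (4 * t)) \<le> A * min 1 t"
      using 1 2 by (simp add: min_def)
    then show "(4 * pi * t) powr (- d / 2) * exp (- 1 / (4 * t)) \<le> (4 * pi) powr (- d / 2) * A * min 1 t"
      using t by (simp add: powr_mult mult.assoc mult_left_mono)
  qed (use A in auto)
qed

lemma mellin_symbol:
  fixes \<xi> :: "'a::euclidean_space"
  assumes s: "0 < s" "s < 1"
  shows "mellin s (\<lambda>t. 1 - exp (- t * (norm \<xi>)\<^sup>2)) = ennreal (norm \<xi> powr (2 * s)) * symbol_const s"
proof (cases "\<xi> = 0")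
  case True
  then show ?thesis by (simp add: mellin_def)
next
  case False
  have "mellin s (\<lambda>t. 1 - exp (- ((norm \<xi>)\<^sup>2 * t))) = ennreal (((norm \<xi>)\<^sup>2) powr s) * symbol_const s"
    unfolding symbol_const_def using False by (intro mellin_scale) auto
  moreover have "((norm \<xi>)\<^sup>2) powr s = norm \<xi> powr (2 * s)"
    using False by (simp add: powr_powr flip: powr_numeral)
  ultimately show ?thesis by (simp add: mult.commute)
qed

lemma mellin_gauss:
  fixes z :: "'a::euclidean_space"
  assumes z: "z \<noteq> 0" and s: "0 < s" "s < 1"
  shows "mellin s (\<lambda>t. gauss t z) = kernel_const (real DIM('a)) s * ennreal (riesz s z)"
proof -
  let ?d = "real DIM('a)"
  let ?f = "\<lambda>t. (4 * pi * t) powr (- ?d / 2) * exp (- 1 / (4 * t))"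
  define c where "c = 1 / (norm z)\<^sup>2"
  have c: "c > 0" using z by (simp add: c_def)
  have "gauss t z = c powr (?d / 2) * ?f (c * t)" if t: "t > 0" for t
  proof -
    have "4 * pi * t = (4 * pi * (c * t)) * (1 / c)" using c by simp
    then have "(4 * pi * t) powr (- ?d / 2) = (4 * pi * (c * t)) powr (- ?d / 2) * (1 / c) powr (- ?d / 2)"
      using c t by (metis powr_mult)
    also have "(1 / c) powr (- ?d / 2) = c powr (?d / 2)"
      using c by (simp add: powr_divide powr_minus_divide)
    finally have "(4 * pi * t) powr (- ?d / 2) = c powr (?d / 2) * (4 * pi * (c * t)) powr (- ?d / 2)"
      by (simp only: mult.commute)
    moreover have "- (norm z)\<^sup>2 / (4 * t) = - 1 / (4 * (c * t))"
      by (simp add: c_def)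
    ultimately show ?thesis by (simp only: gauss_def mult.assoc)
  qed
  then have "mellin s (\<lambda>t. gauss t z) = mellin s (\<lambda>t. c powr (?d / 2) * ?f (c * t))"
    by (intro mellin_cong)
  also have "\<dots> = ennreal (c powr (?d / 2)) * mellin s (\<lambda>t. ?f (c * t))"
    by (rule mellin_cmult) auto
  also have "mellin s (\<lambda>t. ?f (c * t)) = ennreal (c powr s) * kernel_const ?d s"
    unfolding kernel_const_def using c by (intro mellin_scale) auto
  also have "ennreal (c powr (?d / 2)) * (ennreal (c powr s) * kernel_const ?d s) = kernel_const ?d s * ennreal (c powr (?d / 2 + s))"
    by (simp add: powr_add ennreal_mult mult_ac)
  also have "c powr (?d / 2 + s) = riesz s z"
  proof -
    have "c = norm z powr (- 2)" using z by (simp add: c_def powr_minus_divide)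
    then have "c powr (?d / 2 + s) = norm z powr (- 2 * (?d / 2 + s))" by (simp only: powr_powr)
    then show ?thesis by (simp add: riesz_def algebra_simps)
  qed
  finally show ?thesis .
qed

lemma mellin_Fubini:
  fixes F :: "real \<Rightarrow> 'a::euclidean_space \<Rightarrow> real"
  assumes [measurable]: "case_prod F \<in> borel_measurable (borel \<Otimes>\<^sub>M borel)" "w \<in> borel_measurable borel"
  shows "(\<integral>\<^sup>+t. (\<integral>\<^sup>+x. w x * ennreal (F t x) \<partial>lborel) * ennreal (t powr (- 1 - s)) * indicator {0<..} t \<partial>lborel)
       = (\<integral>\<^sup>+x. w x * mellin s (\<lambda>t. F t x) \<partial>lborel)"
proof -
  have "(\<integral>\<^sup>+t. (\<integral>\<^sup>+x. w x * ennreal (F t x) \<partial>lborel) * ennreal (t powr (- 1 - s)) * indicator {0<..} t \<partial>lborel)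
      = (\<integral>\<^sup>+t. \<integral>\<^sup>+x. w x * (ennreal (F t x * t powr (- 1 - s)) * indicator {0<..} t) \<partial>lborel \<partial>lborel)"
    by (simp add: nn_integral_multc[symmetric] ennreal_mult'' mult.assoc)
  also have "\<dots> = (\<integral>\<^sup>+x. \<integral>\<^sup>+t. w x * (ennreal (F t x * t powr (- 1 - s)) * indicator {0<..} t) \<partial>lborel \<partial>lborel)"
    by (rule lborel_pair.Fubini'[symmetric]) measurable
  also have "\<dots> = (\<integral>\<^sup>+x. w x * mellin s (\<lambda>t. F t x) \<partial>lborel)"
    unfolding mellin_def by (intro nn_integral_cong nn_integral_cmult) measurable
  finally show ?thesis .
qed

lemma gag_eq_translation_defect:
  fixes g :: "'a::euclidean_space \<Rightarrow> 'b::{second_countable_topology, real_normed_vector}"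
  assumes [measurable]: "g \<in> borel_measurable borel"
  shows "gag s g = (\<integral>\<^sup>+z. translation_defect g z * ennreal (riesz s z) \<partial>lborel)"
  unfolding gag_def translation_defect_def
  by (subst nn_integral_difference_kernel[symmetric]) auto

text \<open>
  Subtracting \<open>gauss_fourier_identity\<close> from Plancherel's theorem gives, for every \<open>t\<close>,
  \<open>\<integral> \<bar>Fg\<bar>\<^sup>2 (1 - exp (- t \<bar>\<xi>\<bar>\<^sup>2)) = 1/2 \<integral>\<integral> \<bar>g x - g y\<bar>\<^sup>2 G\<^sub>t(x - y)\<close>; take the Mellin transform of
  both sides in \<open>t\<close>.
\<close>
lemma fourier_energy:
  fixes g :: "'a::euclidean_space \<Rightarrow> complex"
  assumes s: "0 < s" "s < 1" and [measurable]: "g \<in> borel_measurable borel"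
    and i: "integrable lborel g" and i2: "integrable lborel (\<lambda>x. (norm (g x))\<^sup>2)"
    and lim: "(translation_defect g \<longlongrightarrow> 0) (at 0)"
  shows "(\<integral>\<^sup>+\<xi>. ennreal ((norm (fourier g \<xi>))\<^sup>2) * ennreal (norm \<xi> powr (2 * s)) \<partial>lborel) * symbol_const s
       = ennreal (1/2) * kernel_const (real DIM('a)) s * gag s g"
proof -
  let ?F = "\<lambda>\<xi>. ennreal ((norm (fourier g \<xi>))\<^sup>2)"
  have fin: "(\<integral>\<^sup>+\<xi>. ?F \<xi> \<partial>lborel) < \<infinity>"
    unfolding plancherel[OF assms(3) i i2 lim] using i2 by (simp add: integrable_iff_bounded)
  have *: "(\<integral>\<^sup>+\<xi>. ?F \<xi> * ennreal (1 - exp (- t * (norm \<xi>)\<^sup>2)) \<partial>lborel) = ennreal (1/2) * gauss_defect t g" if t: "t > 0" for t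
  proof -
    let ?E = "(\<integral>\<^sup>+\<xi>. ennreal (exp (- t * (norm \<xi>)\<^sup>2) * (norm (fourier g \<xi>))\<^sup>2) \<partial>lborel)"
    have "?E + (\<integral>\<^sup>+\<xi>. ?F \<xi> * ennreal (1 - exp (- t * (norm \<xi>)\<^sup>2)) \<partial>lborel)
        = (\<integral>\<^sup>+\<xi>. ennreal (exp (- t * (norm \<xi>)\<^sup>2) * (norm (fourier g \<xi>))\<^sup>2) + ?F \<xi> * ennreal (1 - exp (- t * (norm \<xi>)\<^sup>2)) \<partial>lborel)"
      by (rule nn_integral_add[symmetric]) measurable
    also have "\<dots> = (\<integral>\<^sup>+\<xi>. ?F \<xi> \<partial>lborel)"
    proof (rule nn_integral_cong)
      fix \<xi> :: 'a
      define e where "e = exp (- t * (norm \<xi>)\<^sup>2)"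
      have e: "0 \<le> e" "e \<le> 1" using t by (simp_all add: e_def)
      have "ennreal (e * (norm (fourier g \<xi>))\<^sup>2) + ?F \<xi> * ennreal (1 - e)
          = ennreal (e * (norm (fourier g \<xi>))\<^sup>2 + (norm (fourier g \<xi>))\<^sup>2 * (1 - e))"
        using e by (simp add: ennreal_mult ennreal_plus)
      also have "e * (norm (fourier g \<xi>))\<^sup>2 + (norm (fourier g \<xi>))\<^sup>2 * (1 - e) = (norm (fourier g \<xi>))\<^sup>2"
        by (simp add: algebra_simps)
      finally show "ennreal (exp (- t * (norm \<xi>)\<^sup>2) * (norm (fourier g \<xi>))\<^sup>2) + ?F \<xi> * ennreal (1 - exp (- t * (norm \<xi>)\<^sup>2)) = ?F \<xi>"
        unfolding e_def .
    qed
    also have "\<dots> = ?E + ennreal (1/2) * gauss_defect t g"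
      unfolding plancherel[OF assms(3) i i2 lim] by (rule gauss_fourier_identity[OF assms(3) i i2 t, symmetric])
    finally have eq: "?E + (\<integral>\<^sup>+\<xi>. ?F \<xi> * ennreal (1 - exp (- t * (norm \<xi>)\<^sup>2)) \<partial>lborel) = ?E + ennreal (1/2) * gauss_defect t g" .
    have "?E \<le> (\<integral>\<^sup>+\<xi>. ?F \<xi> \<partial>lborel)"
      using t by (intro nn_integral_mono ennreal_leI mult_left_le_one_le) auto
    with fin have "?E \<noteq> \<infinity>" by auto
    with eq show ?thesis unfolding ennreal_add_left_cancel by simp
  qed
  have "(\<integral>\<^sup>+\<xi>. ?F \<xi> * ennreal (norm \<xi> powr (2 * s)) \<partial>lborel) * symbol_const s
      = (\<integral>\<^sup>+\<xi>. ?F \<xi> * mellin s (\<lambda>t. 1 - exp (- t * (norm \<xi>)\<^sup>2)) \<partial>lborel)"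
    by (simp only: mellin_symbol[OF s] mult.assoc[symmetric]) (rule nn_integral_multc[symmetric], measurable)
  also have "\<dots> = (\<integral>\<^sup>+t. (\<integral>\<^sup>+\<xi>. ?F \<xi> * ennreal (1 - exp (- t * (norm \<xi>)\<^sup>2)) \<partial>lborel) * ennreal (t powr (- 1 - s)) * indicator {0<..} t \<partial>lborel)"
    by (rule mellin_Fubini[symmetric]) measurable
  also have "\<dots> = (\<integral>\<^sup>+t. ennreal (1/2) * ((\<integral>\<^sup>+z. translation_defect g z * ennreal (gauss t z) \<partial>lborel) * ennreal (t powr (- 1 - s)) * indicator {0<..} t) \<partial>lborel)"
  proof (rule nn_integral_cong)
    fix t :: real
    show "(\<integral>\<^sup>+\<xi>. ?F \<xi> * ennreal (1 - exp (- t * (norm \<xi>)\<^sup>2)) \<partial>lborel) * ennreal (t powr (- 1 - s)) * indicator {0<..} t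
      = ennreal (1/2) * ((\<integral>\<^sup>+z. translation_defect g z * ennreal (gauss t z) \<partial>lborel) * ennreal (t powr (- 1 - s)) * indicator {0<..} t)"
      using *[of t] gauss_defect_eq[OF assms(3), of t] by (cases "t > 0") (simp_all add: mult.assoc)
  qed
  also have "\<dots> = ennreal (1/2) * (\<integral>\<^sup>+t. ((\<integral>\<^sup>+z. translation_defect g z * ennreal (gauss t z) \<partial>lborel) * ennreal (t powr (- 1 - s)) * indicator {0<..} t) \<partial>lborel)"
  proof -
    have [measurable]: "(\<lambda>(t, z::'a). gauss t z) \<in> borel_measurable (lborel \<Otimes>\<^sub>M lborel)"
      unfolding gauss_def by measurable
    show ?thesis by (rule nn_integral_cmult) measurable
  qed
  also have "(\<integral>\<^sup>+t. ((\<integral>\<^sup>+z. translation_defect g z * ennreal (gauss t z) \<partial>lborel) * ennreal (t powr (- 1 - s)) * indicator {0<..} t) \<partial>lborel)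
      = (\<integral>\<^sup>+z. translation_defect g z * mellin s (\<lambda>t. gauss t z) \<partial>lborel)"
    by (rule mellin_Fubini) (use gauss_measurable_pair in measurable)
  also have "\<dots> = (\<integral>\<^sup>+z. kernel_const (real DIM('a)) s * (translation_defect g z * ennreal (riesz s z)) \<partial>lborel)"
  proof (rule nn_integral_cong)
    fix z :: 'a
    show "translation_defect g z * mellin s (\<lambda>t. gauss t z) = kernel_const (real DIM('a)) s * (translation_defect g z * ennreal (riesz s z))"
      using mellin_gauss[OF _ s, of z] by (cases "z = 0") (auto simp: translation_defect_def mult_ac)
  qed
  also have "\<dots> = kernel_const (real DIM('a)) s * gag s g"
    unfolding gag_eq_translation_defect[OF assms(3)] by (rule nn_integral_cmult) measurable
  finally show ?thesis by (simp add: mult.assoc)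
qed

section \<open>Limits in \<open>L\<^sup>2\<close>\<close>

text \<open>
  The cross term is split with a weight \<open>\<delta>\<close>, so that the first square keeps a factor close to one. This
  stands in for the triangle inequality of the norm, and later weighs the commutator against the main term.
\<close>
lemma norm_add_sq_le_weighted:
  fixes a b :: "'b::real_normed_vector"
  assumes "\<delta> > 0"
  shows "(norm (a + b))\<^sup>2 \<le> (1 + \<delta>) * (norm a)\<^sup>2 + (1 + 1 / \<delta>) * (norm b)\<^sup>2"
proof -
  have "0 \<le> (\<delta> * norm a - norm b)\<^sup>2 / \<delta>" using assms by simp
  also have "\<dots> = \<delta> * (norm a)\<^sup>2 - 2 * norm a * norm b + (norm b)\<^sup>2 / \<delta>"
    using assms by (simp add: power2_eq_square field_simps)
  finally have *: "2 * norm a * norm b \<le> \<delta> * (norm a)\<^sup>2 + (norm b)\<^sup>2 / \<delta>" by simp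
  have "(norm (a + b))\<^sup>2 \<le> (norm a + norm b)\<^sup>2"
    by (intro power_mono norm_triangle_ineq) auto
  also have "\<dots> = (norm a)\<^sup>2 + 2 * norm a * norm b + (norm b)\<^sup>2" by (simp add: power2_sum)
  also have "\<dots> \<le> (1 + \<delta>) * (norm a)\<^sup>2 + (1 + 1 / \<delta>) * (norm b)\<^sup>2"
    using * by (simp add: algebra_simps)
  finally show ?thesis .
qed

lemma L2_normsq_add_le_weighted:
  fixes f g :: "'a::euclidean_space \<Rightarrow> 'b::{second_countable_topology, real_normed_vector}"
  assumes [measurable]: "f \<in> borel_measurable lebesgue" "g \<in> borel_measurable lebesgue" and "\<delta> > 0"
  shows "L2_normsq (\<lambda>x. f x + g x) \<le> ennreal (1 + \<delta>) * L2_normsq f + ennreal (1 + 1 / \<delta>) * L2_normsq g"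
proof -
  have "L2_normsq (\<lambda>x. f x + g x) \<le> (\<integral>\<^sup>+x. ennreal (1 + \<delta>) * ennreal ((norm (f x))\<^sup>2) + ennreal (1 + 1 / \<delta>) * ennreal ((norm (g x))\<^sup>2) \<partial>lebesgue)"
    unfolding L2_normsq_def using norm_add_sq_le_weighted[OF assms(3)] assms(3)
    by (intro nn_integral_mono) (simp add: ennreal_leI flip: ennreal_mult ennreal_plus)
  also have "\<dots> = ennreal (1 + \<delta>) * L2_normsq f + ennreal (1 + 1 / \<delta>) * L2_normsq g"
    unfolding L2_normsq_def by (subst nn_integral_add) (simp_all add: nn_integral_cmult)
  finally show ?thesis .
qed

lemma L2_normsq_add_le:
  fixes f g :: "'a::euclidean_space \<Rightarrow> 'b::{second_countable_topology, real_normed_vector}"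
  assumes "f \<in> borel_measurable lebesgue" "g \<in> borel_measurable lebesgue"
  shows "L2_normsq (\<lambda>x. f x + g x) \<le> 2 * L2_normsq f + 2 * L2_normsq g"
  using L2_normsq_add_le_weighted[OF assms, of 1] by simp

lemma L2_normsq_minus_commute: "L2_normsq (\<lambda>x. f x - g x) = L2_normsq (\<lambda>x. g x - f x)"
  by (simp add: L2_normsq_def norm_minus_commute)

lemma Ltwo_iff:
  "f \<in> Ltwo \<longleftrightarrow> f \<in> borel_measurable lebesgue \<and> L2_normsq f < \<infinity>"
  by (auto simp: Ltwo_def L2_normsq_def integrable_iff_bounded)

text \<open>
  Convergence in mean square for radii tending to infinity, in the form used by the definition of \<open>fourier_L2\<close>.
\<close>
definition L2_tends :: "(real \<Rightarrow> 'a::euclidean_space \<Rightarrow> complex) \<Rightarrow> ('a \<Rightarrow> complex) \<Rightarrow> bool" where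
  "L2_tends F U \<longleftrightarrow> (\<forall>R. F R \<in> borel_measurable lebesgue) \<and> U \<in> borel_measurable lebesgue \<and>
     ((\<lambda>R. L2_normsq (\<lambda>x. F R x - U x)) \<longlongrightarrow> 0) at_top"

lemma L2_tends_add:
  assumes "L2_tends F U" "L2_tends G V"
  shows "L2_tends (\<lambda>R x. F R x + G R x) (\<lambda>x. U x + V x)"
  unfolding L2_tends_def
proof (intro conjI allI)
  from assms have [measurable]: "\<And>R. F R \<in> borel_measurable lebesgue" "U \<in> borel_measurable lebesgue"
      "\<And>R. G R \<in> borel_measurable lebesgue" "V \<in> borel_measurable lebesgue"
    and lim: "((\<lambda>R. L2_normsq (\<lambda>x. F R x - U x)) \<longlongrightarrow> 0) at_top" "((\<lambda>R. L2_normsq (\<lambda>x. G R x - V x)) \<longlongrightarrow> 0) at_top"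
    by (auto simp: L2_tends_def)
  show "(\<lambda>x. F R x + G R x) \<in> borel_measurable lebesgue" "(\<lambda>x. U x + V x) \<in> borel_measurable lebesgue" for R
    by measurable
  show "((\<lambda>R. L2_normsq (\<lambda>x. F R x + G R x - (U x + V x))) \<longlongrightarrow> 0) at_top"
  proof (rule tendsto_sandwich[OF _ _ tendsto_const])
    have "((\<lambda>R. 2 * L2_normsq (\<lambda>x. F R x - U x) + 2 * L2_normsq (\<lambda>x. G R x - V x)) \<longlongrightarrow> 2 * 0 + 2 * 0) at_top"
      by (intro tendsto_add ennreal_tendsto_cmult lim) auto
    then show "((\<lambda>R. 2 * L2_normsq (\<lambda>x. F R x - U x) + 2 * L2_normsq (\<lambda>x. G R x - V x)) \<longlongrightarrow> 0) at_top" by simp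
    show "\<forall>\<^sub>F R in at_top. L2_normsq (\<lambda>x. F R x + G R x - (U x + V x)) \<le> 2 * L2_normsq (\<lambda>x. F R x - U x) + 2 * L2_normsq (\<lambda>x. G R x - V x)"
      using L2_normsq_add_le[of "\<lambda>x. F R x - U x" "\<lambda>x. G R x - V x" for R]
      by (intro always_eventually allI) (simp add: algebra_simps)
  qed auto
qed

lemma L2_tends_unique:
  assumes "L2_tends F U" "L2_tends F V"
  shows "AE x in lebesgue. U x = V x"
proof -
  from assms have [measurable]: "\<And>R. F R \<in> borel_measurable lebesgue" "U \<in> borel_measurable lebesgue" "V \<in> borel_measurable lebesgue"
    and lim: "((\<lambda>R. L2_normsq (\<lambda>x. F R x - U x)) \<longlongrightarrow> 0) at_top" "((\<lambda>R. L2_normsq (\<lambda>x. F R x - V x)) \<longlongrightarrow> 0) at_top"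
    by (auto simp: L2_tends_def)
  have le: "L2_normsq (\<lambda>x. U x - V x) \<le> 2 * L2_normsq (\<lambda>x. F R x - U x) + 2 * L2_normsq (\<lambda>x. F R x - V x)" for R
    using L2_normsq_add_le[of "\<lambda>x. U x - F R x" "\<lambda>x. F R x - V x"] L2_normsq_minus_commute[of U "F R"]
    by simp
  have "((\<lambda>R. 2 * L2_normsq (\<lambda>x. F R x - U x) + 2 * L2_normsq (\<lambda>x. F R x - V x)) \<longlongrightarrow> 2 * 0 + 2 * 0) at_top"
    by (intro tendsto_add ennreal_tendsto_cmult lim) auto
  then have "L2_normsq (\<lambda>x. U x - V x) \<le> 2 * 0 + 2 * 0"
    by (rule tendsto_lowerbound) (use le in auto)
  then have "(\<integral>\<^sup>+x. ennreal ((norm (U x - V x))\<^sup>2) \<partial>lebesgue) = 0" by (simp add: L2_normsq_def)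
  then show ?thesis by (subst (asm) nn_integral_0_iff_AE) auto
qed

lemma L2_tends_real:
  assumes "L2_tends F U" and re: "\<And>R x. F R x \<in> \<real>"
  shows "AE x in lebesgue. U x \<in> \<real>"
proof -
  from assms have [measurable]: "\<And>R. F R \<in> borel_measurable lebesgue" "U \<in> borel_measurable lebesgue"
    and lim: "((\<lambda>R. L2_normsq (\<lambda>x. F R x - U x)) \<longlongrightarrow> 0) at_top"
    by (auto simp: L2_tends_def)
  have le: "(\<integral>\<^sup>+x. ennreal ((Im (U x))\<^sup>2) \<partial>lebesgue) \<le> L2_normsq (\<lambda>x. F R x - U x)" for R
    unfolding L2_normsq_def
  proof (intro nn_integral_mono ennreal_leI)
    fix x
    have "Im (F R x) = 0" using re by (simp add: complex_is_Real_iff)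
    then show "(Im (U x))\<^sup>2 \<le> (norm (F R x - U x))\<^sup>2" by (simp add: cmod_power2)
  qed
  have "(\<integral>\<^sup>+x. ennreal ((Im (U x))\<^sup>2) \<partial>lebesgue) \<le> 0"
    by (rule tendsto_lowerbound[OF lim always_eventually]) (use le in auto)
  then have "(\<integral>\<^sup>+x. ennreal ((Im (U x))\<^sup>2) \<partial>lebesgue) = 0" by simp
  then show ?thesis by (subst (asm) nn_integral_0_iff_AE) (auto simp: complex_is_Real_iff)
qed

lemma ennreal_le_if_le_scaled:
  fixes x y :: ennreal
  assumes "\<And>\<delta>. \<delta> > 0 \<Longrightarrow> x \<le> ennreal (1 + \<delta>) * y"
  shows "x \<le> y"
proof (rule ennreal_le_epsilon)
  fix e :: real assume "y < top" "0 < e"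
  then obtain r where r: "y = ennreal r" "r \<ge> 0" by (cases y) auto
  define \<delta> where "\<delta> = e / (r + 1)"
  have \<delta>: "\<delta> > 0" using r \<open>0 < e\<close> by (simp add: \<delta>_def)
  have "(1 + \<delta>) * r \<le> r + e" using r \<open>0 < e\<close> by (simp add: \<delta>_def field_simps)
  then have "ennreal (1 + \<delta>) * y \<le> y + ennreal e"
    using r \<delta> \<open>0 < e\<close> by (simp add: ennreal_leI flip: ennreal_mult ennreal_plus)
  with assms[OF \<delta>] show "x \<le> y + ennreal e" by (rule order_trans)
qed

lemma L2_tends_normsq:
  assumes "L2_tends F U" and N: "((\<lambda>R. L2_normsq (F R)) \<longlongrightarrow> N) at_top"
  shows "L2_normsq U = N"
proof -
  from assms have [measurable]: "\<And>R. F R \<in> borel_measurable lebesgue" "U \<in> borel_measurable lebesgue"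
    and lim: "((\<lambda>R. L2_normsq (\<lambda>x. F R x - U x)) \<longlongrightarrow> 0) at_top"
    by (auto simp: L2_tends_def)
  show ?thesis
  proof (rule antisym; rule ennreal_le_if_le_scaled)
    fix \<delta> :: real assume \<delta>: "\<delta> > 0"
    have 1: "((\<lambda>R. ennreal (1 + \<delta>) * L2_normsq (F R) + ennreal (1 + 1 / \<delta>) * L2_normsq (\<lambda>x. F R x - U x)) \<longlongrightarrow> ennreal (1 + \<delta>) * N + ennreal (1 + 1 / \<delta>) * 0) at_top"
      by (intro tendsto_add ennreal_tendsto_cmult lim N ennreal_less_top)
    have "L2_normsq U \<le> ennreal (1 + \<delta>) * L2_normsq (F R) + ennreal (1 + 1 / \<delta>) * L2_normsq (\<lambda>x. F R x - U x)" for R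
      using L2_normsq_add_le_weighted[of "F R" "\<lambda>x. U x - F R x", OF _ _ \<delta>] L2_normsq_minus_commute[of U "F R"] by simp
    with 1 show "L2_normsq U \<le> ennreal (1 + \<delta>) * N"
      by (intro tendsto_lowerbound[OF 1[unfolded mult_zero_right add_0_right] always_eventually]) auto
    have 2: "((\<lambda>R. ennreal (1 + \<delta>) * L2_normsq U + ennreal (1 + 1 / \<delta>) * L2_normsq (\<lambda>x. F R x - U x)) \<longlongrightarrow> ennreal (1 + \<delta>) * L2_normsq U + ennreal (1 + 1 / \<delta>) * 0) at_top"
      by (intro tendsto_add ennreal_tendsto_cmult lim tendsto_const ennreal_less_top)
    have "L2_normsq (F R) \<le> ennreal (1 + \<delta>) * L2_normsq U + ennreal (1 + 1 / \<delta>) * L2_normsq (\<lambda>x. F R x - U x)" for R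
      using L2_normsq_add_le_weighted[of U "\<lambda>x. F R x - U x", OF _ _ \<delta>] by simp
    then show "N \<le> ennreal (1 + \<delta>) * L2_normsq U"
      by (intro tendsto_le[OF _ 2[unfolded mult_zero_right add_0_right] N] always_eventually) auto
  qed
qed

section \<open>The Fourier--Plancherel transform of continuous functions\<close>

definition trunc :: "real \<Rightarrow> ('a::euclidean_space \<Rightarrow> complex) \<Rightarrow> 'a \<Rightarrow> complex" where
  "trunc R g x = indicator (ball 0 R) x * g x"

lemma ball_measurable [measurable]:
  "ball c r \<in> sets borel" "cball c r \<in> sets borel" "- ball c r \<in> sets borel"
  by (simp_all add: borel_comp)

lemma trunc_measurable [measurable]:
  "g \<in> borel_measurable borel \<Longrightarrow> trunc R g \<in> borel_measurable borel"
  unfolding trunc_def[abs_def] by measurable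

lemma trunc_bounded:
  fixes g :: "'a::euclidean_space \<Rightarrow> complex"
  assumes "continuous_on UNIV g"
  obtains M where "\<And>x. norm (trunc R g x) \<le> M"
proof -
  have "compact (g ` cball 0 R)"
    using assms by (intro compact_continuous_image) (auto intro: continuous_on_subset)
  then obtain M where "\<And>y. y \<in> g ` cball 0 R \<Longrightarrow> norm y \<le> M"
    using compact_imp_bounded bounded_iff by metis
  then have "norm (trunc R g x) \<le> max M 0" for x
    by (cases "x \<in> ball 0 R") (auto simp: trunc_def le_max_iff_disj)
  then show thesis by (rule that)
qed

lemma trunc_AE_isCont:
  fixes g :: "'a::euclidean_space \<Rightarrow> complex"
  assumes "continuous_on UNIV g"
  shows "AE x in lborel. isCont (trunc R g) x"
proof -
  have "sphere (0::'a) R \<in> null_sets lborel"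
    using negligible_sphere[of "0::'a" R] by (auto simp: null_sets_completion_iff negligible_iff_null_sets)
  then have "AE x in lborel. x \<notin> sphere (0::'a) R" by (rule AE_not_in)
  then show ?thesis
  proof eventually_elim
    case (elim x)
    have g: "isCont g x" using assms by (simp add: continuous_on_eq_continuous_at)
    consider "norm x < R" | "norm x > R" using elim by (auto simp: linorder_neq_iff)
    then show ?case
    proof cases
      case 1
      have "\<forall>\<^sub>F y in nhds x. trunc R g y = g y"
        using eventually_nhds_in_open[of "ball 0 R" x] 1 by (auto elim!: eventually_mono simp: trunc_def)
      then show ?thesis using g isCont_cong by blast
    next
      case 2
      have "\<forall>\<^sub>F y in nhds x. trunc R g y = 0"
        by (rule eventually_mono[OF eventually_nhds_in_open[of "- cball 0 R" x]])
           (use 2 in \<open>auto simp: trunc_def indicator_def\<close>)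
      then show ?thesis using isCont_cong[of "trunc R g" "\<lambda>_. 0"] by simp
    qed
  qed
qed

lemma bounded_support_integrable:
  fixes g :: "'a::euclidean_space \<Rightarrow> complex"
  assumes [measurable]: "g \<in> borel_measurable borel" and bd: "\<And>x. norm (g x) \<le> M" and supp: "\<And>x. norm x \<ge> R \<Longrightarrow> g x = 0"
  shows "integrable lborel g" "integrable lborel (\<lambda>x. (norm (g x))\<^sup>2)"
proof -
  have M: "M \<ge> 0" using bd[of 0] norm_ge_zero order_trans by blast
  have i: "integrable lborel (\<lambda>x::'a. c * indicator (cball 0 R) x)" for c :: real
    using emeasure_lborel_cball_finite[of "0::'a" R] by (intro integrable_mult_right integrable_real_indicator) auto
  show "integrable lborel g"
    by (rule Bochner_Integration.integrable_bound[OF i[of M]])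
       (use bd supp M in \<open>auto simp: indicator_def not_le less_imp_le\<close>)
  show "integrable lborel (\<lambda>x. (norm (g x))\<^sup>2)"
    by (rule Bochner_Integration.integrable_bound[OF i[of "M\<^sup>2"]])
       (use bd supp M in \<open>auto simp: indicator_def not_le less_imp_le intro!: power_mono\<close>)
qed

definition tail :: "('a::euclidean_space \<Rightarrow> complex) \<Rightarrow> real \<Rightarrow> ennreal" where
  "tail g R = (\<integral>\<^sup>+x. ennreal ((norm (g x))\<^sup>2) * indicator (- ball 0 R) x \<partial>lborel)"

lemma tail_antimono: "R \<le> R' \<Longrightarrow> tail g R' \<le> tail g R"
  unfolding tail_def by (intro nn_integral_mono) (auto simp: indicator_def)

lemma tail_tendsto_0:
  fixes g :: "'a::euclidean_space \<Rightarrow> complex"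
  assumes [measurable]: "g \<in> borel_measurable borel" and i2: "integrable lborel (\<lambda>x. (norm (g x))\<^sup>2)"
  shows "(tail g \<longlongrightarrow> 0) at_top"
proof -
  have [measurable]: "- ball (0::'a) R \<in> sets borel" for R by simp
  have seq: "(\<lambda>n. tail g (real n)) \<longlonglongrightarrow> (\<integral>\<^sup>+x. 0 \<partial>(lborel :: 'a measure))"
    unfolding tail_def
  proof (rule nn_integral_dominated_convergence[where w="\<lambda>x. ennreal ((norm (g x))\<^sup>2)"])
    show "(\<integral>\<^sup>+x. ennreal ((norm (g x))\<^sup>2) \<partial>lborel) < \<infinity>"
      using i2 by (simp add: integrable_iff_bounded)
    show "AE x in lborel. (\<lambda>n. ennreal ((norm (g x))\<^sup>2) * indicator (- ball 0 (real n)) x) \<longlonglongrightarrow> 0"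
    proof (rule AE_I2)
      fix x :: 'a
      have "\<forall>\<^sub>F n in sequentially. ennreal ((norm (g x))\<^sup>2) * indicator (- ball 0 (real n)) x = 0"
        using eventually_gt_at_top[of "nat \<lceil>norm x\<rceil>"]
        by eventually_elim (auto simp: indicator_def, linarith)
      then show "(\<lambda>n. ennreal ((norm (g x))\<^sup>2) * indicator (- ball 0 (real n)) x) \<longlonglongrightarrow> 0"
        by (rule tendsto_eventually)
    qed
  qed (auto simp: indicator_def)
  show ?thesis
  proof (rule order_tendstoI)
    fix e :: ennreal assume "e > 0"
    with seq have "\<forall>\<^sub>F n in sequentially. tail g (real n) < e" by (intro order_tendstoD(2)) auto
    then obtain n where "tail g (real n) < e" by (auto simp: eventually_sequentially)
    then show "\<forall>\<^sub>F R in at_top. tail g R < e"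
      using tail_antimono[of "real n" _ g]
      by (intro eventually_mono[OF eventually_ge_at_top[of "real n"]]) (auto intro: le_less_trans)
  qed simp
qed

lemma fourier_diff:
  fixes g w :: "'a::euclidean_space \<Rightarrow> complex"
  assumes [measurable]: "g \<in> borel_measurable borel" "w \<in> borel_measurable borel"
    and "integrable lborel g" "integrable lborel w"
  shows "fourier (\<lambda>x. g x - w x) \<xi> = fourier g \<xi> - fourier w \<xi>"
  using integrable_cis_mult[OF assms(3), of \<xi>] integrable_cis_mult[OF assms(4), of \<xi>]
  by (simp add: fourier_lborel right_diff_distrib)

lemma fourier_add:
  fixes g w :: "'a::euclidean_space \<Rightarrow> complex"
  assumes [measurable]: "g \<in> borel_measurable borel" "w \<in> borel_measurable borel"
    and "integrable lborel g" "integrable lborel w"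
  shows "fourier (\<lambda>x. g x + w x) \<xi> = fourier g \<xi> + fourier w \<xi>"
  using integrable_cis_mult[OF assms(3), of \<xi>] integrable_cis_mult[OF assms(4), of \<xi>]
  by (simp add: fourier_lborel distrib_left)

text \<open>
  The difference of two truncations of a continuous function jumps only on two spheres, which are null sets, so
  Plancherel's theorem applies to it.
\<close>
lemma L2_normsq_fourier_trunc_diff:
  fixes g :: "'a::euclidean_space \<Rightarrow> complex"
  assumes cont: "continuous_on UNIV g"
  shows "L2_normsq (\<lambda>\<xi>. fourier (trunc R g) \<xi> - fourier (trunc R' g) \<xi>) \<le> tail g (min R R')"
proof -
  have [measurable]: "g \<in> borel_measurable borel" using cont by (rule borel_measurable_continuous_onI)
  obtain M M' where M: "\<And>x. norm (trunc R g x) \<le> M" "\<And>x. norm (trunc R' g x) \<le> M'"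
    using trunc_bounded[OF cont] by metis
  have s: "norm x \<ge> R \<Longrightarrow> trunc R g x = 0" for R x by (simp add: trunc_def)
  note i = bounded_support_integrable[where g="trunc R g", OF _ M(1) s] bounded_support_integrable[where g="trunc R' g", OF _ M(2) s]
  let ?d = "\<lambda>x. trunc R g x - trunc R' g x"
  have d: "norm (?d x) \<le> M + M'" "norm x \<ge> max R R' \<Longrightarrow> ?d x = 0" for x
    using norm_triangle_ineq4[of "trunc R g x" "trunc R' g x"] M(1)[of x] M(2)[of x] s[of R x] s[of R' x] by auto
  note id = bounded_support_integrable[where g="?d" and R="max R R'", OF _ d]
  have lim: "(translation_defect ?d \<longlongrightarrow> 0) (at 0)"
  proof (rule translation_defect_tendsto_0_AE_continuous[where g="?d", OF _ d])
    show "AE x in lborel. isCont ?d x"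
      using trunc_AE_isCont[OF cont, of R] trunc_AE_isCont[OF cont, of R'] by eventually_elim (rule isCont_diff)
  qed measurable
  have "L2_normsq (\<lambda>\<xi>. fourier (trunc R g) \<xi> - fourier (trunc R' g) \<xi>) = (\<integral>\<^sup>+\<xi>. ennreal ((norm (fourier ?d \<xi>))\<^sup>2) \<partial>lborel)"
    unfolding L2_normsq_def nn_integral_completion using i by (subst fourier_diff) auto
  also have "\<dots> = (\<integral>\<^sup>+x. ennreal ((norm (?d x))\<^sup>2) \<partial>lborel)"
    by (rule plancherel[OF _ _ _ lim]) (use id in auto)
  also have "\<dots> \<le> tail g (min R R')"
    unfolding tail_def by (intro nn_integral_mono) (auto simp: trunc_def indicator_def min_def)
  finally show ?thesis .
qed

lemma L2_normsq_fourier_trunc: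
  fixes g :: "'a::euclidean_space \<Rightarrow> complex"
  assumes cont: "continuous_on UNIV g"
  shows "L2_normsq (fourier (trunc R g)) = L2_normsq (trunc R g)"
proof -
  have [measurable]: "g \<in> borel_measurable borel" using cont by (rule borel_measurable_continuous_onI)
  obtain M where M: "\<And>x. norm (trunc R g x) \<le> M"
    using trunc_bounded[OF cont] by metis
  have s: "norm x \<ge> R \<Longrightarrow> trunc R g x = 0" for x by (simp add: trunc_def)
  note i = bounded_support_integrable[where g="trunc R g", OF _ M s]
  have lim: "(translation_defect (trunc R g) \<longlongrightarrow> 0) (at 0)"
    by (rule translation_defect_tendsto_0_AE_continuous[where g="trunc R g", OF _ M s trunc_AE_isCont[OF cont]]) auto
  show ?thesis
    unfolding L2_normsq_def nn_integral_completion
    by (rule plancherel[OF _ _ _ lim]) (use i in auto)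
qed

text \<open>
  The Riesz--Fischer argument: a rapidly converging subsequence converges almost everywhere, and Fatou's
  lemma identifies its limit as the limit in mean, with the rate given by the tail.
\<close>
lemma fourier_trunc_converges:
  fixes g :: "'a::euclidean_space \<Rightarrow> complex"
  assumes cont: "continuous_on UNIV g" and i2: "integrable lborel (\<lambda>x. (norm (g x))\<^sup>2)"
  obtains U where "U \<in> borel_measurable borel" "\<And>R. L2_normsq (\<lambda>\<xi>. fourier (trunc R g) \<xi> - U \<xi>) \<le> tail g R"
proof -
  have [measurable]: "g \<in> borel_measurable borel" using cont by (rule borel_measurable_continuous_onI)
  have "\<exists>r. real k \<le> r \<and> tail g r \<le> ennreal ((1/4) ^ k)" for k
  proof -
    have "\<forall>\<^sub>F R in at_top. tail g R < ennreal ((1/4) ^ k)"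
      by (rule order_tendstoD(2)[OF tail_tendsto_0]) (use i2 in auto)
    with eventually_ge_at_top[of "real k"]
    have "\<forall>\<^sub>F R in at_top. real k \<le> R \<and> tail g R \<le> ennreal ((1/4) ^ k)" by eventually_elim auto
    then show ?thesis using eventually_happens'[OF trivial_limit_at_top_linorder] by blast
  qed
  then obtain r where r: "\<And>k. real k \<le> r k" "\<And>k. tail g (r k) \<le> ennreal ((1/4) ^ k)" by metis
  define F where "F k = fourier (trunc (r k) g)" for k
  have [measurable]: "F k \<in> borel_measurable borel" for k unfolding F_def by measurable
  \<comment> \<open>The weights \<open>2 ^ k\<close> leave the sum of the integrals finite and make finiteness of the pointwise sum
    imply geometric decay of the increments.\<close>
  let ?S = "\<lambda>\<xi>. \<Sum>k. ennreal (2 ^ k) * ennreal ((norm (F (Suc k) \<xi> - F k \<xi>))\<^sup>2)"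
  have step: "(\<integral>\<^sup>+\<xi>. ennreal ((norm (F (Suc k) \<xi> - F k \<xi>))\<^sup>2) \<partial>lborel) \<le> ennreal ((1/4) ^ k)" for k
  proof -
    have "(\<integral>\<^sup>+\<xi>. ennreal ((norm (F (Suc k) \<xi> - F k \<xi>))\<^sup>2) \<partial>lborel) \<le> tail g (min (r (Suc k)) (r k))"
      using L2_normsq_fourier_trunc_diff[OF cont, of "r (Suc k)" "r k"]
      by (simp add: L2_normsq_def nn_integral_completion F_def)
    also have "\<dots> \<le> ennreal ((1/4) ^ k)"
    proof (cases "r (Suc k) \<le> r k")
      case True
      have "tail g (r (Suc k)) \<le> ennreal ((1/4) ^ Suc k)" by (rule r)
      also have "\<dots> \<le> ennreal ((1/4) ^ k)" by (intro ennreal_leI) simp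
      finally show ?thesis using True by simp
    next
      case False then show ?thesis using r(2)[of k] by simp
    qed
    finally show ?thesis .
  qed
  have "(\<integral>\<^sup>+\<xi>. ?S \<xi> \<partial>lborel) = (\<Sum>k. ennreal (2 ^ k) * (\<integral>\<^sup>+\<xi>. ennreal ((norm (F (Suc k) \<xi> - F k \<xi>))\<^sup>2) \<partial>lborel))"
    by (subst nn_integral_suminf) (auto simp: nn_integral_cmult)
  also have "\<dots> \<le> (\<Sum>k. ennreal ((1/2) ^ k))"
  proof (intro suminf_le)
    fix k
    have "ennreal (2 ^ k) * (\<integral>\<^sup>+\<xi>. ennreal ((norm (F (Suc k) \<xi> - F k \<xi>))\<^sup>2) \<partial>lborel) \<le> ennreal (2 ^ k) * ennreal ((1/4) ^ k)"
      by (intro mult_left_mono step) auto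
    also have "\<dots> = ennreal ((1/2) ^ k)"
      by (simp add: power_mult_distrib[symmetric] flip: ennreal_mult)
    finally show "ennreal (2 ^ k) * (\<integral>\<^sup>+\<xi>. ennreal ((norm (F (Suc k) \<xi> - F k \<xi>))\<^sup>2) \<partial>lborel) \<le> ennreal ((1/2) ^ k)" .
  qed auto
  also have "\<dots> = ennreal (\<Sum>k. (1/2) ^ k)"
    by (intro suminf_ennreal2) (auto intro: summable_geometric)
  finally have "(\<integral>\<^sup>+\<xi>. ?S \<xi> \<partial>lborel) \<noteq> \<infinity>" by (auto simp: top_unique)
  then have "AE \<xi> in lborel. ?S \<xi> \<noteq> \<infinity>" by (rule nn_integral_PInf_AE[rotated]) measurable
  then have conv: "AE \<xi> in lborel. convergent (\<lambda>k. F k \<xi>)"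
  proof eventually_elim
    case (elim \<xi>)
    then obtain B where B: "?S \<xi> = ennreal B" "B \<ge> 0" by (cases "?S \<xi>") auto
    have bd: "norm (F (Suc k) \<xi> - F k \<xi>) \<le> sqrt B * (1 / sqrt 2) ^ k" for k
    proof -
      have "ennreal (2 ^ k) * ennreal ((norm (F (Suc k) \<xi> - F k \<xi>))\<^sup>2) \<le> ?S \<xi>"
        using sum_le_suminf[of "\<lambda>k. ennreal (2 ^ k) * ennreal ((norm (F (Suc k) \<xi> - F k \<xi>))\<^sup>2)" "{k}"] by simp
      then have "2 ^ k * (norm (F (Suc k) \<xi> - F k \<xi>))\<^sup>2 \<le> B"
        using B by (simp flip: ennreal_mult)
      then have "sqrt ((norm (F (Suc k) \<xi> - F k \<xi>))\<^sup>2) \<le> sqrt (B / 2 ^ k)"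
        by (intro real_sqrt_le_mono) (simp add: field_simps)
      then show ?thesis by (simp add: real_sqrt_divide real_sqrt_power power_divide)
    qed
    have "summable (\<lambda>k. F (Suc k) \<xi> - F k \<xi>)"
      by (rule summable_comparison_test'[of "\<lambda>k. sqrt B * (1 / sqrt 2) ^ k" 0])
         (use bd in \<open>auto intro!: summable_mult summable_geometric\<close>)
    then have "convergent (\<lambda>n. F n \<xi> - F 0 \<xi>)"
      using sum_lessThan_telescope[of "\<lambda>k. F k \<xi>"] by (simp only: summable_iff_convergent)
    from convergent_add[OF this convergent_const[of "F 0 \<xi>"]] show ?case by simp
  qed
  define U where "U \<xi> = lim (\<lambda>k. F k \<xi>)" for \<xi>
  have [measurable]: "U \<in> borel_measurable borel" unfolding U_def by measurable
  have "L2_normsq (\<lambda>\<xi>. fourier (trunc R g) \<xi> - U \<xi>) \<le> tail g R" for R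
  proof -
    let ?f = "\<lambda>k \<xi>. ennreal ((norm (fourier (trunc R g) \<xi> - F k \<xi>))\<^sup>2)"
    have "L2_normsq (\<lambda>\<xi>. fourier (trunc R g) \<xi> - U \<xi>) = (\<integral>\<^sup>+\<xi>. ennreal ((norm (fourier (trunc R g) \<xi> - U \<xi>))\<^sup>2) \<partial>lborel)"
      by (simp add: L2_normsq_def nn_integral_completion)
    also have "\<dots> = (\<integral>\<^sup>+\<xi>. liminf (\<lambda>k. ?f k \<xi>) \<partial>lborel)"
    proof (rule nn_integral_cong_AE)
      show "AE \<xi> in lborel. ennreal ((norm (fourier (trunc R g) \<xi> - U \<xi>))\<^sup>2) = liminf (\<lambda>k. ?f k \<xi>)"
        using conv
      proof eventually_elim
        case (elim \<xi>)
        then have "(\<lambda>k. F k \<xi>) \<longlonglongrightarrow> U \<xi>" by (simp add: U_def convergent_LIMSEQ_iff)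
        then have "(\<lambda>k. ?f k \<xi>) \<longlonglongrightarrow> ennreal ((norm (fourier (trunc R g) \<xi> - U \<xi>))\<^sup>2)"
          by (intro tendsto_intros)
        then show ?case by (intro lim_imp_Liminf[symmetric]) auto
      qed
    qed
    also have "\<dots> \<le> liminf (\<lambda>k. \<integral>\<^sup>+\<xi>. ?f k \<xi> \<partial>lborel)"
      by (rule nn_integral_liminf) measurable
    also have "\<dots> \<le> limsup (\<lambda>k. \<integral>\<^sup>+\<xi>. ?f k \<xi> \<partial>lborel)"
      by (rule Liminf_le_Limsup) simp
    also have "\<dots> \<le> tail g R"
    proof (rule Limsup_bounded)
      show "\<forall>\<^sub>F k in sequentially. (\<integral>\<^sup>+\<xi>. ?f k \<xi> \<partial>lborel) \<le> tail g R"
        using eventually_ge_at_top[of "nat \<lceil>R\<rceil>"]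
      proof eventually_elim
        case (elim k)
        then have "R \<le> r k" using r(1)[of k] by linarith
        then show ?case
          using L2_normsq_fourier_trunc_diff[OF cont, of R "r k"]
          by (simp add: L2_normsq_def nn_integral_completion F_def)
      qed
    qed
    finally show ?thesis .
  qed
  then show thesis using that \<open>U \<in> borel_measurable borel\<close> by blast
qed

lemma fourier_L2_eq:
  "fourier_L2 g = (SOME U. U \<in> Ltwo \<and> ((\<lambda>R. L2_normsq (\<lambda>\<xi>. fourier (trunc R g) \<xi> - U \<xi>)) \<longlongrightarrow> 0) at_top)"
  by (simp add: fourier_L2_def trunc_def[abs_def])

text \<open>
  Equality everywhere: the choice operator is applied to the same predicate.
\<close>
lemma fourier_L2_cong:
  assumes [measurable]: "g \<in> borel_measurable lebesgue" "g' \<in> borel_measurable lebesgue"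
    and "AE x in lebesgue. g x = g' x"
  shows "fourier_L2 g = fourier_L2 g'"
proof -
  have [measurable]: "(\<lambda>x. cis (- (x \<bullet> \<xi>))) \<in> borel_measurable lebesgue" for \<xi> :: 'a
    by (intro measurable_completion) measurable
  have [measurable]: "(indicator (ball 0 R) :: 'a \<Rightarrow> complex) \<in> borel_measurable lebesgue" for R :: real
    by (intro measurable_completion) measurable
  have "fourier (trunc R g) = fourier (trunc R g')" for R
    unfolding fourier_def trunc_def using assms(3)
    by (intro ext arg_cong2[where f="(*)"] refl integral_cong_AE) (auto elim: eventually_mono)
  then show ?thesis by (simp add: fourier_L2_eq)
qed

lemma fourier_L2_I:
  assumes "g \<in> borel_measurable borel" "U \<in> Ltwo"
    and "((\<lambda>R. L2_normsq (\<lambda>\<xi>. fourier (trunc R g) \<xi> - U \<xi>)) \<longlongrightarrow> 0) at_top"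
  shows "fourier_L2 g \<in> Ltwo" "L2_tends (\<lambda>R. fourier (trunc R g)) (fourier_L2 g)"
    "AE x in lebesgue. fourier_L2 g x = U x"
proof -
  let ?P = "\<lambda>U. U \<in> Ltwo \<and> ((\<lambda>R. L2_normsq (\<lambda>\<xi>. fourier (trunc R g) \<xi> - U \<xi>)) \<longlongrightarrow> 0) at_top"
  have P: "?P (fourier_L2 g)"
    unfolding fourier_L2_eq by (rule someI[of ?P U]) (use assms in auto)
  then show "fourier_L2 g \<in> Ltwo" by simp
  have m: "fourier (trunc R g) \<in> borel_measurable lebesgue" for R
    using assms(1) by (intro measurable_completion) auto
  show *: "L2_tends (\<lambda>R. fourier (trunc R g)) (fourier_L2 g)"
    using P m by (auto simp: L2_tends_def Ltwo_iff)
  have "L2_tends (\<lambda>R. fourier (trunc R g)) U"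
    using assms m by (auto simp: L2_tends_def Ltwo_iff)
  with * show "AE x in lebesgue. fourier_L2 g x = U x" by (rule L2_tends_unique)
qed

lemma L2_normsq_trunc_tendsto:
  fixes g :: "'a::euclidean_space \<Rightarrow> complex"
  assumes [measurable]: "g \<in> borel_measurable borel" and i2: "integrable lborel (\<lambda>x. (norm (g x))\<^sup>2)"
  shows "((\<lambda>R. L2_normsq (trunc R g)) \<longlongrightarrow> L2_normsq g) at_top"
proof -
  have eq: "L2_normsq g = L2_normsq (trunc R g) + tail g R" for R
  proof -
    have "L2_normsq (trunc R g) + tail g R = (\<integral>\<^sup>+x. ennreal ((norm (trunc R g x))\<^sup>2) + ennreal ((norm (g x))\<^sup>2) * indicator (- ball 0 R) x \<partial>lborel)"
      unfolding L2_normsq_def nn_integral_completion tail_def by (rule nn_integral_add[symmetric]) auto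
    also have "\<dots> = L2_normsq g"
      unfolding L2_normsq_def nn_integral_completion
      by (intro nn_integral_cong) (auto simp: trunc_def indicator_def)
    finally show ?thesis ..
  qed
  have fin: "L2_normsq g \<noteq> \<infinity>" using i2 by (simp add: L2_normsq_def nn_integral_completion integrable_iff_bounded)
  then have fin2: "tail g R \<noteq> top" for R using eq[of R] by (auto simp: add_top)
  have "L2_normsq (trunc R g) = L2_normsq g - tail g R" for R
    unfolding eq[of R] using fin2 by (simp add: ennreal_add_diff_cancel_right)
  moreover have "((\<lambda>R. L2_normsq g - tail g R) \<longlongrightarrow> L2_normsq g - 0) at_top"
    by (intro tendsto_diff_ennreal tendsto_const tail_tendsto_0[OF assms]) (use fin in auto)
  ultimately show ?thesis by simp
qed

text \<open>
  Continuity is what makes the truncations continuous almost everywhere; the symbol of the half Laplacian of an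
  integrable function has it.
\<close>
lemma fourier_L2_continuous:
  fixes g :: "'a::euclidean_space \<Rightarrow> complex"
  assumes cont: "continuous_on UNIV g" and i2: "integrable lborel (\<lambda>x. (norm (g x))\<^sup>2)"
  shows "fourier_L2 g \<in> Ltwo" "L2_tends (\<lambda>R. fourier (trunc R g)) (fourier_L2 g)"
    "L2_normsq (fourier_L2 g) = L2_normsq g"
proof -
  have g[measurable]: "g \<in> borel_measurable borel" using cont by (rule borel_measurable_continuous_onI)
  have fin: "L2_normsq g < \<infinity>" using i2 by (simp add: L2_normsq_def nn_integral_completion integrable_iff_bounded)
  obtain U where U[measurable]: "U \<in> borel_measurable borel" and U2: "\<And>R. L2_normsq (\<lambda>\<xi>. fourier (trunc R g) \<xi> - U \<xi>) \<le> tail g R"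
    using fourier_trunc_converges[OF assms] by metis
  have lim: "((\<lambda>R. L2_normsq (\<lambda>\<xi>. fourier (trunc R g) \<xi> - U \<xi>)) \<longlongrightarrow> 0) at_top"
    by (rule tendsto_sandwich[OF _ _ tendsto_const tail_tendsto_0[OF g i2]]) (use U2 in auto)
  have "L2_tends (\<lambda>R. fourier (trunc R g)) U"
    using lim unfolding L2_tends_def by (auto intro!: measurable_completion)
  moreover have N: "((\<lambda>R. L2_normsq (fourier (trunc R g))) \<longlongrightarrow> L2_normsq g) at_top"
    unfolding L2_normsq_fourier_trunc[OF cont] by (rule L2_normsq_trunc_tendsto[OF g i2])
  ultimately have "L2_normsq U = L2_normsq g" by (rule L2_tends_normsq)
  then have "U \<in> Ltwo" using fin by (auto simp: Ltwo_iff intro!: measurable_completion)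
  note * = fourier_L2_I[OF g this lim]
  then show "fourier_L2 g \<in> Ltwo" and t: "L2_tends (\<lambda>R. fourier (trunc R g)) (fourier_L2 g)" by auto
  show "L2_normsq (fourier_L2 g) = L2_normsq g" by (rule L2_tends_normsq[OF t N])
qed

section \<open>Translations and the Gagliardo energy\<close>

text \<open>
  Compare \<open>g (x + h)\<close> and \<open>g x\<close> through \<open>g z\<close> and average over \<open>z\<close> in the ball of radius \<open>\<bar>h\<bar> / 2\<close> around
  the midpoint of \<open>x\<close> and \<open>x + h\<close>. Every such \<open>z\<close> lies within distance \<open>\<bar>h\<bar>\<close> of both points, where the Riesz
  kernel is at least \<open>\<bar>h\<bar> powr (- N - 2 * s)\<close>.
\<close>
lemma gag_translation_estimate:
  fixes g :: "'a::euclidean_space \<Rightarrow> 'b::{second_countable_topology, real_normed_vector}"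
  assumes s: "0 < s" and [measurable]: "g \<in> borel_measurable borel"
  shows "translation_defect g h
    \<le> ennreal (4 * 2 ^ DIM('a) / unit_ball_vol (real DIM('a)) * norm h powr (2 * s)) * gag s g"
proof (cases "h = 0")
  case True
  then show ?thesis by (simp add: translation_defect_def)
next
  case False
  define r where "r = norm h"
  have r: "r > 0" using False by (simp add: r_def)
  define p where "p = real DIM('a) + 2 * s"
  let ?B = "\<lambda>x. ball (x + (1/2) *\<^sub>R h) (r / 2)"
  let ?K = "\<lambda>x z. ennreal ((norm (g x - g z))\<^sup>2) * ennreal (riesz s (x - z))"
  define v where "v = unit_ball_vol (real DIM('a)) * (r / 2) ^ DIM('a)"
  have v: "v > 0" using r by (simp add: v_def)
  have one: "ennreal ((norm (g a - g z))\<^sup>2) \<le> ennreal (r powr p) * ?K a z" if "norm (a - z) \<le> r" for a z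
  proof (cases "a = z")
    case False
    have "1 \<le> r powr p * riesz s (a - z)"
    proof -
      have "norm (a - z) powr p \<le> r powr p" using that s by (intro powr_mono2) (auto simp: p_def)
      moreover have "riesz s (a - z) = norm (a - z) powr (- p)" by (simp add: riesz_def p_def)
      ultimately show ?thesis
        using False mult_right_mono[OF \<open>norm (a - z) powr p \<le> r powr p\<close>, of "riesz s (a - z)"] by (simp add: powr_minus)
    qed
    then have "(norm (g a - g z))\<^sup>2 * 1 \<le> (norm (g a - g z))\<^sup>2 * (r powr p * riesz s (a - z))"
      by (intro mult_left_mono) auto
    then show ?thesis by (simp add: mult_ac ennreal_leI flip: ennreal_mult)
  qed simp
  have pw: "ennreal ((norm (g (x + h) - g x))\<^sup>2) * indicator (?B x) z
      \<le> ennreal (2 * r powr p) * ?K (x + h) z + ennreal (2 * r powr p) * ?K x z" for x z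
  proof (cases "z \<in> ?B x")
    case True
    have h2: "norm ((1/2) *\<^sub>R h) = r / 2" by (simp add: r_def)
    have lt: "norm (x + (1/2) *\<^sub>R h - z) < r / 2" using True by (simp add: dist_norm)
    have e1: "x + (1/2) *\<^sub>R h - z - (1/2) *\<^sub>R h = x - z" by simp
    have e2: "x + (1/2) *\<^sub>R h - z + (1/2) *\<^sub>R h = x + h - z"
      using scaleR_add_left[of "1/2" "1/2" h] by (simp add: algebra_simps)
    have n: "norm (x - z) \<le> r" "norm (x + h - z) \<le> r"
      using lt h2 norm_triangle_ineq4[of "x + (1/2) *\<^sub>R h - z" "(1/2) *\<^sub>R h", unfolded e1]
        norm_triangle_ineq[of "x + (1/2) *\<^sub>R h - z" "(1/2) *\<^sub>R h", unfolded e2] by linarith+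
    have "(norm (g (x + h) - g x))\<^sup>2 \<le> 2 * (norm (g (x + h) - g z))\<^sup>2 + 2 * (norm (g x - g z))\<^sup>2"
      using norm_diff_sq_le[of "g (x + h) - g z" "g x - g z"] by simp
    then have "ennreal ((norm (g (x + h) - g x))\<^sup>2) \<le> 2 * ennreal ((norm (g (x + h) - g z))\<^sup>2) + 2 * ennreal ((norm (g x - g z))\<^sup>2)"
      by (simp add: ennreal_leI flip: ennreal_plus ennreal_mult ennreal_numeral)
    also have "\<dots> \<le> 2 * (ennreal (r powr p) * ?K (x + h) z) + 2 * (ennreal (r powr p) * ?K x z)"
      by (intro add_mono mult_left_mono one n) auto
    finally show ?thesis using True by (simp add: ennreal_mult mult.assoc)
  qed simp
  have bm[measurable]: "(\<lambda>(x, z). indicator (?B x) z :: ennreal) \<in> borel_measurable (borel \<Otimes>\<^sub>M borel)"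
  proof -
    have "(\<lambda>(x, z). indicator (?B x) z :: ennreal) = indicator {q. dist (fst q + (1/2) *\<^sub>R h) (snd q) < r / 2}"
      by (auto simp: indicator_def fun_eq_iff)
    then show ?thesis by (simp add: borel_prod open_Collect_less continuous_intros borel_open)
  qed
  have "ennreal v * translation_defect g h = (\<integral>\<^sup>+x. ennreal ((norm (g (x + h) - g x))\<^sup>2) * emeasure lborel (?B x) \<partial>lborel)"
    unfolding translation_defect_def emeasure_ball[OF less_imp_le[OF half_gt_zero[OF r]]] v_def
    by (subst nn_integral_cmult[symmetric]) (auto simp: mult.commute)
  also have "\<dots> = (\<integral>\<^sup>+x. \<integral>\<^sup>+z. ennreal ((norm (g (x + h) - g x))\<^sup>2) * indicator (?B x) z \<partial>lborel \<partial>lborel)"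
    by (simp add: nn_integral_cmult_indicator)
  also have "\<dots> \<le> (\<integral>\<^sup>+x. \<integral>\<^sup>+z. ennreal (2 * r powr p) * ?K (x + h) z + ennreal (2 * r powr p) * ?K x z \<partial>lborel \<partial>lborel)"
    by (intro nn_integral_mono pw)
  also have "\<dots> = (\<integral>\<^sup>+x. ennreal (2 * r powr p) * (\<integral>\<^sup>+z. ?K (x + h) z \<partial>lborel) + ennreal (2 * r powr p) * (\<integral>\<^sup>+z. ?K x z \<partial>lborel) \<partial>lborel)"
    by (intro nn_integral_cong) (simp add: nn_integral_add nn_integral_cmult)
  also have "\<dots> = ennreal (2 * r powr p) * (\<integral>\<^sup>+x. \<integral>\<^sup>+z. ?K (x + h) z \<partial>lborel \<partial>lborel) + ennreal (2 * r powr p) * gag s g"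
    unfolding gag_def by (subst nn_integral_add; (measurable; fail)?) (simp add: nn_integral_cmult)
  also have "(\<integral>\<^sup>+x. \<integral>\<^sup>+z. ?K (x + h) z \<partial>lborel \<partial>lborel) = gag s g"
    unfolding gag_def by (rule nn_integral_shift[of "\<lambda>x. \<integral>\<^sup>+z. ?K x z \<partial>lborel"]) measurable
  also have "ennreal (2 * r powr p) * gag s g + ennreal (2 * r powr p) * gag s g = ennreal (4 * r powr p) * gag s g"
    by (simp flip: distrib_right ennreal_plus)
  finally have "ennreal (1 / v) * (ennreal v * translation_defect g h) \<le> ennreal (1 / v) * (ennreal (4 * r powr p) * gag s g)"
    by (rule mult_left_mono) simp
  also have "ennreal (1 / v) * (ennreal v * translation_defect g h) = translation_defect g h"
    using v by (simp add: mult.assoc[symmetric] flip: ennreal_mult)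
  also have "ennreal (1 / v) * (ennreal (4 * r powr p) * gag s g) = ennreal (4 * r powr p / v) * gag s g"
    using v by (simp add: mult.assoc[symmetric] flip: ennreal_mult)
  also have "4 * r powr p / v = 4 * 2 ^ DIM('a) / unit_ball_vol (real DIM('a)) * norm h powr (2 * s)"
  proof -
    have "r powr p = r ^ DIM('a) * r powr (2 * s)" using r by (simp add: p_def powr_add powr_realpow)
    then show ?thesis using r by (simp add: v_def power_divide r_def)
  qed
  finally show ?thesis .
qed

lemma translation_defect_tendsto_0_gag:
  fixes g :: "'a::euclidean_space \<Rightarrow> 'b::{second_countable_topology, real_normed_vector}"
  assumes s: "0 < s" and [measurable]: "g \<in> borel_measurable borel" and fin: "gag s g < \<infinity>"
  shows "(translation_defect g \<longlongrightarrow> 0) (at 0)"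
proof (rule tendsto_sandwich[OF _ _ tendsto_const])
  let ?c = "4 * 2 ^ DIM('a) / unit_ball_vol (real DIM('a))"
  show "\<forall>\<^sub>F h in at 0. translation_defect g h \<le> gag s g * ennreal (?c * norm h powr (2 * s))"
    using gag_translation_estimate[OF assms(1,2)] by (auto simp: mult.commute intro!: always_eventually)
  have "((\<lambda>h::'a. norm h powr (2 * s)) \<longlongrightarrow> norm (0::'a) powr (2 * s)) (at 0)"
    using s by (intro tendsto_powr' tendsto_intros) auto
  then have "((\<lambda>h::'a. norm h powr (2 * s)) \<longlongrightarrow> 0) (at 0)" using s by simp
  then have "((\<lambda>h::'a. ?c * norm h powr (2 * s)) \<longlongrightarrow> 0) (at 0)" by (rule tendsto_mult_right_zero)
  then have "((\<lambda>h::'a. gag s g * ennreal (?c * norm h powr (2 * s))) \<longlongrightarrow> gag s g * ennreal 0) (at 0)"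
    using fin by (intro ennreal_tendsto_cmult tendsto_ennrealI) auto
  then show "((\<lambda>h::'a. gag s g * ennreal (?c * norm h powr (2 * s))) \<longlongrightarrow> 0) (at 0)" by simp
qed auto

section \<open>The half Laplacian and the Gagliardo form\<close>

lemma integral_lebesgue_reflect:
  fixes f :: "'a::euclidean_space \<Rightarrow> complex"
  assumes [measurable]: "f \<in> borel_measurable lebesgue"
  shows "(LINT x|lebesgue. f (- x)) = (LINT x|lebesgue. f x)"
proof -
  have T: "(\<lambda>x::'a. 0 + (\<Sum>j\<in>Basis. (-1 * (x \<bullet> j)) *\<^sub>R j)) = uminus"
    by (simp add: fun_eq_iff sum_negf euclidean_representation)
  have m[measurable]: "(uminus :: 'a \<Rightarrow> 'a) \<in> lebesgue \<rightarrow>\<^sub>M lebesgue"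
    using lebesgue_affine_measurable[of "\<lambda>_::'a. -1" 0] unfolding T by simp
  have "lebesgue = density (distr lebesgue lebesgue (uminus :: 'a \<Rightarrow> 'a)) (\<lambda>_. 1)"
    using lebesgue_affine_euclidean[of "\<lambda>_::'a. -1" 0] unfolding T by simp
  then have "lebesgue = distr lebesgue lebesgue (uminus :: 'a \<Rightarrow> 'a)"
    by (simp add: density_1)
  then have "(LINT x|lebesgue. f x) = (LINT x|distr lebesgue lebesgue (uminus :: 'a \<Rightarrow> 'a). f x)"
    by (rule arg_cong)
  also have "\<dots> = (LINT x|lebesgue. f (- x))"
    by (rule integral_distr) measurable
  finally show ?thesis ..
qed

lemma fourier_reflect_cnj:
  fixes g :: "'a::euclidean_space \<Rightarrow> complex"
  assumes [measurable]: "g \<in> borel_measurable borel"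
  shows "cnj (fourier g \<xi>) = fourier (\<lambda>x. cnj (g (- x))) \<xi>"
proof -
  have [measurable]: "(\<lambda>x. cis (x \<bullet> \<xi>) * cnj (g x)) \<in> borel_measurable lebesgue"
    by (intro measurable_completion) measurable
  have "cnj (fourier g \<xi>) = of_real ((2 * pi) powr (- real DIM('a) / 2)) * (LINT x|lebesgue. cis (x \<bullet> \<xi>) * cnj (g x))"
    unfolding fourier_def by (simp add: cis_cnj flip: Bochner_Integration.integral_cnj)
  also have "(LINT x|lebesgue. cis (x \<bullet> \<xi>) * cnj (g x)) = (LINT x|lebesgue. cis (- x \<bullet> \<xi>) * cnj (g (- x)))"
    by (rule integral_lebesgue_reflect[symmetric]) measurable
  finally show ?thesis by (simp add: fourier_def)
qed

definition laplacian_symbol :: "real \<Rightarrow> ('a::euclidean_space \<Rightarrow> real) \<Rightarrow> 'a \<Rightarrow> complex" where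
  "laplacian_symbol s u \<xi> = of_real (norm \<xi> powr s) * fourier (\<lambda>x. of_real (u x)) \<xi>"

text \<open>
  The constant \<open>c\<close> with \<open>\<parallel>(-\<Delta>)\<^bsup>s/2\<^esup> u\<parallel>\<^sup>2 = c E(u)\<close> in dimension \<open>d\<close>.
\<close>
definition energy_const :: "real \<Rightarrow> real \<Rightarrow> real" where
  "energy_const d s = enn2real (kernel_const d s) / (2 * enn2real (symbol_const s))"

lemma energy_const_pos:
  assumes "0 < s" "s < 1" "d > 0" shows "energy_const d s > 0"
  using symbol_const_bounds[OF assms(1,2)] kernel_const_bounds[OF assms]
  by (auto simp: energy_const_def enn2real_positive_iff intro!: divide_pos_pos)

text \<open>
  The real functions for which the energy identity is proved. Every function in \<open>H\<^sup>s\<close> of bounded support has a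
  representative of this kind.
\<close>
locale finite_energy =
  fixes s :: real and u :: "'a::euclidean_space \<Rightarrow> real"
  assumes s: "0 < s" "s < 1" and u_measurable [measurable]: "u \<in> borel_measurable borel"
    and integrable: "integrable lborel u" and integrable_sq: "integrable lborel (\<lambda>x. (u x)\<^sup>2)"
    and gag_finite: "gag s u < \<infinity>"
begin

abbreviation "cu \<equiv> (\<lambda>x. complex_of_real (u x))"

lemma translation_limit: "(translation_defect cu \<longlongrightarrow> 0) (at 0)"
  by (rule translation_defect_tendsto_0_gag[of s]) (use s gag_finite in \<open>auto simp: gag_of_real\<close>)

lemma cu_integrable: "integrable lborel cu" "integrable lborel (\<lambda>x. (norm (cu x))\<^sup>2)"
  using integrable integrable_sq by auto

lemma symbol_continuous: "continuous_on UNIV (laplacian_symbol s u)"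
  unfolding laplacian_symbol_def[abs_def] using s cu_integrable
  by (intro continuous_intros continuous_fourier continuous_on_powr') auto

lemma symbol_measurable [measurable]: "laplacian_symbol s u \<in> borel_measurable borel"
  using symbol_continuous by (rule borel_measurable_continuous_onI)

lemma symbol_energy: "L2_normsq (laplacian_symbol s u) = ennreal (energy_const (real DIM('a)) s) * gag s u"
proof -
  obtain a where a: "symbol_const s = ennreal a" "a > 0"
    using symbol_const_bounds[OF s] by (cases "symbol_const s") auto
  obtain b where b: "kernel_const (real DIM('a)) s = ennreal b" "b > 0"
    using kernel_const_bounds[OF s, of "real DIM('a)"] by (cases "kernel_const (real DIM('a)) s") auto
  have eq: "(norm (laplacian_symbol s u \<xi>))\<^sup>2 = (norm (fourier cu \<xi>))\<^sup>2 * norm \<xi> powr (2 * s)" for \<xi>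
  proof -
    have "(norm \<xi> powr s)\<^sup>2 = norm \<xi> powr (2 * s)" by (simp add: power2_eq_square flip: powr_add)
    then show ?thesis by (simp add: laplacian_symbol_def norm_mult power_mult_distrib)
  qed
  have "L2_normsq (laplacian_symbol s u) * symbol_const s = ennreal (1/2) * kernel_const (real DIM('a)) s * gag s cu"
    unfolding L2_normsq_def nn_integral_completion eq ennreal_mult[OF zero_le_power2 powr_ge_zero]
    by (rule fourier_energy[OF s _ cu_integrable translation_limit]) measurable
  then have "L2_normsq (laplacian_symbol s u) * ennreal a * ennreal (1 / a) = ennreal (1/2) * ennreal b * gag s u * ennreal (1 / a)"
    by (simp add: a b gag_of_real)
  moreover have "L2_normsq (laplacian_symbol s u) * ennreal a * ennreal (1 / a) = L2_normsq (laplacian_symbol s u)"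
    using a by (simp add: mult.assoc flip: ennreal_mult)
  moreover have "ennreal (1/2) * ennreal b * gag s u * ennreal (1 / a) = ennreal (1/2 * b * (1 / a)) * gag s u"
  proof -
    have "ennreal (1/2 * b * (1 / a)) = ennreal (1/2 * b) * ennreal (1 / a)" using a b by (intro ennreal_mult) auto
    also have "ennreal (1/2 * b) = ennreal (1/2) * ennreal b" using b by (intro ennreal_mult) auto
    finally show ?thesis by (simp only: mult_ac)
  qed
  moreover have "1/2 * b * (1 / a) = energy_const (real DIM('a)) s"
    using a b by (simp add: energy_const_def)
  ultimately show ?thesis by simp
qed

lemma symbol_integrable_sq: "integrable lborel (\<lambda>\<xi>. (norm (laplacian_symbol s u \<xi>))\<^sup>2)"
proof -
  have "L2_normsq (laplacian_symbol s u) < \<infinity>"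
    unfolding symbol_energy using gag_finite by (simp add: ennreal_mult_less_top)
  then show ?thesis by (simp add: integrable_iff_bounded L2_normsq_def nn_integral_completion)
qed

lemmas transform = fourier_L2_continuous[OF symbol_continuous symbol_integrable_sq]

text \<open>
  The transform of a real function is Hermitian and the symbol \<open>\<bar>\<xi>\<bar> powr s\<close> is even, so the truncated symbols
  have real transforms; reality passes to the limit.
\<close>
lemma transform_real: "AE x in lebesgue. fourier_L2 (laplacian_symbol s u) x \<in> \<real>"
proof (rule L2_tends_real[OF transform(2)])
  fix R x
  have m: "trunc R (laplacian_symbol s u) \<in> borel_measurable borel" by measurable
  have "cnj (fourier cu (- \<xi>)) = fourier cu \<xi>" for \<xi>
    unfolding fourier_def by (simp add: cis_cnj flip: Bochner_Integration.integral_cnj)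
  then have "cnj (trunc R (laplacian_symbol s u) (- \<xi>)) = trunc R (laplacian_symbol s u) \<xi>" for \<xi>
    by (simp add: trunc_def laplacian_symbol_def indicator_def)
  then have "cnj (fourier (trunc R (laplacian_symbol s u)) x) = fourier (trunc R (laplacian_symbol s u)) x"
    by (simp add: fourier_reflect_cnj[OF m])
  then show "fourier (trunc R (laplacian_symbol s u)) x \<in> \<real>" by (simp add: Reals_cnj_iff)
qed

text \<open>
  For bounded support the truncations eventually coincide with \<open>u\<close>, so the \<open>L\<^sup>2\<close> transform of \<open>u\<close> is the
  integral one up to a null set.
\<close>
lemma half_frac_laplacian_eq:
  assumes supp: "bounded {x. u x \<noteq> 0}"
  shows "half_frac_laplacian s u x = fourier_L2 (laplacian_symbol s u) (- x)"
proof -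
  obtain R0 where R0: "\<And>x. u x \<noteq> 0 \<Longrightarrow> norm x \<le> R0"
    using supp by (auto simp: bounded_iff)
  have "\<forall>\<^sub>F R in at_top. L2_normsq (\<lambda>\<xi>. fourier (trunc R cu) \<xi> - fourier cu \<xi>) = 0"
    using eventually_gt_at_top[of R0]
  proof eventually_elim
    case (elim R)
    have "trunc R cu = cu"
    proof
      fix x show "trunc R cu x = cu x" using R0[of x] elim by (cases "u x = 0") (auto simp: trunc_def indicator_def)
    qed
    then show ?case by (simp add: L2_normsq_def)
  qed
  then have lim: "((\<lambda>R. L2_normsq (\<lambda>\<xi>. fourier (trunc R cu) \<xi> - fourier cu \<xi>)) \<longlongrightarrow> 0) at_top"
    by (rule tendsto_eventually)
  have "L2_normsq (fourier cu) < \<infinity>"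
    using plancherel[OF _ cu_integrable translation_limit] cu_integrable(2)
    by (simp add: L2_normsq_def nn_integral_completion integrable_iff_bounded)
  then have F: "fourier cu \<in> Ltwo" by (auto simp: Ltwo_iff intro!: measurable_completion)
  note * = fourier_L2_I[OF _ F lim]
  have m: "fourier_L2 cu \<in> borel_measurable lebesgue"
    using *(1) by (simp add: Ltwo_iff)
  have p: "(\<lambda>\<xi>::'a. complex_of_real (norm \<xi> powr s)) \<in> borel_measurable lebesgue"
    by (intro measurable_completion) measurable
  have "fourier_L2 (\<lambda>\<xi>. of_real (norm \<xi> powr s) * fourier_L2 cu \<xi>) = fourier_L2 (laplacian_symbol s u)"
  proof (rule fourier_L2_cong)
    show "(\<lambda>\<xi>. of_real (norm \<xi> powr s) * fourier_L2 cu \<xi>) \<in> borel_measurable lebesgue"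
      using m p by (rule borel_measurable_times[rotated])
    show "laplacian_symbol s u \<in> borel_measurable lebesgue"
      by (intro measurable_completion) measurable
    have "AE \<xi> in lebesgue. fourier_L2 cu \<xi> = fourier cu \<xi>" by (rule *(3)) measurable
    then show "AE \<xi> in lebesgue. of_real (norm \<xi> powr s) * fourier_L2 cu \<xi> = laplacian_symbol s u \<xi>"
      by eventually_elim (simp add: laplacian_symbol_def)
  qed
  then show ?thesis
    by (simp add: half_frac_laplacian_def fourier_multiplier_def inv_fourier_L2_def)
qed

end

lemma finite_energy_add:
  assumes "finite_energy s u" "finite_energy s v"
  shows "finite_energy s (\<lambda>x. u x + v x)"
proof -
  interpret u: finite_energy s u by fact
  interpret v: finite_energy s v by fact
  have sq: "(a + b)\<^sup>2 \<le> 2 * a\<^sup>2 + 2 * b\<^sup>2" for a b :: real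
    using norm_diff_sq_le[of a "- b"] by simp
  show ?thesis
  proof
    show "integrable lborel (\<lambda>x. (u x + v x)\<^sup>2)"
      by (rule Bochner_Integration.integrable_bound[of _ "\<lambda>x. 2 * (u x)\<^sup>2 + 2 * (v x)\<^sup>2"])
         (use u.integrable_sq v.integrable_sq sq in auto)
    let ?K = "\<lambda>w x y. ennreal ((norm (w x - w y :: real))\<^sup>2) * ennreal (riesz s (x - y))"
    have "gag s (\<lambda>x. u x + v x) \<le> (\<integral>\<^sup>+x. \<integral>\<^sup>+y. 2 * ?K u x y + 2 * ?K v x y \<partial>lborel \<partial>lborel)"
      unfolding gag_def
    proof (intro nn_integral_mono)
      fix x y
      have "(norm (u x + v x - (u y + v y)))\<^sup>2 \<le> 2 * (norm (u x - u y))\<^sup>2 + 2 * (norm (v x - v y))\<^sup>2"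
        using sq[of "u x - u y" "v x - v y"] by (simp add: algebra_simps)
      then have "ennreal ((norm (u x + v x - (u y + v y)))\<^sup>2) \<le> 2 * ennreal ((norm (u x - u y))\<^sup>2) + 2 * ennreal ((norm (v x - v y))\<^sup>2)"
        by (simp add: ennreal_leI flip: ennreal_plus ennreal_mult ennreal_numeral)
      from mult_right_mono[OF this, of "ennreal (riesz s (x - y))"]
      show "?K (\<lambda>x. u x + v x) x y \<le> 2 * ?K u x y + 2 * ?K v x y"
        by (simp add: distrib_right mult.assoc)
    qed
    also have "\<dots> = 2 * gag s u + 2 * gag s v"
      unfolding gag_def by (simp add: nn_integral_add nn_integral_cmult)
    also have "\<dots> < \<infinity>"
      using u.gag_finite v.gag_finite by (simp add: ennreal_mult_less_top)
    finally show "gag s (\<lambda>x. u x + v x) < \<infinity>" .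
  qed (use u.s u.integrable v.integrable in auto)
qed

text \<open>
  Up to null sets the half Laplacians are real and additive, so their product is the polarisation of squares,
  and each square integrates to \<open>c\<close> times an energy. The form in the equation has no complex conjugate, which is
  why reality matters here.
\<close>
theorem half_frac_laplacian_form:
  fixes u v :: "'a::euclidean_space \<Rightarrow> real"
  assumes u: "finite_energy s u" and v: "finite_energy s v"
    and supp: "bounded {x. u x \<noteq> 0}" "bounded {x. v x \<noteq> 0}"
  shows "(LINT x|lebesgue. half_frac_laplacian s u x * half_frac_laplacian s v x)
    = of_real (energy_const (real DIM('a)) s *
        (enn2real (gag s (\<lambda>x. u x + v x)) - enn2real (gag s u) - enn2real (gag s v)) / 2)"
proof -
  let ?w = "\<lambda>x. u x + v x" and ?c = "energy_const (real DIM('a)) s"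
  interpret u: finite_energy s u by fact
  interpret v: finite_energy s v by fact
  interpret w: finite_energy s ?w by (rule finite_energy_add[OF u v])
  let ?U = "fourier_L2 (laplacian_symbol s u)" and ?V = "fourier_L2 (laplacian_symbol s v)"
    and ?W = "fourier_L2 (laplacian_symbol s ?w)"
  have [measurable]: "?U \<in> borel_measurable lebesgue" "?V \<in> borel_measurable lebesgue" "?W \<in> borel_measurable lebesgue"
    using u.transform(1) v.transform(1) w.transform(1) by (auto simp: Ltwo_iff)
  have sym: "laplacian_symbol s ?w \<xi> = laplacian_symbol s u \<xi> + laplacian_symbol s v \<xi>" for \<xi>
    unfolding laplacian_symbol_def using u.cu_integrable(1) v.cu_integrable(1)
    by (simp add: fourier_add distrib_left)
  have "fourier (trunc R (laplacian_symbol s ?w)) = (\<lambda>\<xi>. fourier (trunc R (laplacian_symbol s u)) \<xi> + fourier (trunc R (laplacian_symbol s v)) \<xi>)" for R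
  proof
    fix \<xi>
    have i: "integrable lborel (trunc R (laplacian_symbol s u))" if "finite_energy s u" for u :: "'a \<Rightarrow> real"
    proof -
      interpret finite_energy s u by fact
      obtain M where M: "\<And>x. norm (trunc R (laplacian_symbol s u) x) \<le> M"
        using trunc_bounded[OF symbol_continuous] by metis
      show ?thesis
        by (rule bounded_support_integrable(1)[where M=M and R=R]) (use M in \<open>auto simp: trunc_def\<close>)
    qed
    have "trunc R (laplacian_symbol s ?w) = (\<lambda>x. trunc R (laplacian_symbol s u) x + trunc R (laplacian_symbol s v) x)"
      by (simp add: trunc_def sym distrib_left fun_eq_iff)
    then show "fourier (trunc R (laplacian_symbol s ?w)) \<xi> = fourier (trunc R (laplacian_symbol s u)) \<xi> + fourier (trunc R (laplacian_symbol s v)) \<xi>"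
      using i[OF u] i[OF v] by (simp add: fourier_add)
  qed
  then have "L2_tends (\<lambda>R. fourier (trunc R (laplacian_symbol s ?w))) (\<lambda>x. ?U x + ?V x)"
    using L2_tends_add[OF u.transform(2) v.transform(2)] by simp
  with w.transform(2) have W: "AE x in lebesgue. ?W x = ?U x + ?V x" by (rule L2_tends_unique)
  have sq: "integrable lebesgue (\<lambda>x. (Re (fourier_L2 (laplacian_symbol s z) x))\<^sup>2) \<and>
      (LINT x|lebesgue. (Re (fourier_L2 (laplacian_symbol s z) x))\<^sup>2) = ?c * enn2real (gag s z)"
    if "finite_energy s z" for z :: "'a \<Rightarrow> real"
  proof -
    interpret finite_energy s z by fact
    let ?Z = "fourier_L2 (laplacian_symbol s z)"
    have [measurable]: "?Z \<in> borel_measurable lebesgue" using transform(1) by (simp add: Ltwo_iff)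
    have "L2_normsq ?Z = (\<integral>\<^sup>+x. ennreal ((Re (?Z x))\<^sup>2) \<partial>lebesgue)"
      unfolding L2_normsq_def using transform_real
      by (intro nn_integral_cong_AE) (auto elim!: eventually_mono simp: complex_is_Real_iff cmod_power2)
    then have nn: "(\<integral>\<^sup>+x. ennreal ((Re (?Z x))\<^sup>2) \<partial>lebesgue) = ennreal ?c * gag s z"
      using transform(3) symbol_energy by simp
    then have i: "integrable lebesgue (\<lambda>x. (Re (?Z x))\<^sup>2)"
      using gag_finite by (intro integrableI_bounded) (auto simp: ennreal_mult_less_top)
    have "(LINT x|lebesgue. (Re (?Z x))\<^sup>2) = enn2real (ennreal ?c * gag s z)"
      unfolding nn[symmetric] by (rule integral_eq_nn_integral) auto
    also have "\<dots> = ?c * enn2real (gag s z)"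
      using energy_const_pos[OF s, of "real DIM('a)"] by (simp add: enn2real_mult)
    finally show ?thesis using i by simp
  qed
  have prod: "AE x in lebesgue. ?U x * ?V x = of_real (((Re (?W x))\<^sup>2 - (Re (?U x))\<^sup>2 - (Re (?V x))\<^sup>2) / 2)"
    using W u.transform_real v.transform_real
  proof eventually_elim
    case (elim x)
    then obtain a b where "?U x = of_real a" "?V x = of_real b" by (auto elim!: Reals_cases)
    with elim show ?case by (simp add: power2_eq_square algebra_simps)
  qed
  have "(LINT x|lebesgue. half_frac_laplacian s u x * half_frac_laplacian s v x) = (LINT x|lebesgue. ?U (- x) * ?V (- x))"
    by (simp only: u.half_frac_laplacian_eq[OF supp(1)] v.half_frac_laplacian_eq[OF supp(2)])
  also have "\<dots> = (LINT x|lebesgue. ?U x * ?V x)"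
    by (rule integral_lebesgue_reflect) measurable
  also have "\<dots> = (LINT x|lebesgue. complex_of_real (((Re (?W x))\<^sup>2 - (Re (?U x))\<^sup>2 - (Re (?V x))\<^sup>2) / 2))"
    by (rule integral_cong_AE) (use prod in auto)
  also have "\<dots> = of_real (LINT x|lebesgue. ((Re (?W x))\<^sup>2 - (Re (?U x))\<^sup>2 - (Re (?V x))\<^sup>2) / 2)"
    by (rule integral_complex_of_real)
  also have "(LINT x|lebesgue. ((Re (?W x))\<^sup>2 - (Re (?U x))\<^sup>2 - (Re (?V x))\<^sup>2) / 2)
      = ?c * (enn2real (gag s ?w) - enn2real (gag s u) - enn2real (gag s v)) / 2"
    using sq[OF u] sq[OF v] sq[OF w.finite_energy_axioms] by (simp add: right_diff_distrib)
  finally show ?thesis .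
qed

section \<open>Poincare inequality and localised translations\<close>

text \<open>
  For \<open>x\<close> in \<open>\<Omega>\<close> the unit ball around \<open>x + (d + 2) e\<close>, with \<open>d\<close> the diameter and \<open>e\<close> a unit vector, misses \<open>\<Omega>\<close>.
  There \<open>u\<close> vanishes, and the kernel is at least \<open>(d + 3) powr (- N - 2 * s)\<close>.
\<close>
lemma fractional_poincare:
  fixes u :: "'a::euclidean_space \<Rightarrow> real"
  assumes [measurable]: "u \<in> borel_measurable borel" and s: "0 < s"
    and bd: "bounded \<Omega>" and supp: "\<And>x. x \<notin> \<Omega> \<Longrightarrow> u x = 0"
  shows "(\<integral>\<^sup>+x. ennreal ((u x)\<^sup>2) \<partial>lborel)
    \<le> ennreal ((diameter \<Omega> + 3) powr (real DIM('a) + 2 * s) / unit_ball_vol (real DIM('a))) * gag s u"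
proof -
  define d where "d = diameter \<Omega>"
  have d: "d \<ge> 0" unfolding d_def using bd by (rule diameter_ge_0)
  define p where "p = real DIM('a) + 2 * s"
  have p: "p > 0" using s by (simp add: p_def)
  define v where "v = unit_ball_vol (real DIM('a))"
  have v: "v > 0" by (simp add: v_def)
  define c where "c = (d + 3) powr p / v"
  have c: "c > 0" using d v by (auto simp: c_def)
  obtain e :: 'a where e: "norm e = 1" using norm_Basis nonempty_Basis by blast
  have "ennreal (1 / c) * ennreal ((u x)\<^sup>2) \<le> (\<integral>\<^sup>+y. ennreal ((norm (u x - u y))\<^sup>2) * ennreal (riesz s (x - y)) \<partial>lborel)" for x
  proof (cases "x \<in> \<Omega>")
    case False
    then show ?thesis using supp by simp
  next
    case True
    let ?B = "ball (x + (d + 2) *\<^sub>R e) 1"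
    have "ennreal ((u x)\<^sup>2 * (d + 3) powr (- p)) * indicator ?B y \<le> ennreal ((norm (u x - u y))\<^sup>2) * ennreal (riesz s (x - y))" for y
    proof (cases "y \<in> ?B")
      case yB: True
      have n: "norm ((d + 2) *\<^sub>R e) = d + 2" using e d by simp
      have y1: "norm (x + (d + 2) *\<^sub>R e - y) < 1" using yB by (simp add: dist_norm)
      have 1: "norm (x - y) \<le> norm (x + (d + 2) *\<^sub>R e - y) + norm ((d + 2) *\<^sub>R e)"
        using norm_triangle_ineq4[of "x + (d + 2) *\<^sub>R e - y" "(d + 2) *\<^sub>R e"] by simp
      have 2: "norm ((d + 2) *\<^sub>R e) \<le> norm (x + (d + 2) *\<^sub>R e - y) + norm (x - y)"
        using norm_triangle_ineq4[of "x + (d + 2) *\<^sub>R e - y" "x - y"] by simp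
      have "dist x y > d" using 2 n y1 by (simp add: dist_norm)
      then have "y \<notin> \<Omega>" using diameter_bounded_bound[OF bd True, of y] by (auto simp: d_def)
      then have "u y = 0" using supp by simp
      moreover have "(d + 3) powr (- p) \<le> riesz s (x - y)"
      proof -
        have "0 < norm (x - y)" "norm (x - y) \<le> d + 3" using 1 2 n y1 d by linarith+
        then have "(d + 3) powr (- p) \<le> norm (x - y) powr (- p)" using p by (intro powr_mono2') auto
        then show ?thesis by (simp add: riesz_def p_def)
      qed
      ultimately show ?thesis using yB by (simp add: ennreal_leI mult_left_mono flip: ennreal_mult)
    qed simp
    then have "(\<integral>\<^sup>+y. ennreal ((u x)\<^sup>2 * (d + 3) powr (- p)) * indicator ?B y \<partial>lborel) \<le> (\<integral>\<^sup>+y. ennreal ((norm (u x - u y))\<^sup>2) * ennreal (riesz s (x - y)) \<partial>lborel)"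
      by (rule nn_integral_mono)
    also have "(\<integral>\<^sup>+y. ennreal ((u x)\<^sup>2 * (d + 3) powr (- p)) * indicator ?B y \<partial>lborel) = ennreal ((u x)\<^sup>2 * (d + 3) powr (- p)) * ennreal v"
      by (subst nn_integral_cmult_indicator) (simp_all add: emeasure_ball v_def)
    also have "\<dots> = ennreal (1 / c) * ennreal ((u x)\<^sup>2)"
      using c v d by (simp add: c_def powr_minus field_simps flip: ennreal_mult)
    finally show ?thesis .
  qed
  then have "(\<integral>\<^sup>+x. ennreal (1 / c) * ennreal ((u x)\<^sup>2) \<partial>lborel) \<le> gag s u"
    unfolding gag_def by (rule nn_integral_mono)
  then have "ennreal c * (ennreal (1 / c) * (\<integral>\<^sup>+x. ennreal ((u x)\<^sup>2) \<partial>lborel)) \<le> ennreal c * gag s u"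
    by (intro mult_left_mono) (simp_all add: nn_integral_cmult)
  moreover have "ennreal c * (ennreal (1 / c) * X) = X" for X
    using c by (simp add: mult.assoc[symmetric] flip: ennreal_mult)
  ultimately show ?thesis by (simp add: c_def d_def p_def v_def)
qed

text \<open>
  A bound for \<open>\<integral> \<bar>\<phi> x - \<phi> y\<bar>\<^sup>2 \<bar>x - y\<bar> powr (- N - 2 * s) dx\<close> when \<open>\<phi>\<close> takes values in \<open>[0, 1]\<close> and has
  Lipschitz constant \<open>L\<close>. The type argument carries the dimension.
\<close>
definition commutator_const :: "'a::euclidean_space itself \<Rightarrow> real \<Rightarrow> real \<Rightarrow> ennreal" where
  "commutator_const _ s L = (\<integral>\<^sup>+z. ennreal (min 1 (L\<^sup>2 * (norm (z::'a))\<^sup>2)) * ennreal (riesz s z) \<partial>lborel)"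

text \<open>
  Writing the Riesz kernel as an integral of heat kernels replaces polar coordinates: against \<open>G\<^sub>t\<close> the truncated
  quadratic weight integrates to at most a multiple of \<open>min 1 t\<close>, whose Mellin transform at \<open>- s\<close> is finite for
  \<open>0 < s < 1\<close>.
\<close>
lemma commutator_const_finite:
  assumes s: "0 < s" "s < 1"
  shows "commutator_const TYPE('a::euclidean_space) s L < \<infinity>"
proof -
  let ?w = "\<lambda>z::'a. ennreal (min 1 (L\<^sup>2 * (norm z)\<^sup>2))"
  let ?k = "kernel_const (real DIM('a)) s"
  define c where "c = 8 * 2 powr (real DIM('a) / 2)"
  have c: "c > 0" by (simp add: c_def)
  have in1: "(\<integral>\<^sup>+z. ?w z * ennreal (gauss t z) \<partial>lborel) \<le> ennreal ((1 + L\<^sup>2 * c) * min 1 t)" if t: "t > 0" for t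
  proof -
    have a: "(\<integral>\<^sup>+z. ?w z * ennreal (gauss t z) \<partial>lborel) \<le> 1"
    proof -
      have "(\<integral>\<^sup>+z. ?w z * ennreal (gauss t z) \<partial>lborel) \<le> (\<integral>\<^sup>+z. 1 * ennreal (gauss t (z::'a)) \<partial>lborel)"
        by (intro nn_integral_mono mult_right_mono) auto
      then show ?thesis by (simp add: gauss_nn_integral[OF t])
    qed
    have "(\<integral>\<^sup>+z. ?w z * ennreal (gauss t z) \<partial>lborel) \<le> (\<integral>\<^sup>+z. ennreal (L\<^sup>2) * ennreal ((norm (z::'a))\<^sup>2 * gauss t z) \<partial>lborel)"
    proof (rule nn_integral_mono)
      fix z :: 'a
      have "min 1 (L\<^sup>2 * (norm z)\<^sup>2) * gauss t z \<le> L\<^sup>2 * ((norm z)\<^sup>2 * gauss t z)"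
        unfolding mult.assoc[symmetric] by (intro mult_right_mono) auto
      then show "?w z * ennreal (gauss t z) \<le> ennreal (L\<^sup>2) * ennreal ((norm z)\<^sup>2 * gauss t z)"
        by (simp add: ennreal_leI flip: ennreal_mult)
    qed
    also have "\<dots> = ennreal (L\<^sup>2) * (\<integral>\<^sup>+z. ennreal ((norm (z::'a))\<^sup>2 * gauss t z) \<partial>lborel)"
      by (rule nn_integral_cmult) measurable
    also have "\<dots> \<le> ennreal (L\<^sup>2) * ennreal (c * t)"
      using gauss_second_moment[OF t, where 'a='a] by (intro mult_left_mono) (auto simp: c_def)
    also have "\<dots> = ennreal (L\<^sup>2 * c * t)"
      using c t by (simp add: mult.assoc flip: ennreal_mult)
    finally have b: "(\<integral>\<^sup>+z. ?w z * ennreal (gauss t z) \<partial>lborel) \<le> ennreal (L\<^sup>2 * c * t)" .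
    have "0 \<le> L\<^sup>2 * c" using c by simp
    then have "1 \<le> (1 + L\<^sup>2 * c) * 1" "L\<^sup>2 * c * t \<le> (1 + L\<^sup>2 * c) * t" using t by (auto simp: algebra_simps)
    then show ?thesis
      using a b by (cases "t \<le> 1") (auto simp: min_def intro: order_trans ennreal_leI)
  qed
  have "commutator_const TYPE('a) s L * ?k = (\<integral>\<^sup>+z. ?w z * (?k * ennreal (riesz s z)) \<partial>lborel)"
    unfolding commutator_const_def by (subst nn_integral_multc[symmetric]) (auto simp: mult_ac)
  also have "\<dots> = (\<integral>\<^sup>+z. ?w z * mellin s (\<lambda>t. gauss t z) \<partial>lborel)"
  proof (rule nn_integral_cong)
    fix z :: 'a
    show "?w z * (?k * ennreal (riesz s z)) = ?w z * mellin s (\<lambda>t. gauss t z)"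
      using mellin_gauss[OF _ s, of z] by (cases "z = 0") auto
  qed
  also have "\<dots> = (\<integral>\<^sup>+t. (\<integral>\<^sup>+z. ?w z * ennreal (gauss t z) \<partial>lborel) * ennreal (t powr (- 1 - s)) * indicator {0<..} t \<partial>lborel)"
    by (rule mellin_Fubini[symmetric]) (use gauss_measurable_pair in measurable)
  also have "\<dots> \<le> mellin s (\<lambda>t. (1 + L\<^sup>2 * c) * min 1 t)"
    unfolding mellin_def
  proof (rule nn_integral_mono)
    fix t :: real
    show "(\<integral>\<^sup>+z. ?w z * ennreal (gauss t z) \<partial>lborel) * ennreal (t powr (- 1 - s)) * indicator {0<..} t
       \<le> ennreal ((1 + L\<^sup>2 * c) * min 1 t * t powr (- 1 - s)) * indicator {0<..} t"
      using mult_right_mono[OF in1, of t "ennreal (t powr (- 1 - s))"]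
      by (cases "t > 0") (auto simp: ennreal_mult'')
  qed
  also have "\<dots> < \<infinity>"
    by (rule mellin_finite[OF s, of "1 + L\<^sup>2 * c"]) (use c in auto)
  finally show ?thesis
    using kernel_const_bounds(1)[OF s, of "real DIM('a)"]
    by (auto simp: ennreal_mult_less_top less_top[symmetric] ennreal_mult_eq_top_iff)
qed

text \<open>
  \<open>T u x - T u y\<close> is the convex combination \<open>\<phi> x * a + (1 - \<phi> x) * b\<close> of the differences \<open>a\<close> of the translate and
  \<open>b\<close> of \<open>u\<close>, plus the commutator \<open>(\<phi> x - \<phi> y) * (u (y + h) - u y)\<close>. Convexity of the square bounds the first part;
  translating the term with \<open>a\<close> back moves the translation onto \<open>\<phi>\<close>, where the Lipschitz bound enters.
\<close>
lemma gag_local_shift_le: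
  fixes u :: "'a::euclidean_space \<Rightarrow> real"
  assumes [measurable]: "u \<in> borel_measurable borel" and s: "0 < s" "s < 1"
    and lip: "L-lipschitz_on UNIV \<phi>" and \<phi>: "\<And>x. 0 \<le> \<phi> x" "\<And>x. \<phi> x \<le> 1" and \<delta>: "\<delta> > 0"
  shows "gag s (local_shift \<phi> h u) \<le> ennreal ((1 + \<delta>) * (1 + L * norm h)) * gag s u
     + ennreal (1 + 1 / \<delta>) * (commutator_const TYPE('a) s L * translation_defect u h)"
proof -
  have L: "L \<ge> 0" using lip by (rule lipschitz_on_nonneg)
  have lipD: "\<bar>\<phi> x - \<phi> y\<bar> \<le> L * norm (x - y)" for x y
    using lipschitz_onD[OF lip, of x y] by (simp add: dist_norm)
  have [measurable]: "\<phi> \<in> borel_measurable borel"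
    using lipschitz_on_continuous_on[OF lip] by (rule borel_measurable_continuous_onI)
  define F where "F x y = ennreal ((norm (u x - u y))\<^sup>2) * ennreal (riesz s (x - y))" for x y
  have [measurable]: "case_prod F \<in> borel_measurable (borel \<Otimes>\<^sub>M borel)" unfolding F_def by measurable
  have [measurable]: "case_prod F \<in> borel_measurable (lborel \<Otimes>\<^sub>M lborel)" unfolding F_def by measurable
  define G where "G x y = ennreal ((\<phi> x - \<phi> y)\<^sup>2) * ennreal (riesz s (x - y))" for x y
  have [measurable]: "case_prod G \<in> borel_measurable (borel \<Otimes>\<^sub>M borel)" unfolding G_def by measurable
  have [measurable]: "case_prod G \<in> borel_measurable (lborel \<Otimes>\<^sub>M lborel)" unfolding G_def by measurable
  define D where "D y = ennreal ((norm (u (y + h) - u y))\<^sup>2)" for y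
  have [measurable]: "D \<in> borel_measurable borel" unfolding D_def by measurable
  have pw: "ennreal ((norm (local_shift \<phi> h u x - local_shift \<phi> h u y))\<^sup>2) * ennreal (riesz s (x - y))
    \<le> ennreal (1 + \<delta>) * (ennreal (\<phi> x) * F (x + h) (y + h) + ennreal (1 - \<phi> x) * F x y) + ennreal (1 + 1 / \<delta>) * (D y * G x y)" for x y
  proof -
    define a b where "a = u (x + h) - u (y + h)" and "b = u x - u y"
    let ?A = "\<phi> x * a + (1 - \<phi> x) * b" and ?B = "(\<phi> x - \<phi> y) * (u (y + h) - u y)"
    have "local_shift \<phi> h u x - local_shift \<phi> h u y = ?A + ?B"
      by (simp add: local_shift_def shift_def a_def b_def algebra_simps)
    then have "(norm (local_shift \<phi> h u x - local_shift \<phi> h u y))\<^sup>2 \<le> (1 + \<delta>) * ?A\<^sup>2 + (1 + 1 / \<delta>) * ?B\<^sup>2"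
      using norm_add_sq_le_weighted[OF \<delta>, of ?A ?B] by simp
    also have "?A\<^sup>2 \<le> \<phi> x * a\<^sup>2 + (1 - \<phi> x) * b\<^sup>2"
    proof -
      have "\<phi> x * a\<^sup>2 + (1 - \<phi> x) * b\<^sup>2 - ?A\<^sup>2 = \<phi> x * (1 - \<phi> x) * (a - b)\<^sup>2"
        by (simp add: power2_eq_square algebra_simps)
      also have "\<dots> \<ge> 0" using \<phi>[of x] by simp
      finally show ?thesis by simp
    qed
    finally have "(norm (local_shift \<phi> h u x - local_shift \<phi> h u y))\<^sup>2
       \<le> (1 + \<delta>) * (\<phi> x * a\<^sup>2 + (1 - \<phi> x) * b\<^sup>2) + (1 + 1 / \<delta>) * ((u (y + h) - u y)\<^sup>2 * (\<phi> x - \<phi> y)\<^sup>2)"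
      using \<delta> by (simp add: power_mult_distrib mult.commute mult_left_mono)
    then have "(norm (local_shift \<phi> h u x - local_shift \<phi> h u y))\<^sup>2 * riesz s (x - y)
       \<le> ((1 + \<delta>) * (\<phi> x * a\<^sup>2 + (1 - \<phi> x) * b\<^sup>2) + (1 + 1 / \<delta>) * ((u (y + h) - u y)\<^sup>2 * (\<phi> x - \<phi> y)\<^sup>2)) * riesz s (x - y)"
      by (rule mult_right_mono) simp
    also have "\<dots> = (1 + \<delta>) * (\<phi> x * (a\<^sup>2 * riesz s (x - y)) + (1 - \<phi> x) * (b\<^sup>2 * riesz s (x - y)))
        + (1 + 1 / \<delta>) * ((u (y + h) - u y)\<^sup>2 * ((\<phi> x - \<phi> y)\<^sup>2 * riesz s (x - y)))"
      by (simp add: algebra_simps)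
    finally have "ennreal ((norm (local_shift \<phi> h u x - local_shift \<phi> h u y))\<^sup>2 * riesz s (x - y))
      \<le> ennreal (1 + \<delta>) * (ennreal (\<phi> x) * (ennreal (a\<^sup>2) * ennreal (riesz s (x - y))) + ennreal (1 - \<phi> x) * (ennreal (b\<^sup>2) * ennreal (riesz s (x - y))))
        + ennreal (1 + 1 / \<delta>) * (ennreal ((u (y + h) - u y)\<^sup>2) * (ennreal ((\<phi> x - \<phi> y)\<^sup>2) * ennreal (riesz s (x - y))))"
      using \<phi>[of x] \<delta> by (simp add: ennreal_leI flip: ennreal_mult ennreal_plus)
    then show ?thesis
      by (simp add: F_def G_def D_def a_def b_def ennreal_mult)
  qed
  have "gag s (local_shift \<phi> h u)
      \<le> (\<integral>\<^sup>+x. \<integral>\<^sup>+y. ennreal (1 + \<delta>) * (ennreal (\<phi> x) * F (x + h) (y + h) + ennreal (1 - \<phi> x) * F x y) + ennreal (1 + 1 / \<delta>) * (D y * G x y) \<partial>lborel \<partial>lborel)"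
    unfolding gag_def by (intro nn_integral_mono pw)
  also have "\<dots> = ennreal (1 + \<delta>) * ((\<integral>\<^sup>+x. \<integral>\<^sup>+y. ennreal (\<phi> x) * F (x + h) (y + h) \<partial>lborel \<partial>lborel) + (\<integral>\<^sup>+x. \<integral>\<^sup>+y. ennreal (1 - \<phi> x) * F x y \<partial>lborel \<partial>lborel))
       + ennreal (1 + 1 / \<delta>) * (\<integral>\<^sup>+x. \<integral>\<^sup>+y. D y * G x y \<partial>lborel \<partial>lborel)"
    by (simp add: nn_integral_add nn_integral_cmult)
  also have "(\<integral>\<^sup>+x. \<integral>\<^sup>+y. ennreal (\<phi> x) * F (x + h) (y + h) \<partial>lborel \<partial>lborel) = (\<integral>\<^sup>+x. \<integral>\<^sup>+y. ennreal (\<phi> (x - h)) * F x y \<partial>lborel \<partial>lborel)"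
  proof -
    have "(\<integral>\<^sup>+x. \<integral>\<^sup>+y. ennreal (\<phi> x) * F (x + h) (y + h) \<partial>lborel \<partial>lborel) = (\<integral>\<^sup>+x. \<integral>\<^sup>+y. ennreal (\<phi> x) * F (x + h) y \<partial>lborel \<partial>lborel)"
    proof (rule nn_integral_cong)
      fix x show "(\<integral>\<^sup>+y. ennreal (\<phi> x) * F (x + h) (y + h) \<partial>lborel) = (\<integral>\<^sup>+y. ennreal (\<phi> x) * F (x + h) y \<partial>lborel)"
        by (rule nn_integral_shift[of "\<lambda>y. ennreal (\<phi> x) * F (x + h) y"]) measurable
    qed
    also have "\<dots> = (\<integral>\<^sup>+x. \<integral>\<^sup>+y. ennreal (\<phi> (x - h)) * F x y \<partial>lborel \<partial>lborel)"
      using nn_integral_shift[of "\<lambda>x. \<integral>\<^sup>+y. ennreal (\<phi> (x - h)) * F x y \<partial>lborel" h] by simp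
    finally show ?thesis .
  qed
  also have "(\<integral>\<^sup>+x. \<integral>\<^sup>+y. ennreal (\<phi> (x - h)) * F x y \<partial>lborel \<partial>lborel) + (\<integral>\<^sup>+x. \<integral>\<^sup>+y. ennreal (1 - \<phi> x) * F x y \<partial>lborel \<partial>lborel)
      = (\<integral>\<^sup>+x. \<integral>\<^sup>+y. ennreal (\<phi> (x - h)) * F x y + ennreal (1 - \<phi> x) * F x y \<partial>lborel \<partial>lborel)"
    by (simp add: nn_integral_add)
  also have "\<dots> \<le> (\<integral>\<^sup>+x. \<integral>\<^sup>+y. ennreal (1 + L * norm h) * F x y \<partial>lborel \<partial>lborel)"
  proof (intro nn_integral_mono)
    fix x y
    have "\<phi> (x - h) + (1 - \<phi> x) \<le> 1 + L * norm h" using lipD[of "x - h" x] by simp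
    then have "ennreal (\<phi> (x - h)) + ennreal (1 - \<phi> x) \<le> ennreal (1 + L * norm h)"
      using \<phi>[of "x - h"] \<phi>[of x] by (simp add: ennreal_leI flip: ennreal_plus)
    then show "ennreal (\<phi> (x - h)) * F x y + ennreal (1 - \<phi> x) * F x y \<le> ennreal (1 + L * norm h) * F x y"
      unfolding distrib_right[symmetric] by (rule mult_right_mono) simp
  qed
  also have "\<dots> = ennreal (1 + L * norm h) * gag s u"
    unfolding gag_def F_def[symmetric] by (simp add: nn_integral_cmult)
  also have "(\<integral>\<^sup>+x. \<integral>\<^sup>+y. D y * G x y \<partial>lborel \<partial>lborel) \<le> commutator_const TYPE('a) s L * translation_defect u h"
  proof -
    have "(\<integral>\<^sup>+x. \<integral>\<^sup>+y. D y * G x y \<partial>lborel \<partial>lborel) = (\<integral>\<^sup>+y. D y * (\<integral>\<^sup>+x. G x y \<partial>lborel) \<partial>lborel)"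
      by (subst lborel_pair.Fubini'[symmetric]) (simp_all add: nn_integral_cmult)
    also have "\<dots> \<le> (\<integral>\<^sup>+y. D y * commutator_const TYPE('a) s L \<partial>lborel)"
    proof (intro nn_integral_mono mult_left_mono)
      fix y :: 'a
      have "(\<integral>\<^sup>+x. G x y \<partial>lborel) = (\<integral>\<^sup>+z. G (z + y) y \<partial>lborel)"
        by (rule nn_integral_shift[symmetric]) measurable
      also have "\<dots> \<le> commutator_const TYPE('a) s L"
        unfolding commutator_const_def G_def
      proof (intro nn_integral_mono)
        fix z :: 'a
        have "\<bar>\<phi> (z + y) - \<phi> y\<bar> \<le> 1" using \<phi>[of "z + y"] \<phi>[of y] by simp
        then have 1: "(\<phi> (z + y) - \<phi> y)\<^sup>2 \<le> 1\<^sup>2" by (metis abs_ge_zero power2_abs power_mono)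
        have "\<bar>\<phi> (z + y) - \<phi> y\<bar> \<le> L * norm z" using lipD[of "z + y" y] by simp
        then have "(\<phi> (z + y) - \<phi> y)\<^sup>2 \<le> (L * norm z)\<^sup>2" by (metis abs_ge_zero power2_abs power_mono)
        with 1 show "ennreal ((\<phi> (z + y) - \<phi> y)\<^sup>2) * ennreal (riesz s (z + y - y)) \<le> ennreal (min 1 (L\<^sup>2 * (norm z)\<^sup>2)) * ennreal (riesz s z)"
          by (intro mult_mono) (auto simp: power_mult_distrib intro!: ennreal_leI)
      qed
      finally show "(\<integral>\<^sup>+x. G x y \<partial>lborel) \<le> commutator_const TYPE('a) s L" .
    qed simp
    also have "\<dots> = commutator_const TYPE('a) s L * translation_defect u h"
      unfolding translation_defect_def D_def[symmetric] by (simp add: nn_integral_multc mult.commute)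
    finally show ?thesis .
  qed
  finally show ?thesis
    using \<delta> L by (simp add: mult_left_mono add_mono ennreal_mult mult.assoc)
qed

section \<open>Bounded weak gradients and Lipschitz continuity\<close>

lemma pos_part_sq_has_derivative:
  "((\<lambda>x::real. (max 0 x)\<^sup>2) has_field_derivative 2 * max 0 x) (at x)"
proof -
  have *: "\<bar>(max 0 y)\<^sup>2 - (max 0 x)\<^sup>2 - 2 * max 0 x * (y - x)\<bar> \<le> (y - x)\<^sup>2" for y :: real
  proof -
    consider "x \<ge> 0" "y \<ge> 0" | "x \<ge> 0" "y < 0" | "x < 0" "y \<ge> 0" | "x < 0" "y < 0" by linarith
    then show ?thesis
    proof cases
      case 1
      then have "(max 0 y)\<^sup>2 - (max 0 x)\<^sup>2 - 2 * max 0 x * (y - x) = (y - x)\<^sup>2"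
        by (simp add: max_def power2_eq_square algebra_simps)
      then show ?thesis by simp
    next
      case 2
      then have "0 \<le> x * (x - 2 * y)" "0 \<le> y\<^sup>2" by auto
      with 2 show ?thesis by (simp add: max_def power2_eq_square algebra_simps abs_if)
    next
      case 3
      then have "y * x \<le> 0" "0 \<le> x\<^sup>2" by (auto simp: mult_nonneg_nonpos)
      with 3 show ?thesis by (simp add: max_def power2_eq_square algebra_simps)
    next
      case 4 then show ?thesis by (simp add: max_def)
    qed
  qed
  have "((\<lambda>y. ((max 0 y)\<^sup>2 - (max 0 x)\<^sup>2) / (y - x) - 2 * max 0 x) \<longlongrightarrow> 0) (at x)"
  proof (rule Lim_null_comparison)
    have "((\<lambda>y. \<bar>y - x\<bar>) \<longlongrightarrow> \<bar>x - x\<bar>) (at x)" by (intro tendsto_intros)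
    then show "((\<lambda>y. \<bar>y - x\<bar>) \<longlongrightarrow> 0) (at x)" by simp
    show "\<forall>\<^sub>F y in at x. norm (((max 0 y)\<^sup>2 - (max 0 x)\<^sup>2) / (y - x) - 2 * max 0 x) \<le> \<bar>y - x\<bar>"
      unfolding eventually_at_filter
    proof (intro always_eventually allI impI)
      fix y assume "y \<noteq> x"
      then have "((max 0 y)\<^sup>2 - (max 0 x)\<^sup>2) / (y - x) - 2 * max 0 x = ((max 0 y)\<^sup>2 - (max 0 x)\<^sup>2 - 2 * max 0 x * (y - x)) / (y - x)"
        by (simp add: field_simps)
      also have "\<bar>\<dots>\<bar> \<le> (y - x)\<^sup>2 / \<bar>y - x\<bar>"
        unfolding abs_divide by (intro divide_right_mono *) auto
      also have "(y - x)\<^sup>2 = \<bar>y - x\<bar> * \<bar>y - x\<bar>" by (simp add: power2_eq_square)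
      also have "\<bar>y - x\<bar> * \<bar>y - x\<bar> / \<bar>y - x\<bar> = \<bar>y - x\<bar>"
        using \<open>y \<noteq> x\<close> by (intro nonzero_mult_div_cancel_right) simp
      finally show "norm (((max 0 y)\<^sup>2 - (max 0 x)\<^sup>2) / (y - x) - 2 * max 0 x) \<le> \<bar>y - x\<bar>" by simp
    qed
  qed
  then have "((\<lambda>y. ((max 0 y)\<^sup>2 - (max 0 x)\<^sup>2) / (y - x)) \<longlongrightarrow> 2 * max 0 x) (at x)"
    by (rule LIM_zero_cancel)
  then show ?thesis by (simp add: has_field_derivative_iff)
qed

text \<open>
  A continuously differentiable test function, not normalised, of support radius \<open>1 / sqrt \<kappa>\<close>. Its radial profile is a
  square of a positive part, which makes the gradient explicit.
\<close>
definition bump :: "real \<Rightarrow> 'a::euclidean_space \<Rightarrow> real" where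
  "bump \<kappa> z = (max 0 (1 - \<kappa> * (norm z)\<^sup>2))\<^sup>2"

definition bump_grad :: "real \<Rightarrow> 'a::euclidean_space \<Rightarrow> 'a" where
  "bump_grad \<kappa> z = (- 4 * \<kappa> * max 0 (1 - \<kappa> * (norm z)\<^sup>2)) *\<^sub>R z"

lemma bump_nonneg [simp]: "0 \<le> bump \<kappa> z"
  by (simp add: bump_def)

lemma bump_continuous [continuous_intros]:
  "continuous_on S f \<Longrightarrow> continuous_on S (\<lambda>x. bump \<kappa> (f x))"
  "continuous_on S f \<Longrightarrow> continuous_on S (\<lambda>x. bump_grad \<kappa> (f x))"
  unfolding bump_def bump_grad_def by (intro continuous_intros; simp)+

lemma bump_has_derivative:
  "(bump \<kappa> has_derivative (\<lambda>h. bump_grad \<kappa> z \<bullet> h)) (at z)"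
proof -
  have 1: "((\<lambda>z. 1 - \<kappa> * (norm z)\<^sup>2) has_derivative (\<lambda>h. - (2 * \<kappa> * (z \<bullet> h)))) (at z)"
    unfolding power2_norm_eq_inner
    by (auto intro!: derivative_eq_intros simp: fun_eq_iff inner_commute algebra_simps)
  have "((\<lambda>z. (max 0 (1 - \<kappa> * (norm z)\<^sup>2))\<^sup>2) has_derivative (\<lambda>h. 2 * max 0 (1 - \<kappa> * (norm z)\<^sup>2) * (- (2 * \<kappa> * (z \<bullet> h))))) (at z)"
    using has_derivative_compose[OF 1 pos_part_sq_has_derivative[THEN has_field_derivative_imp_has_derivative]] by simp
  then show ?thesis
    unfolding bump_def[abs_def] bump_grad_def by (rule has_derivative_eq_rhs) (simp add: fun_eq_iff)
qed

lemma bump_eq_0: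
  assumes "\<epsilon> > 0" "norm z \<ge> \<epsilon>"
  shows "bump (1 / \<epsilon>\<^sup>2) z = 0" "bump_grad (1 / \<epsilon>\<^sup>2) z = 0"
proof -
  have "\<epsilon>\<^sup>2 \<le> (norm z)\<^sup>2" using assms by (intro power_mono) auto
  then have "1 - 1 / \<epsilon>\<^sup>2 * (norm z)\<^sup>2 \<le> 0" using assms by (simp add: field_simps)
  then show "bump (1 / \<epsilon>\<^sup>2) z = 0" "bump_grad (1 / \<epsilon>\<^sup>2) z = 0"
    unfolding bump_def bump_grad_def by (simp_all only: max_absorb1) simp_all
qed

lemma continuous_compact_support_integral:
  fixes f :: "'a::euclidean_space \<Rightarrow> real"
  assumes cont: "continuous_on UNIV f" and supp: "\<And>x. x \<notin> cbox a b \<Longrightarrow> f x = 0"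
  shows "integrable lborel f" "integrable lebesgue f" "(LINT x|lebesgue. f x) = integral (cbox a b) f"
proof -
  have [measurable]: "f \<in> borel_measurable borel" using cont by (rule borel_measurable_continuous_onI)
  have eq: "(\<lambda>x. indicator (cbox a b) x *\<^sub>R f x) = f" using supp by (auto simp: indicator_def fun_eq_iff)
  have i: "set_integrable lborel (cbox a b) f"
    unfolding set_integrable_def by (rule borel_integrable_compact) (use cont in \<open>auto intro: continuous_on_subset\<close>)
  then show i2: "integrable lborel f" unfolding set_integrable_def eq .
  then show "integrable lebesgue f" by (simp add: integrable_completion)
  have "(LINT x|lebesgue. f x) = (LINT x|lborel. f x)" by (rule integral_completion) measurable
  also have "\<dots> = integral (cbox a b) f"
    using set_borel_integral_eq_integral(2)[OF i] unfolding set_lebesgue_integral_def eq .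
  finally show "(LINT x|lebesgue. f x) = integral (cbox a b) f" .
qed

lemma ball_subset_cbox:
  fixes c :: "'a::euclidean_space"
  obtains a b where "\<And>x::'a. x \<notin> cbox a b \<Longrightarrow> norm (c - x) \<ge> r"
proof -
  obtain a b :: 'a where "ball c r \<subseteq> cbox a b"
    using bounded_subset_cbox_symmetric[OF bounded_ball] by metis
  then have "\<And>x. x \<notin> cbox a b \<Longrightarrow> norm (c - x) \<ge> r" by (force simp: dist_norm)
  then show thesis by (rule that)
qed

text \<open>
  The definition of the weak gradient, combined linearly over the coordinates.
\<close>
lemma weak_gradient_bump:
  fixes \<phi> :: "'a::euclidean_space \<Rightarrow> real"
  assumes cont: "continuous_on UNIV \<phi>" and wg: "weak_gradient \<phi> g" and g: "g \<in> borel_measurable lebesgue"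
    and M: "AE x in lebesgue. norm (g x) \<le> M" and \<epsilon>: "\<epsilon> > 0"
  shows "\<bar>LINT y|lebesgue. \<phi> y * (bump_grad (1 / \<epsilon>\<^sup>2) (c - y) \<bullet> v)\<bar>
    \<le> M * norm v * (LINT y|lebesgue. bump (1 / \<epsilon>\<^sup>2) (c - y))"
proof -
  let ?\<psi> = "\<lambda>y. bump (1 / \<epsilon>\<^sup>2) (c - y)" and ?D = "\<lambda>y. - bump_grad (1 / \<epsilon>\<^sup>2) (c - y)"
  obtain p q where pq: "\<And>x. x \<notin> cbox p q \<Longrightarrow> norm (c - x) \<ge> \<epsilon>" using ball_subset_cbox by metis
  have z: "x \<notin> cbox p q \<Longrightarrow> ?\<psi> x = 0" "x \<notin> cbox p q \<Longrightarrow> bump_grad (1 / \<epsilon>\<^sup>2) (c - x) = 0" for x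
    using bump_eq_0[OF \<epsilon> pq] by auto
  have \<psi>i: "integrable lebesgue ?\<psi>"
    by (rule continuous_compact_support_integral(2)[of _ p q]) (auto intro!: continuous_intros z)
  have [measurable]: "?\<psi> \<in> borel_measurable lebesgue" using \<psi>i by (rule borel_measurable_integrable)
  have gd: "GDERIV ?\<psi> y :> ?D y" for y
  proof -
    have "((\<lambda>y. c - y) has_derivative (\<lambda>h. - h)) (at y)"
      by (auto intro!: derivative_eq_intros)
    from has_derivative_compose[OF this bump_has_derivative] show ?thesis
      unfolding gderiv_def by (simp add: inner_commute)
  qed
  have "{y. ?\<psi> y \<noteq> 0} \<subseteq> cbox p q" using z(1) by blast
  then have "compact (closure {y. ?\<psi> y \<noteq> 0})" using bounded_subset[OF bounded_cbox] compact_closure by blast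
  moreover have "continuous_on UNIV ?D" by (intro continuous_intros)
  ultimately have admissible: "(\<forall>y. GDERIV ?\<psi> y :> ?D y) \<and> continuous_on UNIV ?D \<and> compact (closure {y. ?\<psi> y \<noteq> 0})"
    using gd by blast
  have b: "(LINT x|lebesgue. \<phi> x * (?D x \<bullet> b)) = - (LINT x|lebesgue. (g x \<bullet> b) * ?\<psi> x)" if "b \<in> Basis" for b
    using wg[unfolded weak_gradient_def, THEN spec, THEN spec, THEN mp, OF admissible, THEN bspec, OF that] .
  have i1: "integrable lebesgue (\<lambda>x. \<phi> x * (?D x \<bullet> b))" for b
    by (rule continuous_compact_support_integral(2)[of _ p q]) (auto intro!: continuous_intros cont simp: z)
  have gm[measurable]: "(\<lambda>x. g x \<bullet> w) \<in> borel_measurable lebesgue" for w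
    using g by measurable
  have gb: "AE x in lebesgue. \<bar>(g x \<bullet> w) * ?\<psi> x\<bar> \<le> M * norm w * ?\<psi> x" for w
    using M
  proof eventually_elim
    case (elim x)
    have "\<bar>g x \<bullet> w\<bar> \<le> M * norm w"
      using Cauchy_Schwarz_ineq2[of "g x" w] mult_right_mono[OF elim norm_ge_zero[of w]] by linarith
    then show ?case by (simp add: abs_mult mult_right_mono)
  qed
  have i2: "integrable lebesgue (\<lambda>x. (g x \<bullet> w) * ?\<psi> x)" for w
    by (rule Bochner_Integration.integrable_bound[OF integrable_mult_right[OF \<psi>i, of "M * norm w"]])
       (measurable, rule eventually_mono[OF gb], simp only: real_norm_def, erule order_trans, rule abs_ge_self)
  have "(LINT y|lebesgue. \<phi> y * (bump_grad (1 / \<epsilon>\<^sup>2) (c - y) \<bullet> v)) = (LINT y|lebesgue. (\<Sum>b\<in>Basis. - (v \<bullet> b) * (\<phi> y * (?D y \<bullet> b))))"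
    by (intro Bochner_Integration.integral_cong refl, subst euclidean_inner)
       (simp add: sum_distrib_left mult_ac)
  also have "\<dots> = (\<Sum>b\<in>Basis. - (v \<bullet> b) * (LINT y|lebesgue. \<phi> y * (?D y \<bullet> b)))"
    using i1 by (subst Bochner_Integration.integral_sum) (auto simp del: inner_minus_left)
  also have "\<dots> = (\<Sum>b\<in>Basis. (v \<bullet> b) * (LINT x|lebesgue. (g x \<bullet> b) * ?\<psi> x))"
  proof (intro sum.cong refl)
    fix i :: 'a assume "i \<in> Basis"
    from b[OF this] show "- (v \<bullet> i) * (LINT y|lebesgue. \<phi> y * (?D y \<bullet> i)) = (v \<bullet> i) * (LINT x|lebesgue. (g x \<bullet> i) * ?\<psi> x)"
      by (simp only: mult_minus_left mult_minus_right minus_minus)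
  qed
  also have "\<dots> = (LINT y|lebesgue. (\<Sum>b\<in>Basis. (v \<bullet> b) * ((g y \<bullet> b) * ?\<psi> y)))"
    using i2 by (subst Bochner_Integration.integral_sum) auto
  also have "\<dots> = (LINT y|lebesgue. (g y \<bullet> v) * ?\<psi> y)"
    by (intro Bochner_Integration.integral_cong refl, subst euclidean_inner[of "g _" v])
       (simp add: sum_distrib_right mult_ac)
  also have "\<bar>\<dots>\<bar> \<le> (LINT y|lebesgue. \<bar>(g y \<bullet> v) * ?\<psi> y\<bar>)"
    by (rule integral_abs_bound)
  also have "\<dots> \<le> (LINT y|lebesgue. M * norm v * ?\<psi> y)"
    by (rule integral_mono_AE) (use i2 \<psi>i gb in auto)
  finally show ?thesis by simp
qed

lemma bump_mass:
  assumes \<epsilon>: "\<epsilon> > 0"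
  shows "(LINT y|lebesgue. bump (1 / \<epsilon>\<^sup>2) (c - y::'a::euclidean_space)) = (LINT y|lebesgue. bump (1 / \<epsilon>\<^sup>2) (y::'a))"
    and "(LINT y|lebesgue. bump (1 / \<epsilon>\<^sup>2) (y::'a)) > 0"
proof -
  have [measurable]: "bump (1 / \<epsilon>\<^sup>2) \<in> borel_measurable (borel :: 'a measure)"
    by (intro borel_measurable_continuous_onI continuous_intros)
  have nn: "(LINT y|lebesgue. bump (1 / \<epsilon>\<^sup>2) (c - y)) = enn2real (\<integral>\<^sup>+y. ennreal (bump (1 / \<epsilon>\<^sup>2) (y::'a)) \<partial>lborel)" for c :: 'a
  proof -
    have "(LINT y|lebesgue. bump (1 / \<epsilon>\<^sup>2) (c - y)) = (LINT y|lborel. bump (1 / \<epsilon>\<^sup>2) (c - y))"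
      by (rule integral_completion) measurable
    also have "\<dots> = enn2real (\<integral>\<^sup>+y. ennreal (bump (1 / \<epsilon>\<^sup>2) (c - y)) \<partial>lborel)"
      by (rule integral_eq_nn_integral) auto
    also have "(\<integral>\<^sup>+y. ennreal (bump (1 / \<epsilon>\<^sup>2) (c - y)) \<partial>lborel) = (\<integral>\<^sup>+y. ennreal (bump (1 / \<epsilon>\<^sup>2) (y - c)) \<partial>lborel)"
      by (simp add: bump_def norm_minus_commute)
    also have "\<dots> = (\<integral>\<^sup>+y. ennreal (bump (1 / \<epsilon>\<^sup>2) (y::'a)) \<partial>lborel)"
      using nn_integral_shift_minus[of "\<lambda>y::'a. ennreal (bump (1 / \<epsilon>\<^sup>2) y)" c] by simp
    finally show ?thesis .
  qed
  have even: "(LINT y|lebesgue. bump (1 / \<epsilon>\<^sup>2) (0 - y::'a)) = (LINT y|lebesgue. bump (1 / \<epsilon>\<^sup>2) (y::'a))"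
    by (simp add: bump_def)
  then show "(LINT y|lebesgue. bump (1 / \<epsilon>\<^sup>2) (c - y)) = (LINT y|lebesgue. bump (1 / \<epsilon>\<^sup>2) (y::'a))"
    using nn[where c=0] nn[where c=c] by simp
  obtain p q where pq: "\<And>x::'a. x \<notin> cbox p q \<Longrightarrow> norm (0 - x) \<ge> \<epsilon>" using ball_subset_cbox[where c="0::'a" and r="\<epsilon>"] by metis
  have i: "integrable lborel (bump (1 / \<epsilon>\<^sup>2) :: 'a \<Rightarrow> real)"
    by (rule continuous_compact_support_integral(1)[of _ p q]) (use pq bump_eq_0[OF \<epsilon>] in \<open>auto intro!: continuous_intros\<close>)
  have "ennreal (1/4) * indicator (ball 0 (\<epsilon> / 2)) y \<le> ennreal (bump (1 / \<epsilon>\<^sup>2) (y::'a))" for y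
  proof (cases "norm y < \<epsilon> / 2")
    case True
    then have "(norm y)\<^sup>2 \<le> (\<epsilon> / 2)\<^sup>2" by (intro power_mono) auto
    then have "1 / \<epsilon>\<^sup>2 * (norm y)\<^sup>2 \<le> 1/4" using \<epsilon> by (simp add: field_simps)
    then have "1/2 \<le> 1 - 1 / \<epsilon>\<^sup>2 * (norm y)\<^sup>2" by linarith
    then have "1/2 \<le> max 0 (1 - 1 / \<epsilon>\<^sup>2 * (norm y)\<^sup>2)" by (rule max.coboundedI2)
    then have "(1/2)\<^sup>2 \<le> bump (1 / \<epsilon>\<^sup>2) y" unfolding bump_def by (rule power_mono) simp
    then have "ennreal (1/4) \<le> ennreal (bump (1 / \<epsilon>\<^sup>2) y)" by (intro ennreal_leI) (simp add: power2_eq_square)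
    then show ?thesis using True by simp
  qed simp
  then have "(\<integral>\<^sup>+y. ennreal (1/4) * indicator (ball (0::'a) (\<epsilon> / 2)) y \<partial>lborel) \<le> (\<integral>\<^sup>+y. ennreal (bump (1 / \<epsilon>\<^sup>2) (y::'a)) \<partial>lborel)"
    by (rule nn_integral_mono)
  moreover have "(\<integral>\<^sup>+y. ennreal (1/4) * indicator (ball (0::'a) (\<epsilon> / 2)) y \<partial>lborel) > 0"
    using \<epsilon> by (subst nn_integral_cmult_indicator) (auto simp: emeasure_ball ennreal_zero_less_mult_iff)
  ultimately have "(\<integral>\<^sup>+y. ennreal (bump (1 / \<epsilon>\<^sup>2) (y::'a)) \<partial>lborel) > 0" by (rule less_le_trans[rotated])
  moreover have "(\<integral>\<^sup>+y. ennreal (bump (1 / \<epsilon>\<^sup>2) (y::'a)) \<partial>lborel) < \<infinity>"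
    using i by (simp add: integrable_iff_bounded)
  ultimately have "enn2real (\<integral>\<^sup>+y. ennreal (bump (1 / \<epsilon>\<^sup>2) (y::'a)) \<partial>lborel) > 0"
    by (simp add: enn2real_positive_iff)
  then show "(LINT y|lebesgue. bump (1 / \<epsilon>\<^sup>2) (y::'a)) > 0"
    unfolding nn[where c=0, symmetric] even .
qed

lemma bump_average_close:
  fixes \<phi> :: "'a::euclidean_space \<Rightarrow> real"
  assumes cont: "continuous_on UNIV \<phi>" and \<epsilon>: "\<epsilon> > 0"
    and close: "\<And>y. norm (c - y) < \<epsilon> \<Longrightarrow> \<bar>\<phi> y - \<phi> c\<bar> \<le> \<eta>"
  shows "\<bar>(LINT y|lebesgue. \<phi> y * bump (1 / \<epsilon>\<^sup>2) (c - y)) - \<phi> c * (LINT y|lebesgue. bump (1 / \<epsilon>\<^sup>2) (c - y))\<bar>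
    \<le> \<eta> * (LINT y|lebesgue. bump (1 / \<epsilon>\<^sup>2) (c - y))"
proof -
  let ?\<psi> = "\<lambda>y. bump (1 / \<epsilon>\<^sup>2) (c - y)"
  obtain p q where pq: "\<And>x. x \<notin> cbox p q \<Longrightarrow> norm (c - x) \<ge> \<epsilon>" using ball_subset_cbox by metis
  have z: "x \<notin> cbox p q \<Longrightarrow> ?\<psi> x = 0" for x
    using bump_eq_0[OF \<epsilon> pq] by auto
  have i: "integrable lebesgue ?\<psi>" "integrable lebesgue (\<lambda>y. \<phi> y * ?\<psi> y)"
    by (rule continuous_compact_support_integral(2)[of _ p q]; auto intro!: continuous_intros cont simp: z)+
  have "(LINT y|lebesgue. \<phi> y * ?\<psi> y) - \<phi> c * (LINT y|lebesgue. ?\<psi> y) = (LINT y|lebesgue. (\<phi> y - \<phi> c) * ?\<psi> y)"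
    using i by (simp add: left_diff_distrib)
  also have "\<bar>\<dots>\<bar> \<le> (LINT y|lebesgue. \<bar>(\<phi> y - \<phi> c) * ?\<psi> y\<bar>)"
    by (rule integral_abs_bound)
  also have "\<dots> \<le> (LINT y|lebesgue. \<eta> * ?\<psi> y)"
  proof (rule integral_mono)
    show "integrable lebesgue (\<lambda>y. \<bar>(\<phi> y - \<phi> c) * ?\<psi> y\<bar>)"
      using i by (intro integrable_abs) (simp add: left_diff_distrib)
    show "integrable lebesgue (\<lambda>y. \<eta> * ?\<psi> y)" using i by simp
    show "\<bar>(\<phi> y - \<phi> c) * ?\<psi> y\<bar> \<le> \<eta> * ?\<psi> y" for y
      using close[of y] bump_eq_0(1)[OF \<epsilon>, of "c - y"]
      by (cases "norm (c - y) < \<epsilon>") (auto simp: abs_mult mult_right_mono)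
  qed
  finally show ?thesis by simp
qed

text \<open>
  Mollify with a bump of small radius. Along a segment the average has a derivative bounded by \<open>M * \<bar>v\<bar>\<close> times the mass
  of the bump, by the weak gradient; at the end points it is close to \<open>\<phi>\<close> by continuity.
\<close>
lemma W1_infty_lipschitz:
  fixes \<phi> :: "'a::euclidean_space \<Rightarrow> real"
  assumes "\<phi> \<in> W1_infty" and cont: "continuous_on UNIV \<phi>"
  obtains L where "L-lipschitz_on UNIV \<phi>"
proof -
  obtain g M0 where g: "g \<in> borel_measurable lebesgue" and wg: "weak_gradient \<phi> g" and M0: "AE x in lebesgue. norm (g x) \<le> M0"
    using assms(1) by (auto simp: W1_infty_def Linfty_def)
  define M where "M = max 0 M0"
  have M: "AE x in lebesgue. norm (g x) \<le> M" "M \<ge> 0" using M0 by (auto simp: M_def elim: eventually_mono)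
  have "\<bar>\<phi> (c + v) - \<phi> c\<bar> \<le> M * norm v" for c v
  proof (rule field_le_epsilon)
    fix e :: real assume e: "e > 0"
    have "isCont \<phi> x" for x using cont by (simp add: continuous_on_eq_continuous_at)
    then have "\<exists>d>0. \<forall>y. norm (x - y) < d \<longrightarrow> \<bar>\<phi> y - \<phi> x\<bar> \<le> e / 2" for x
      using e unfolding continuous_at_eps_delta
      by (metis dist_norm half_gt_zero less_imp_le norm_minus_commute real_norm_def)
    then obtain d1 d2 where d: "d1 > 0" "d2 > 0" "\<And>y. norm (c - y) < d1 \<Longrightarrow> \<bar>\<phi> y - \<phi> c\<bar> \<le> e / 2"
      "\<And>y. norm (c + v - y) < d2 \<Longrightarrow> \<bar>\<phi> y - \<phi> (c + v)\<bar> \<le> e / 2" by metis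
    define \<epsilon> where "\<epsilon> = min d1 d2"
    have \<epsilon>: "\<epsilon> > 0" using d by (simp add: \<epsilon>_def)
    define I where "I = (LINT y|lebesgue. bump (1 / \<epsilon>\<^sup>2) (y::'a))"
    have I: "I > 0" "(LINT y|lebesgue. bump (1 / \<epsilon>\<^sup>2) (c - y)) = I" for c :: 'a
      using bump_mass[OF \<epsilon>, where 'a='a] by (auto simp: I_def)
    define F where "F t = (LINT y|lebesgue. \<phi> y * bump (1 / \<epsilon>\<^sup>2) (c + t *\<^sub>R v - y))" for t
    obtain p q where pq: "\<And>x. x \<notin> cbox p q \<Longrightarrow> norm (c - x) \<ge> norm v + \<epsilon>" using ball_subset_cbox by metis
    have far: "norm (c + t *\<^sub>R v - x) \<ge> \<epsilon>" if "x \<notin> cbox p q" "t \<in> {0..1}" for x t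
    proof -
      have "norm (t *\<^sub>R v) \<le> norm v" using that by (simp add: mult_left_le_one_le)
      then show ?thesis using pq[OF that(1)] norm_triangle_ineq4[of "c + t *\<^sub>R v - x" "t *\<^sub>R v"] by simp
    qed
    have far0: "bump (1 / \<epsilon>\<^sup>2) (c + t *\<^sub>R v - x) = 0" "bump_grad (1 / \<epsilon>\<^sup>2) (c + t *\<^sub>R v - x) = 0"
      if "x \<notin> cbox p q" "t \<in> {0..1}" for x t
      using bump_eq_0[OF \<epsilon> far[OF that]] by simp_all
    have F: "F t = integral (cbox p q) (\<lambda>y. \<phi> y * bump (1 / \<epsilon>\<^sup>2) (c + t *\<^sub>R v - y))" if "t \<in> {0..1}" for t
      unfolding F_def
      by (intro continuous_compact_support_integral(3)) (simp_all add: far0[OF _ that] cont continuous_intros)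
    have F': "integral (cbox p q) (\<lambda>y. \<phi> y * (bump_grad (1 / \<epsilon>\<^sup>2) (c + t *\<^sub>R v - y) \<bullet> v))
        = (LINT y|lebesgue. \<phi> y * (bump_grad (1 / \<epsilon>\<^sup>2) (c + t *\<^sub>R v - y) \<bullet> v))" if "t \<in> {0..1}" for t
      by (intro continuous_compact_support_integral(3)[symmetric]) (simp_all add: far0[OF _ that] cont continuous_intros)
    have deriv: "(F has_field_derivative (LINT y|lebesgue. \<phi> y * (bump_grad (1 / \<epsilon>\<^sup>2) (c + t *\<^sub>R v - y) \<bullet> v))) (at t within {0..1})"
      if t: "t \<in> {0..1}" for t
    proof (rule has_field_derivative_transform_within[OF _ zero_less_one t F[symmetric]])
      show "((\<lambda>t. integral (cbox p q) (\<lambda>y. \<phi> y * bump (1 / \<epsilon>\<^sup>2) (c + t *\<^sub>R v - y))) has_field_derivative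
          (LINT y|lebesgue. \<phi> y * (bump_grad (1 / \<epsilon>\<^sup>2) (c + t *\<^sub>R v - y) \<bullet> v))) (at t within {0..1})"
        unfolding F'[OF t, symmetric]
      proof (rule leibniz_rule_field_derivative)
        fix \<tau> y
        have "((\<lambda>\<tau>. c + \<tau> *\<^sub>R v - y) has_derivative (\<lambda>h. h *\<^sub>R v)) (at \<tau> within {0..1})"
          by (auto intro!: derivative_eq_intros)
        from has_derivative_mult_right[OF has_derivative_compose[OF this bump_has_derivative], of "\<phi> y"]
        show "((\<lambda>\<tau>. \<phi> y * bump (1 / \<epsilon>\<^sup>2) (c + \<tau> *\<^sub>R v - y)) has_field_derivative \<phi> y * (bump_grad (1 / \<epsilon>\<^sup>2) (c + \<tau> *\<^sub>R v - y) \<bullet> v)) (at \<tau> within {0..1})"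
          unfolding has_field_derivative_def by (rule has_derivative_eq_rhs) (simp add: fun_eq_iff mult_ac)
      next
        show "(\<lambda>y. \<phi> y * bump (1 / \<epsilon>\<^sup>2) (c + \<tau> *\<^sub>R v - y)) integrable_on cbox p q" for \<tau>
          by (intro integrable_continuous continuous_intros continuous_on_subset[OF cont]) auto
        show "continuous_on ({0..1} \<times> cbox p q) (\<lambda>(\<tau>, y). \<phi> y * (bump_grad (1 / \<epsilon>\<^sup>2) (c + \<tau> *\<^sub>R v - y) \<bullet> v))"
          unfolding case_prod_unfold
          by (intro continuous_intros continuous_on_compose2[OF cont]) auto
      qed (use t in auto)
    qed
    have "norm (F (1::real) - F 0) \<le> M * norm v * I * norm (1 - 0 :: real)"
    proof (rule field_differentiable_bound[OF _ deriv])
      show "norm (LINT y|lebesgue. \<phi> y * (bump_grad (1 / \<epsilon>\<^sup>2) (c + t *\<^sub>R v - y) \<bullet> v)) \<le> M * norm v * I" for t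
        using weak_gradient_bump[OF cont wg g M(1) \<epsilon>, of "c + t *\<^sub>R v" v] I(2) by simp
    qed auto
    then have "\<bar>F 1 - F 0\<bar> \<le> M * norm v * I" by simp
    moreover have "\<bar>F 0 - \<phi> c * I\<bar> \<le> e / 2 * I"
      using bump_average_close[OF cont \<epsilon>, of c "e / 2"] d(3) I(2) by (simp add: F_def \<epsilon>_def)
    moreover have "\<bar>F 1 - \<phi> (c + v) * I\<bar> \<le> e / 2 * I"
      using bump_average_close[OF cont \<epsilon>, of "c + v" "e / 2"] d(4) I(2) by (simp add: F_def \<epsilon>_def)
    ultimately have "\<bar>\<phi> (c + v) * I - \<phi> c * I\<bar> \<le> M * norm v * I + e / 2 * I + e / 2 * I"
      by linarith
    also have "\<dots> = (M * norm v + e) * I" by (simp add: algebra_simps)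
    finally have "\<bar>\<phi> (c + v) - \<phi> c\<bar> * I \<le> (M * norm v + e) * I"
      using I(1) by (simp add: abs_mult flip: left_diff_distrib)
    then show "\<bar>\<phi> (c + v) - \<phi> c\<bar> \<le> M * norm v + e" using I(1) by simp
  qed note * = this
  have "M-lipschitz_on UNIV \<phi>"
  proof (rule lipschitz_onI)
    fix x y :: 'a
    show "dist (\<phi> x) (\<phi> y) \<le> M * dist x y"
      using *[of y "x - y"] by (simp add: dist_norm)
  qed (rule M(2))
  then show thesis by (rule that)
qed

text \<open>
  The infimum in \<open>Lip\<close> is attained.
\<close>
lemma Lip_lipschitz:
  fixes \<phi> :: "'a::euclidean_space \<Rightarrow> real"
  assumes "L-lipschitz_on UNIV \<phi>"
  shows "(Lip \<phi>)-lipschitz_on UNIV \<phi>"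
proof (rule lipschitz_onI)
  let ?S = "{L. L-lipschitz_on UNIV \<phi>}"
  have S: "?S \<noteq> {}" using assms by auto
  show "0 \<le> Lip \<phi>" unfolding Lip_def by (rule cInf_greatest[OF S]) (auto dest: lipschitz_on_nonneg)
  fix x y :: 'a
  show "dist (\<phi> x) (\<phi> y) \<le> Lip \<phi> * dist x y"
  proof (cases "x = y")
    case False
    have "dist (\<phi> x) (\<phi> y) / dist x y \<le> Lip \<phi>"
      unfolding Lip_def
    proof (rule cInf_greatest[OF S])
      fix K assume "K \<in> ?S"
      then show "dist (\<phi> x) (\<phi> y) / dist x y \<le> K"
        using lipschitz_onD[of K UNIV \<phi> x y] False by (simp add: divide_le_eq)
    qed
    then show ?thesis using False by (simp add: divide_le_eq)
  qed simp
qed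

section \<open>Pairings and dual norms\<close>

lemma pairing_Ltwo:
  fixes f w :: "'a::euclidean_space \<Rightarrow> real"
  assumes f: "f \<in> Ltwo" and w: "w \<in> Ltwo"
  shows "\<bar>pairing f w\<bar> \<le> L2_norm f * L2_norm w"
proof -
  have [measurable]: "f \<in> borel_measurable lebesgue" "w \<in> borel_measurable lebesgue"
    using assms by (auto simp: Ltwo_iff)
  obtain a where a: "L2_normsq f = ennreal a" "a \<ge> 0" using f by (cases "L2_normsq f") (auto simp: Ltwo_iff)
  obtain b where b: "L2_normsq w = ennreal b" "b \<ge> 0" using w by (cases "L2_normsq w") (auto simp: Ltwo_iff)
  let ?I = "\<integral>\<^sup>+x. ennreal \<bar>f x\<bar> * ennreal \<bar>w x\<bar> \<partial>lebesgue"
  have "?I\<^sup>2 \<le> L2_normsq f * L2_normsq w"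
    using Cauchy_Schwarz_nn_integral[of "\<lambda>x. ennreal \<bar>f x\<bar>" lebesgue "\<lambda>x. ennreal \<bar>w x\<bar>"]
    by (simp add: L2_normsq_def ennreal_power)
  also have "\<dots> = ennreal (a * b)" using a b by (simp add: ennreal_mult)
  finally have I2: "?I\<^sup>2 \<le> ennreal (a * b)" .
  have "?I \<noteq> top"
  proof
    assume "?I = top"
    with I2 have "top \<le> ennreal (a * b)" by (simp add: power2_eq_square)
    then show False by (simp add: top_unique)
  qed
  then obtain i where i: "?I = ennreal i" "i \<ge> 0" by (cases ?I) auto
  have "i\<^sup>2 \<le> a * b" using I2 i a b by (simp add: ennreal_power)
  then have "i \<le> sqrt (a * b)" by (rule real_le_rsqrt)
  have i': "?I = (\<integral>\<^sup>+x. ennreal (norm (f x * w x)) \<partial>lebesgue)" by (simp add: abs_mult ennreal_mult)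
  have "integrable lebesgue (\<lambda>x. f x * w x)"
    by (rule integrableI_bounded) (use i i' in auto)
  then have "\<bar>pairing f w\<bar> \<le> (LINT x|lebesgue. norm (f x * w x))"
    unfolding pairing_def using integral_norm_bound[of lebesgue "\<lambda>x. f x * w x"] by simp
  also have "\<dots> = enn2real ?I" unfolding i' by (rule integral_eq_nn_integral) auto
  also have "\<dots> = i" using i by simp
  also have "\<dots> \<le> sqrt (a * b)" by fact
  finally show ?thesis using a b by (simp add: L2_norm_def real_sqrt_mult)
qed

lemma L2_norm_le_Hs_norm:
  assumes "w \<in> Hs s" shows "L2_norm w \<le> Hs_norm s w"
proof -
  have "L2_normsq w < top" "gagliardo_sq s w < top" using assms by (auto simp: Hs_def Ltwo_iff)
  then show ?thesis unfolding L2_norm_def Hs_norm_def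
    by (intro real_sqrt_le_mono enn2real_mono) auto
qed

lemma L2_norm_nonneg [simp]: "0 \<le> L2_norm f" and Hs_norm_nonneg [simp]: "0 \<le> Hs_norm s v"
  by (simp_all add: L2_norm_def Hs_norm_def)

text \<open>
  Boundedness makes the real supremum in \<open>dual_norm\<close> a genuine one.
\<close>
lemma dual_norm_bdd:
  assumes f: "f \<in> Ltwo" and V: "V \<subseteq> Hs s"
  shows "bdd_above ((\<lambda>v. \<bar>pairing f v\<bar>) ` {v \<in> V. Hs_norm s v \<le> 1})"
proof (rule bdd_aboveI2)
  fix v assume v: "v \<in> {v \<in> V. Hs_norm s v \<le> 1}"
  then have "v \<in> Hs s" using V by auto
  then have "\<bar>pairing f v\<bar> \<le> L2_norm f * L2_norm v" by (intro pairing_Ltwo f) (auto simp: Hs_def)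
  also have "\<dots> \<le> L2_norm f * 1"
    using L2_norm_le_Hs_norm[OF \<open>v \<in> Hs s\<close>] v by (intro mult_left_mono) auto
  finally show "\<bar>pairing f v\<bar> \<le> L2_norm f" by simp
qed

lemma Hs_scale:
  fixes w :: "'a::euclidean_space \<Rightarrow> real"
  assumes [measurable]: "w \<in> borel_measurable borel"
  shows "L2_normsq (\<lambda>x. c * w x) = ennreal (c\<^sup>2) * L2_normsq w"
    "gagliardo_sq s (\<lambda>x. c * w x) = ennreal (c\<^sup>2) * gagliardo_sq s w"
    "Hs_norm s (\<lambda>x. c * w x) = \<bar>c\<bar> * Hs_norm s w"
proof -
  show 1: "L2_normsq (\<lambda>x. c * w x) = ennreal (c\<^sup>2) * L2_normsq w"
    unfolding L2_normsq_def nn_integral_completion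
    by (subst nn_integral_cmult[symmetric]) (auto simp: abs_mult power_mult_distrib simp flip: ennreal_mult)
  have "gag s (\<lambda>x. c * w x) = (\<integral>\<^sup>+x. \<integral>\<^sup>+y. ennreal (c\<^sup>2) * (ennreal ((norm (w x - w y))\<^sup>2) * ennreal (riesz s (x - y))) \<partial>lborel \<partial>lborel)"
    unfolding gag_def
    by (intro nn_integral_cong)
       (simp add: right_diff_distrib[symmetric] abs_mult power_mult_distrib ennreal_mult mult.assoc)
  also have "\<dots> = ennreal (c\<^sup>2) * gag s w"
    unfolding gag_def by (simp add: nn_integral_cmult)
  finally show 2: "gagliardo_sq s (\<lambda>x. c * w x) = ennreal (c\<^sup>2) * gagliardo_sq s w"
    by (simp add: gagliardo_sq_eq_gag)
  show "Hs_norm s (\<lambda>x. c * w x) = \<bar>c\<bar> * Hs_norm s w"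
    unfolding Hs_norm_def 1 2 by (simp add: enn2real_mult real_sqrt_mult flip: distrib_left)
qed

lemma gagliardo_sq_zero [simp]: "gagliardo_sq s (\<lambda>_. 0) = 0"
  by (simp add: gagliardo_sq_def case_prod_unfold)

lemma zero_in_X0: "(\<lambda>_. 0) \<in> X0 s \<Omega>"
  by (simp add: X0_def Hs_def Ltwo_def)

lemma Hs_norm_zero: "Hs_norm s (\<lambda>_. 0) = 0"
  by (simp add: Hs_norm_def L2_normsq_def)

lemma X0_subset_Hs: "X0 s \<Omega> \<subseteq> Hs s" by (auto simp: X0_def)

lemma dual_norm_X0_nonneg:
  assumes f: "f \<in> Ltwo" shows "0 \<le> dual_norm s (X0 s \<Omega>) (pairing f)"
  unfolding dual_norm_def
  by (rule cSUP_upper2[OF dual_norm_bdd[OF f X0_subset_Hs], of "\<lambda>_. 0"]) (auto simp: zero_in_X0 Hs_norm_zero)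

lemma dual_norm_X0_le_Hs:
  assumes f: "f \<in> Ltwo" shows "dual_norm s (X0 s \<Omega>) (pairing f) \<le> dual_norm s (Hs s) (pairing f)"
  unfolding dual_norm_def
proof (rule cSUP_subset_mono)
  show "{v \<in> X0 s \<Omega>. Hs_norm s v \<le> 1} \<noteq> {}" 
  proof -
    have "(\<lambda>_. 0) \<in> {v \<in> X0 s \<Omega>. Hs_norm s v \<le> 1}" by (simp add: zero_in_X0 Hs_norm_zero)
    then show ?thesis by blast
  qed
qed (use X0_subset_Hs dual_norm_bdd[OF f] in auto)

lemma pairing_le_dual_norm:
  fixes w :: "'a::euclidean_space \<Rightarrow> real"
  assumes f: "f \<in> Ltwo" and w: "w \<in> X0 s \<Omega>" and m: "w \<in> borel_measurable borel"
  shows "\<bar>pairing f w\<bar> \<le> dual_norm s (X0 s \<Omega>) (pairing f) * Hs_norm s w"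
proof (cases "Hs_norm s w = 0")
  case True
  have "w \<in> Hs s" using w by (simp add: X0_def)
  then have "L2_norm w = 0" using L2_norm_le_Hs_norm[of w s] True by (simp add: antisym)
  then show ?thesis using pairing_Ltwo[OF f, of w] \<open>w \<in> Hs s\<close> True by (simp add: Hs_def)
next
  case False
  define n where "n = Hs_norm s w"
  have n: "n > 0" using False Hs_norm_nonneg[of s w] by (simp add: n_def less_le)
  let ?w = "\<lambda>x. 1 / n * w x"
  have "?w \<in> X0 s \<Omega>"
  proof -
    have "?w \<in> borel_measurable lebesgue" using m by (intro measurable_completion) measurable
    then have "?w \<in> Hs s"
      using w Hs_scale(1)[OF m, of "1 / n"] Hs_scale(2)[OF m, of s "1 / n"] by (auto simp: X0_def Hs_def Ltwo_iff ennreal_mult_less_top)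
    moreover have "AE x in lebesgue. x \<notin> \<Omega> \<longrightarrow> ?w x = 0" using w by (auto simp: X0_def)
    ultimately show ?thesis by (simp add: X0_def)
  qed
  moreover have "Hs_norm s ?w = 1"
    using Hs_scale(3)[OF m, of s "1 / n"] n by (simp add: n_def)
  ultimately have "\<bar>pairing f ?w\<bar> \<le> dual_norm s (X0 s \<Omega>) (pairing f)"
    unfolding dual_norm_def by (intro cSUP_upper dual_norm_bdd f X0_subset_Hs) simp
  moreover have "pairing f ?w = pairing f w / n"
    unfolding pairing_def using integral_mult_right_zero[of lebesgue "1 / n" "\<lambda>x. f x * w x"] by (simp add: mult.left_commute)
  ultimately have "\<bar>pairing f w / n\<bar> \<le> dual_norm s (X0 s \<Omega>) (pairing f)" by simp
  then have "\<bar>pairing f w\<bar> / n \<le> dual_norm s (X0 s \<Omega>) (pairing f)" using n by (simp add: abs_divide)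
  then show ?thesis using n by (simp add: n_def[symmetric] pos_divide_le_eq)
qed

section \<open>Borel representatives\<close>

lemma L2_normsq_cong: "AE x in lborel. u x = v x \<Longrightarrow> L2_normsq u = L2_normsq v"
  unfolding L2_normsq_def nn_integral_completion by (rule nn_integral_cong_AE) auto

text \<open>
  The exceptional null set \<open>N\<close> enters as \<open>N \<times> UNIV\<close> and \<open>UNIV \<times> N\<close>, both null in the product.
\<close>
lemma gagliardo_sq_cong:
  fixes u v :: "'a::euclidean_space \<Rightarrow> real"
  assumes "AE x in lborel. u x = v x" shows "gagliardo_sq s u = gagliardo_sq s v"
proof -
  obtain N where "{x \<in> space lborel. u x \<noteq> v x} \<subseteq> N" "emeasure lborel N = 0" and N[measurable]: "N \<in> sets lborel"
    using assms by (rule AE_E)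
  then have n: "emeasure lborel N = 0" "{x. u x \<noteq> v x} \<subseteq> N" by simp_all
  have N0: "AE x in lborel. x \<notin> N" using N n by (intro AE_not_in) auto
  have "AE q in (lborel \<Otimes>\<^sub>M lborel). fst q \<notin> N \<and> snd q \<notin> N"
  proof (rule lborel_pair.AE_pair_measure)
    show "AE x in lborel. AE y in lborel. fst (x, y) \<notin> N \<and> snd (x, y) \<notin> N"
      using N0 by (auto elim!: eventually_mono)
  qed measurable
  then have "AE q in (lborel :: ('a \<times> 'a) measure). u (fst q) = v (fst q) \<and> u (snd q) = v (snd q)"
    unfolding lborel_prod by (rule eventually_mono) (use n(2) in auto)
  then show ?thesis
    unfolding gagliardo_sq_def nn_integral_completion
    by (intro nn_integral_cong_AE, elim eventually_mono) (simp add: case_prod_unfold)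
qed

lemma half_frac_laplacian_cong:
  assumes "AE x in lborel. u x = v x" and [measurable]: "u \<in> borel_measurable lebesgue" "v \<in> borel_measurable lebesgue"
  shows "half_frac_laplacian s u = half_frac_laplacian s v"
proof -
  have "fourier_L2 (\<lambda>x. complex_of_real (u x)) = fourier_L2 (\<lambda>x. complex_of_real (v x))"
    using assms(1) by (intro fourier_L2_cong) (auto simp: AE_completion_iff)
  then show ?thesis by (simp add: half_frac_laplacian_def fourier_multiplier_def)
qed

lemma X0_cong:
  assumes "AE x in lborel. u x = v x" and u: "u \<in> X0 s \<Omega>" and v: "v \<in> borel_measurable lebesgue"
  shows "v \<in> X0 s \<Omega>"
proof -
  have "AE x in lborel. x \<notin> \<Omega> \<longrightarrow> u x = 0" using u by (simp add: X0_def AE_completion_iff)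
  with assms(1) have "AE x in lborel. x \<notin> \<Omega> \<longrightarrow> v x = 0" by eventually_elim auto
  then show ?thesis
    using u v L2_normsq_cong[OF assms(1)] gagliardo_sq_cong[OF assms(1), of s]
    by (simp add: X0_def Hs_def Ltwo_iff AE_completion_iff)
qed

lemma weak_solution_cong:
  assumes "AE x in lborel. u x = v x" and u: "weak_solution s \<Omega> f u" and v: "v \<in> borel_measurable lebesgue"
  shows "weak_solution s \<Omega> f v"
proof -
  have "u \<in> borel_measurable lebesgue" using u by (simp add: weak_solution_def X0_def Hs_def Ltwo_iff)
  then have "half_frac_laplacian s u = half_frac_laplacian s v"
    by (intro half_frac_laplacian_cong assms)
  then show ?thesis using u X0_cong[OF assms(1) _ v] by (simp add: weak_solution_def)
qed

lemma AE_lborel_shift: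
  fixes h :: "'a::euclidean_space"
  assumes "AE x in lborel. P x" shows "AE x in lborel. P (x + h)"
proof -
  have "AE x in distr lborel borel ((+) h). P x" using assms by (simp only: lborel_distr_plus)
  from AE_distrD[OF _ this] show ?thesis by (simp add: add.commute)
qed

lemma borel_representative:
  fixes u :: "'a::euclidean_space \<Rightarrow> real"
  assumes u: "u \<in> X0 s \<Omega>" and "open \<Omega>"
  obtains v where "v \<in> borel_measurable borel" "AE x in lborel. u x = v x" "\<And>x. x \<notin> \<Omega> \<Longrightarrow> v x = 0"
proof -
  have "u \<in> borel_measurable lebesgue" using u by (simp add: X0_def Hs_def Ltwo_iff)
  then obtain u0 where u0: "u0 \<in> borel_measurable lborel" "AE x in lborel. u x = u0 x"
    using completion_ex_borel_measurable_real by blast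
  have z: "AE x in lborel. x \<notin> \<Omega> \<longrightarrow> u x = 0" using u by (simp add: X0_def AE_completion_iff)
  have [measurable]: "u0 \<in> borel_measurable borel" "\<Omega> \<in> sets borel" using u0 \<open>open \<Omega>\<close> by auto
  show thesis
  proof
    show "(\<lambda>x. indicator \<Omega> x * u0 x) \<in> borel_measurable borel" by measurable
    show "AE x in lborel. u x = indicator \<Omega> x * u0 x"
      using u0(2) z by eventually_elim (auto simp: indicator_def)
  qed simp
qed

section \<open>The regularity estimates\<close>

lemma finite_energy_Hs:
  fixes u :: "'a::euclidean_space \<Rightarrow> real"
  assumes s: "0 < s" "s < 1" and [measurable]: "u \<in> borel_measurable borel" and u: "u \<in> Hs s"
    and bd: "bounded {x. u x \<noteq> 0}"
  shows "finite_energy s u"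
proof
  have "L2_normsq u < \<infinity>" and g: "gagliardo_sq s u < \<infinity>" using u by (auto simp: Hs_def Ltwo_iff)
  then show i2: "integrable lborel (\<lambda>x. (u x)\<^sup>2)"
    by (simp add: L2_normsq_def nn_integral_completion integrable_iff_bounded)
  show "gag s u < \<infinity>" using g by (simp add: gagliardo_sq_eq_gag)
  obtain R where R: "\<And>x. u x \<noteq> 0 \<Longrightarrow> norm x \<le> R" using bd by (auto simp: bounded_iff)
  have "integrable lborel (indicator (cball (0::'a) R) :: 'a \<Rightarrow> real)"
    using emeasure_lborel_cball_finite[of "0::'a" R] by (intro integrable_real_indicator) auto
  then have "integrable lborel (\<lambda>x. indicator (cball 0 R) x + (u x)\<^sup>2)" using i2 by simp
  then show "integrable lborel u"
  proof (rule Bochner_Integration.integrable_bound)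
    have "\<bar>u x\<bar> \<le> indicator (cball 0 R) x + (u x)\<^sup>2" for x
    proof (cases "u x = 0")
      case False
      have "0 \<le> (\<bar>u x\<bar> - 1/2)\<^sup>2" by simp
      then have "\<bar>u x\<bar> \<le> 1 + (u x)\<^sup>2" by (simp add: power2_eq_square algebra_simps)
      then show ?thesis using R[OF False] by simp
    qed simp
    then show "AE x in lborel. norm (u x) \<le> norm (indicator (cball 0 R) x + (u x)\<^sup>2)"
      by (intro AE_I2) (metis abs_ge_self order_trans real_norm_def)
  qed measurable
qed (use s in auto)

lemma finite_energy_uminus:
  assumes "finite_energy s u" shows "finite_energy s (\<lambda>x. - u x)"
proof -
  interpret finite_energy s u by fact
  have "gag s (\<lambda>x. - u x) = gag s u" unfolding gag_def by (simp add: abs_minus_commute)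
  then show ?thesis
    using s integrable integrable_sq gag_finite by unfold_locales auto
qed

lemma weak_solution_energy:
  fixes u v :: "'a::euclidean_space \<Rightarrow> real"
  assumes ws: "weak_solution s \<Omega> f u" and v: "v \<in> X0 s \<Omega>" and fe: "finite_energy s u" "finite_energy s v"
    and bd: "bounded {x. u x \<noteq> 0}" "bounded {x. v x \<noteq> 0}"
  shows "energy_const (real DIM('a)) s *
        (enn2real (gag s (\<lambda>x. u x + v x)) - enn2real (gag s u) - enn2real (gag s v)) / 2 = pairing f v"
  using ws v half_frac_laplacian_form[OF fe bd] of_real_eq_iff unfolding weak_solution_def by metis

definition poincare_const :: "'a::euclidean_space itself \<Rightarrow> real \<Rightarrow> real \<Rightarrow> real" where
  "poincare_const _ s d = (d + 3) powr (real DIM('a) + 2 * s) / unit_ball_vol (real DIM('a))"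

definition shift_const :: "'a::euclidean_space itself \<Rightarrow> real" where
  "shift_const _ = 4 * 2 ^ DIM('a) / unit_ball_vol (real DIM('a))"

text \<open>
  The \<open>C\<close> in \<open>E(T u) \<le> (1 + C \<bar>h\<bar> powr s) E(u)\<close>.
\<close>
definition convexity_const :: "'a::euclidean_space itself \<Rightarrow> real \<Rightarrow> real \<Rightarrow> real" where
  "convexity_const T s L = 1 + 2 * L + 2 * enn2real (commutator_const T s L) * shift_const T"

definition L2_const :: "'a::euclidean_space itself \<Rightarrow> real \<Rightarrow> real \<Rightarrow> real" where
  "L2_const T s d = shift_const T * (1 + poincare_const T s d) / (energy_const (real DIM('a)) s)\<^sup>2"

definition Hs_const :: "'a::euclidean_space itself \<Rightarrow> real \<Rightarrow> real \<Rightarrow> real \<Rightarrow> real" where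
  "Hs_const T s L d = (convexity_const T s L * sqrt (poincare_const T s d) + 2 * sqrt (shift_const T))
     * sqrt (1 + poincare_const T s d) / (energy_const (real DIM('a)) s)\<^sup>2"

text \<open>
  The theorem for a Borel solution that vanishes everywhere outside \<open>\<Omega>\<close>, with the constants made explicit.
\<close>
lemma translation_estimates:
  fixes u f \<phi> :: "'a::euclidean_space \<Rightarrow> real"
  assumes s: "0 < s" "s < 1" and \<Omega>: "bounded \<Omega>" and f: "f \<in> Ltwo" and h: "norm h < 1"
    and lip: "L-lipschitz_on UNIV \<phi>" and \<phi>: "\<And>x. 0 \<le> \<phi> x" "\<And>x. \<phi> x \<le> 1" and \<phi>bd: "bounded {x. \<phi> x \<noteq> 0}"
    and ws: "weak_solution s \<Omega> f u" and X: "(\<lambda>x. \<phi> x * shift h u x) \<in> X0 s \<Omega>"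
    and um[measurable]: "u \<in> borel_measurable borel" and u0: "\<And>x. x \<notin> \<Omega> \<Longrightarrow> u x = 0"
  defines "D \<equiv> dual_norm s (X0 s \<Omega>) (pairing f)"
  shows "L2_normsq (\<lambda>x. local_shift \<phi> h u x - u x) \<le> L2_normsq (\<lambda>x. shift h u x - u x)"
    and "L2_normsq (\<lambda>x. shift h u x - u x) \<le> ennreal (L2_const TYPE('a) s (diameter \<Omega>) * norm h powr (2 * s) * D\<^sup>2)"
    and "gagliardo_sq s (\<lambda>x. local_shift \<phi> h u x - u x)
       \<le> ennreal (Hs_const TYPE('a) s L (diameter \<Omega>) * norm h powr s * L2_norm f * dual_norm s (Hs s) (pairing f))"
proof -
  let ?T = "local_shift \<phi> h u"
  let ?v = "\<lambda>x. ?T x - u x"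
  define c where "c = energy_const (real DIM('a)) s"
  have c: "c > 0" unfolding c_def using s by (intro energy_const_pos) auto
  define P where "P = poincare_const TYPE('a) s (diameter \<Omega>)"
  have P: "P \<ge> 0" unfolding P_def poincare_const_def by (intro divide_nonneg_nonneg) auto
  define K where "K = shift_const TYPE('a)"
  have K: "K \<ge> 0" by (simp add: K_def shift_const_def)
  have L: "L \<ge> 0" using lip by (rule lipschitz_on_nonneg)
  have [measurable]: "\<phi> \<in> borel_measurable borel"
    using lipschitz_on_continuous_on[OF lip] by (rule borel_measurable_continuous_onI)
  have Tm[measurable]: "?T \<in> borel_measurable borel" unfolding local_shift_def[abs_def] shift_def by measurable
  have veq: "?v x = \<phi> x * (shift h u x - u x)" for x by (simp add: local_shift_def algebra_simps)
  have uX: "u \<in> X0 s \<Omega>" using ws by (simp add: weak_solution_def)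
  then have uH: "u \<in> Hs s" by (simp add: X0_def)
  have ubd: "bounded {x. u x \<noteq> 0}" by (rule bounded_subset[OF \<Omega>]) (use u0 in auto)
  have fu: "finite_energy s u" by (rule finite_energy_Hs[OF s um uH ubd])
  define E where "E = enn2real (gag s u)"
  have E0: "E \<ge> 0" by (simp add: E_def)
  have gE: "gag s u = ennreal E" using finite_energy.gag_finite[OF fu] by (simp add: E_def)
  have td: "translation_defect u h = L2_normsq (\<lambda>x. shift h u x - u x)"
    by (simp add: translation_defect_def L2_normsq_def nn_integral_completion shift_def)
  have td_le: "translation_defect u h \<le> ennreal (K * norm h powr (2 * s) * E)"
    using gag_translation_estimate[OF s(1) um, of h] K E0 unfolding gE
    by (simp add: K_def shift_const_def flip: ennreal_mult)
  \<comment> \<open>testing the equation with the solution; the polarised form at \<open>u, u\<close> is \<open>(4 E - E - E) / 2 = E\<close>\<close>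
  have en_u: "c * E = pairing f u"
  proof -
    have "gag s (\<lambda>x. u x + u x) = ennreal (2\<^sup>2) * gag s u"
      using Hs_scale(2)[OF um, of s 2] by (simp add: gagliardo_sq_eq_gag)
    then have "enn2real (gag s (\<lambda>x. u x + u x)) = 4 * E" by (simp add: E_def enn2real_mult)
    then show ?thesis using weak_solution_energy[OF ws uX fu fu ubd ubd] by (simp add: c_def E_def)
  qed
  have P_le: "L2_normsq u \<le> ennreal (P * E)"
    using fractional_poincare[OF um s(1) \<Omega> u0] P E0 unfolding gE
    by (simp add: P_def poincare_const_def L2_normsq_def nn_integral_completion flip: ennreal_mult)
  have u2: "L2_norm u \<le> sqrt (P * E)"
    unfolding L2_norm_def using P_le P E0 by (intro real_sqrt_le_mono) (simp add: enn2real_leI)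
  have uHn: "Hs_norm s u \<le> sqrt ((1 + P) * E)"
  proof -
    have "L2_normsq u + gagliardo_sq s u \<le> ennreal (P * E) + ennreal E"
      using P_le gE by (intro add_mono) (auto simp: gagliardo_sq_eq_gag)
    also have "\<dots> = ennreal ((1 + P) * E)" using P E0 by (simp add: algebra_simps flip: ennreal_plus)
    finally show ?thesis unfolding Hs_norm_def using P E0 by (intro real_sqrt_le_mono) (simp add: enn2real_leI)
  qed
  have D: "D \<ge> 0" unfolding D_def by (rule dual_norm_X0_nonneg[OF f])
  have DD: "D \<le> dual_norm s (Hs s) (pairing f)" unfolding D_def by (rule dual_norm_X0_le_Hs[OF f])
  have sE: "sqrt E \<le> sqrt (1 + P) * D / c"
  proof -
    have "c * E \<le> D * Hs_norm s u"
      using pairing_le_dual_norm[OF f uX um] en_u by (simp add: D_def)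
    also have "\<dots> \<le> D * (sqrt (1 + P) * sqrt E)"
      using uHn D by (intro mult_left_mono) (auto simp: real_sqrt_mult)
    finally have "(c * sqrt E) * sqrt E \<le> (sqrt (1 + P) * D) * sqrt E"
      using E0 by (simp add: mult_ac real_sqrt_mult_self)
    then have "E = 0 \<or> c * sqrt E \<le> sqrt (1 + P) * D"
      using E0 by (auto simp: mult_le_cancel_right)
    then show ?thesis using c D P by (auto simp: field_simps)
  qed
  show "L2_normsq ?v \<le> L2_normsq (\<lambda>x. shift h u x - u x)"
    unfolding L2_normsq_def
  proof (intro nn_integral_mono ennreal_leI power_mono)
    fix x show "norm (?v x) \<le> norm (shift h u x - u x)"
      unfolding veq using \<phi>[of x] by (simp add: abs_mult mult_left_le_one_le)
  qed simp
  have "E \<le> (sqrt (1 + P) * D / c)\<^sup>2"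
    using power_mono[OF sE, of 2] E0 by simp
  then have E_le: "E \<le> (1 + P) * D\<^sup>2 / c\<^sup>2" using P by (simp add: power_mult_distrib power_divide)
  show "L2_normsq (\<lambda>x. shift h u x - u x) \<le> ennreal (L2_const TYPE('a) s (diameter \<Omega>) * norm h powr (2 * s) * D\<^sup>2)"
  proof -
    have "K * norm h powr (2 * s) * E \<le> K * norm h powr (2 * s) * ((1 + P) * D\<^sup>2 / c\<^sup>2)"
      using E_le K by (intro mult_left_mono) auto
    also have "\<dots> = L2_const TYPE('a) s (diameter \<Omega>) * norm h powr (2 * s) * D\<^sup>2"
      by (simp add: L2_const_def K_def P_def c_def)
    finally show ?thesis using td_le unfolding td by (meson ennreal_leI order_trans)
  qed
  let ?F = "L2_norm f" and ?D' = "dual_norm s (Hs s) (pairing f)"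
  \<comment> \<open>This weight balances the two sides of \<open>gag_local_shift_le\<close>: \<open>\<delta>\<close> itself, and \<open>1 / \<delta>\<close> times the
    translation defect of order \<open>\<delta>\<^sup>2\<close>.\<close>
  define \<delta> where "\<delta> = norm h powr s"
  show "gagliardo_sq s ?v \<le> ennreal (Hs_const TYPE('a) s L (diameter \<Omega>) * norm h powr s * ?F * ?D')"
  proof (cases "h = 0")
    case True
    then have "?v = (\<lambda>_. 0)" by (simp add: local_shift_def shift_def algebra_simps)
    then show ?thesis by simp
  next
    case False
    have \<delta>: "\<delta> > 0" "\<delta> \<le> 1" using False h s by (auto simp: \<delta>_def powr_le1)
    have h\<delta>: "norm h \<le> \<delta>"
      using powr_mono'[of s 1 "norm h"] h s by (simp add: \<delta>_def)
    have \<delta>2: "norm h powr (2 * s) = \<delta>\<^sup>2" by (simp add: \<delta>_def power2_eq_square flip: powr_add)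
    define M where "M = enn2real (commutator_const TYPE('a) s L)"
    have M: "M \<ge> 0" "commutator_const TYPE('a) s L = ennreal M"
      using commutator_const_finite[OF s, where 'a='a, of L] by (auto simp: M_def)
    define B where "B = convexity_const TYPE('a) s L"
    have B: "B = 1 + 2 * L + 2 * M * K" by (simp add: B_def convexity_const_def M_def K_def)
    have TE: "gag s ?T \<le> ennreal (E + B * \<delta> * E)"
    proof -
      have "gag s ?T \<le> ennreal ((1 + \<delta>) * (1 + L * norm h)) * ennreal E + ennreal (1 + 1 / \<delta>) * (ennreal M * translation_defect u h)"
        using gag_local_shift_le[OF um s lip \<phi> \<delta>(1), of h] by (simp add: gE M)
      also have "\<dots> \<le> ennreal ((1 + \<delta>) * (1 + L * norm h)) * ennreal E + ennreal (1 + 1 / \<delta>) * (ennreal M * ennreal (K * \<delta>\<^sup>2 * E))"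
        using td_le unfolding \<delta>2 by (intro add_mono mult_left_mono) auto
      also have "\<dots> = ennreal ((1 + \<delta>) * (1 + L * norm h) * E + (1 + 1 / \<delta>) * (M * (K * \<delta>\<^sup>2 * E)))"
        using \<delta> L M K E0 by (simp add: ennreal_plus ennreal_mult)
      also have "(1 + \<delta>) * (1 + L * norm h) * E + (1 + 1 / \<delta>) * (M * (K * \<delta>\<^sup>2 * E)) \<le> E + B * \<delta> * E"
      proof -
        have "(1 + \<delta>) * (1 + L * norm h) \<le> (1 + \<delta>) * (1 + L * \<delta>)"
          using h\<delta> L \<delta> by (intro mult_left_mono add_mono) auto
        also have "\<dots> \<le> 1 + \<delta> * (1 + 2 * L)"
        proof -
          have "L * (\<delta> * \<delta>) \<le> L * (\<delta> * 1)" using L \<delta> by (intro mult_left_mono) auto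
          then show ?thesis by (simp add: algebra_simps)
        qed
        finally have 1: "(1 + \<delta>) * (1 + L * norm h) \<le> 1 + \<delta> * (1 + 2 * L)" .
        have "(1 + 1 / \<delta>) * \<delta>\<^sup>2 = \<delta>\<^sup>2 + \<delta>" using \<delta> by (simp add: power2_eq_square field_simps)
        also have "\<dots> \<le> 2 * \<delta>" using \<delta> mult_left_le_one_le[of \<delta> \<delta>] by (simp add: power2_eq_square)
        finally have "(M * K) * ((1 + 1 / \<delta>) * \<delta>\<^sup>2) \<le> (M * K) * (2 * \<delta>)"
          using M K by (intro mult_left_mono) auto
        with 1 have "(1 + \<delta>) * (1 + L * norm h) + (M * K) * ((1 + 1 / \<delta>) * \<delta>\<^sup>2) \<le> 1 + B * \<delta>"
          by (simp add: B algebra_simps)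
        from mult_right_mono[OF this E0] show ?thesis by (simp add: algebra_simps)
      qed
      finally show ?thesis by (simp add: ennreal_leI)
    qed
    \<comment> \<open>\<open>?v\<close> is an admissible test function: it has finite energy by the previous bound, and vanishes
      outside \<open>\<Omega>\<close> by the assumption on \<open>\<phi> u\<^sub>h\<close>\<close>
    have Tbd: "bounded {x. ?T x \<noteq> 0}"
      by (rule bounded_subset[OF bounded_Un[THEN iffD2, OF conjI[OF \<phi>bd ubd]]]) (auto simp: local_shift_def)
    have vbd: "bounded {x. ?v x \<noteq> 0}"
      by (rule bounded_subset[OF \<phi>bd]) (auto simp: veq)
    have v_meas: "?v \<in> borel_measurable lebesgue" by (intro measurable_completion) measurable
    have v_fin: "L2_normsq ?v < \<infinity>"
    proof -
      have "L2_normsq ?v \<le> ennreal (K * norm h powr (2 * s) * E)"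
        using \<open>L2_normsq ?v \<le> _\<close> td_le unfolding td by (rule order_trans)
      then show ?thesis by (simp add: less_top order.strict_trans1)
    qed
    have "L2_normsq ?T < \<infinity>"
    proof -
      have "u \<in> borel_measurable lebesgue" by (intro measurable_completion) measurable
      then have "L2_normsq ?T \<le> 2 * L2_normsq u + 2 * L2_normsq ?v"
        using L2_normsq_add_le[OF _ v_meas, of u] by simp
      moreover have "L2_normsq u < top" using uH by (simp add: Hs_def Ltwo_iff)
      ultimately show ?thesis using v_fin by (auto intro: le_less_trans simp: ennreal_mult_less_top)
    qed
    moreover have "gagliardo_sq s ?T < \<infinity>"
      using TE by (simp add: gagliardo_sq_eq_gag less_top order.strict_trans1)
    moreover have "?T \<in> borel_measurable lebesgue" by (intro measurable_completion) measurable
    ultimately have "?T \<in> Hs s" by (simp add: Hs_def Ltwo_iff)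
    then have fT: "finite_energy s ?T" by (rule finite_energy_Hs[OF s Tm _ Tbd])
    have fv: "finite_energy s ?v"
      using finite_energy_add[OF fT finite_energy_uminus[OF fu]] by simp
    have gv: "gagliardo_sq s ?v = gag s ?v" by (rule gagliardo_sq_eq_gag) measurable
    have vX: "?v \<in> X0 s \<Omega>"
    proof -
      have "AE x in lebesgue. x \<notin> \<Omega> \<longrightarrow> \<phi> x * shift h u x = 0" using X by (simp add: X0_def)
      then have "AE x in lebesgue. x \<notin> \<Omega> \<longrightarrow> ?v x = 0"
        by eventually_elim (auto simp: local_shift_def u0)
      then show ?thesis
        using v_meas v_fin finite_energy.gag_finite[OF fv] gv by (simp add: X0_def Hs_def Ltwo_iff)
    qed
    \<comment> \<open>testing the equation with \<open>?v\<close>, for which \<open>u + ?v\<close> is \<open>?T\<close>\<close>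
    have "c * (enn2real (gag s ?T) - E - enn2real (gag s ?v)) / 2 = pairing f ?v"
      using weak_solution_energy[OF ws vX fu fv ubd vbd] by (simp add: c_def E_def)
    then have Ev: "enn2real (gag s ?v) = enn2real (gag s ?T) - E - 2 / c * pairing f ?v"
      using c by (simp add: field_simps)
    have "enn2real (gag s ?T) \<le> E + B * \<delta> * E"
      using TE \<delta> E0 B L M K by (intro enn2real_leI) auto
    then have "enn2real (gag s ?v) \<le> (B * \<delta>) * E + (2 / c) * \<bar>pairing f ?v\<bar>"
      using Ev c abs_ge_minus_self[of "2 / c * pairing f ?v"] by (simp add: abs_mult)
    moreover have "(B * \<delta>) * E \<le> (B * \<delta>) * (?F * (sqrt P * (sqrt (1 + P) * ?D' / c)) / c)"
    proof (rule mult_left_mono)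
      show "E \<le> ?F * (sqrt P * (sqrt (1 + P) * ?D' / c)) / c"
      proof -
        have "c * E \<le> ?F * L2_norm u"
          using pairing_Ltwo[OF f, of u] uH en_u by (simp add: Hs_def)
        also have "\<dots> \<le> ?F * (sqrt P * sqrt E)"
          using u2 by (intro mult_left_mono) (auto simp: real_sqrt_mult)
        also have "\<dots> \<le> ?F * (sqrt P * (sqrt (1 + P) * ?D' / c))"
        proof -
          have "sqrt E \<le> sqrt (1 + P) * ?D' / c"
            using sE mult_left_mono[OF DD, of "sqrt (1 + P)"] c P by (meson divide_right_mono order_trans less_imp_le real_sqrt_ge_zero add_nonneg_nonneg zero_le_one)
          then show ?thesis using P by (intro mult_left_mono) auto
        qed
        finally show ?thesis using c by (simp add: field_simps)
      qed
      show "0 \<le> B * \<delta>" using B L M K \<delta> by simp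
    qed
    moreover have "(2 / c) * \<bar>pairing f ?v\<bar> \<le> (2 / c) * (?F * (sqrt K * \<delta> * (sqrt (1 + P) * ?D' / c)))"
    proof (rule mult_left_mono)
      show "\<bar>pairing f ?v\<bar> \<le> ?F * (sqrt K * \<delta> * (sqrt (1 + P) * ?D' / c))"
      proof -
        have "\<bar>pairing f ?v\<bar> \<le> ?F * L2_norm ?v"
          using vX by (intro pairing_Ltwo f) (simp add: X0_def Hs_def)
        also have "L2_norm ?v \<le> sqrt (K * \<delta>\<^sup>2 * E)"
        proof -
          have "L2_normsq ?v \<le> ennreal (K * \<delta>\<^sup>2 * E)"
            using \<open>L2_normsq ?v \<le> _\<close> td_le unfolding td \<delta>2 by (rule order_trans)
          then show ?thesis unfolding L2_norm_def using K E0 by (intro real_sqrt_le_mono) (simp add: enn2real_leI)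
        qed
        also have "sqrt (K * \<delta>\<^sup>2 * E) = sqrt K * \<delta> * sqrt E" using \<delta> by (simp add: real_sqrt_mult)
        also have "sqrt E \<le> sqrt (1 + P) * ?D' / c"
            using sE mult_left_mono[OF DD, of "sqrt (1 + P)"] c P by (meson divide_right_mono order_trans less_imp_le real_sqrt_ge_zero add_nonneg_nonneg zero_le_one)
        finally show ?thesis using K \<delta> by (simp add: mult_left_mono)
      qed
      show "0 \<le> 2 / c" using c by simp
    qed
    ultimately have "enn2real (gag s ?v) \<le> (B * \<delta>) * (?F * (sqrt P * (sqrt (1 + P) * ?D' / c)) / c) + (2 / c) * (?F * (sqrt K * \<delta> * (sqrt (1 + P) * ?D' / c)))"
      by linarith
    also have "\<dots> = Hs_const TYPE('a) s L (diameter \<Omega>) * \<delta> * ?F * ?D'"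
      using c by (simp add: Hs_const_def B_def P_def K_def c_def power2_eq_square field_simps)
    finally have "ennreal (enn2real (gag s ?v)) \<le> ennreal (Hs_const TYPE('a) s L (diameter \<Omega>) * \<delta> * ?F * ?D')"
      by (rule ennreal_leI)
    moreover have "ennreal (enn2real (gag s ?v)) = gagliardo_sq s ?v"
      using finite_energy.gag_finite[OF fv] by (simp add: gv)
    ultimately show ?thesis by (simp add: \<delta>_def)
  qed
qed

text \<open>
  Passing to a Borel representative that vanishes outside \<open>\<Omega>\<close> changes no quantity in the statement.
\<close>
theorem theorem1:
  shows "\<exists>(C :: real \<Rightarrow> real \<Rightarrow> real \<Rightarrow> real)
          (C' :: real \<Rightarrow> real \<Rightarrow> real \<Rightarrow> real \<Rightarrow> real \<Rightarrow> real).
    \<forall>(s :: real) (\<Omega> :: 'a::euclidean_space set) (f :: 'a \<Rightarrow> real) (h :: 'a)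
      (\<phi> :: 'a \<Rightarrow> real) (u :: 'a \<Rightarrow> real).
      0 < s \<and> s < 1 \<and> open \<Omega> \<and> bounded \<Omega> \<and> f \<in> Ltwo \<and> norm h < 1 \<and>
      \<phi> \<in> W1_infty \<and> continuous_on UNIV \<phi> \<and> (\<forall>x. 0 \<le> \<phi> x \<and> \<phi> x \<le> 1) \<and>
      closure {x. \<phi> x \<noteq> 0} \<subseteq> ball 0 1 \<and>
      weak_solution s \<Omega> f u \<and> (\<lambda>x. \<phi> x * shift h u x) \<in> X0 s \<Omega>
      \<longrightarrow>
      L2_normsq (\<lambda>x. local_shift \<phi> h u x - u x) \<le> L2_normsq (\<lambda>x. shift h u x - u x) \<and>
      L2_normsq (\<lambda>x. shift h u x - u x)
        \<le> ennreal (C s (Lip \<phi>) (diameter \<Omega>) * norm h powr (2 * s) *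
                   (dual_norm s (X0 s \<Omega>) (pairing f))\<^sup>2) \<and>
      (\<forall>\<rho> \<theta>. 0 < \<rho> \<and> 0 < \<theta> \<and> \<theta> < pi / 2 \<and> lipschitz_cone_condition \<rho> \<theta> \<Omega> \<and>
             norm h \<le> \<rho> * sin \<theta> / 4 \<longrightarrow>
         gagliardo_sq s (\<lambda>x. local_shift \<phi> h u x - u x)
           \<le> ennreal (C' s (Lip \<phi>) (diameter \<Omega>) \<rho> \<theta> * norm h powr s *
                      L2_norm f * dual_norm s (Hs s) (pairing f)))"
proof (rule exI[of _ "\<lambda>s L d. L2_const TYPE('a) s d"], rule exI[of _ "\<lambda>s L d \<rho> \<theta>. Hs_const TYPE('a) s L d"],
    intro allI impI, elim conjE)
  fix s :: real and \<Omega> :: "'a set" and f \<phi> u :: "'a \<Rightarrow> real" and h :: 'a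
  assume s: "0 < s" "s < 1" and \<Omega>: "open \<Omega>" "bounded \<Omega>" and f: "f \<in> Ltwo" and h: "norm h < 1"
    and \<phi>W: "\<phi> \<in> W1_infty" "continuous_on UNIV \<phi>" and \<phi>: "\<forall>x. 0 \<le> \<phi> x \<and> \<phi> x \<le> 1"
    and supp: "closure {x. \<phi> x \<noteq> 0} \<subseteq> ball 0 1"
    and ws: "weak_solution s \<Omega> f u" and X: "(\<lambda>x. \<phi> x * shift h u x) \<in> X0 s \<Omega>"
  obtain L where "L-lipschitz_on UNIV \<phi>" using W1_infty_lipschitz[OF \<phi>W] .
  then have lip: "(Lip \<phi>)-lipschitz_on UNIV \<phi>" by (rule Lip_lipschitz)
  have "{x. \<phi> x \<noteq> 0} \<subseteq> ball 0 1" using closure_subset supp by (rule order_trans)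
  then have \<phi>bd: "bounded {x. \<phi> x \<noteq> 0}" by (rule bounded_subset[OF bounded_ball])
  have [measurable]: "\<phi> \<in> borel_measurable borel" using \<phi>W(2) by (rule borel_measurable_continuous_onI)
  obtain w where w[measurable]: "w \<in> borel_measurable borel" and uw: "AE x in lborel. u x = w x"
    and w0: "\<And>x. x \<notin> \<Omega> \<Longrightarrow> w x = 0"
    using borel_representative[of u s \<Omega>] ws \<Omega>(1) by (auto simp: weak_solution_def)
  have uwh: "AE x in lborel. shift h u x = shift h w x"
    unfolding shift_def by (rule AE_lborel_shift[OF uw])
  have wsw: "weak_solution s \<Omega> f w"
    by (rule weak_solution_cong[OF uw ws]) (intro measurable_completion, measurable)
  have Xw: "(\<lambda>x. \<phi> x * shift h w x) \<in> X0 s \<Omega>"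
  proof (rule X0_cong[OF _ X])
    show "AE x in lborel. \<phi> x * shift h u x = \<phi> x * shift h w x" using uwh by eventually_elim simp
    show "(\<lambda>x. \<phi> x * shift h w x) \<in> borel_measurable lebesgue"
      unfolding shift_def by (intro measurable_completion) measurable
  qed
  have "AE x in lborel. shift h u x - u x = shift h w x - w x"
    using uw uwh by eventually_elim simp
  note shift_eq = L2_normsq_cong[OF this]
  have "AE x in lborel. local_shift \<phi> h u x - u x = local_shift \<phi> h w x - w x"
    using uw uwh by eventually_elim (simp add: local_shift_def)
  note local_eq = L2_normsq_cong[OF this] gagliardo_sq_cong[OF this, of s]
  have \<phi>': "0 \<le> \<phi> x" "\<phi> x \<le> 1" for x using \<phi> by auto
  note main = translation_estimates[OF s \<Omega>(2) f h lip \<phi>' \<phi>bd wsw Xw w w0]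
  show "L2_normsq (\<lambda>x. local_shift \<phi> h u x - u x) \<le> L2_normsq (\<lambda>x. shift h u x - u x) \<and>
      L2_normsq (\<lambda>x. shift h u x - u x)
        \<le> ennreal (L2_const TYPE('a) s (diameter \<Omega>) * norm h powr (2 * s) *
                   (dual_norm s (X0 s \<Omega>) (pairing f))\<^sup>2) \<and>
      (\<forall>\<rho> \<theta>. 0 < \<rho> \<and> 0 < \<theta> \<and> \<theta> < pi / 2 \<and> lipschitz_cone_condition \<rho> \<theta> \<Omega> \<and>
             norm h \<le> \<rho> * sin \<theta> / 4 \<longrightarrow>
         gagliardo_sq s (\<lambda>x. local_shift \<phi> h u x - u x)
           \<le> ennreal (Hs_const TYPE('a) s (Lip \<phi>) (diameter \<Omega>) * norm h powr s *
                      L2_norm f * dual_norm s (Hs s) (pairing f)))"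
    unfolding shift_eq local_eq using main by blast
qed

end
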